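(* Let $(X,\mathcal B,\mu,\mathcal T)$ be a finitary factor of an iid system with factor map $\pi$ and coding radius $R$, and let $\Gamma_n=[0,n-1]^d\cap\mathbb Z^d$ for $n\ge 1$. Let $v\in C(X)$ with $\mathbb E_\mu[v]=0$ and let $\epsilon\in(0,d/2)$. Suppose there exists $q\ge3$ such that $v$ is $p$-regular and $\mathbb E[R^s]<\infty$ for some parameters $p$ and $s$ satisfying $$p\ge h_\epsilon(q)\qquad\text{and}\qquad s>\big(h_\epsilon(q)+1\big)\big(q+d/(p+1)\big),$$ where $$h_\epsilon(q)=\Big(\frac32-\frac1q\Big)d+\Big(\frac{d^2}{\epsilon}-2d\Big)\Big(\frac{q+1}{q}\Big)-\frac12 .$$ If $\sigma_v^2=\sum_{i\in\mathbb Z^d}\mathbb E_\mu[v\,(v\circ T^i)]$ is positive, then there is $C>0$ such that for any $n\ge1$, $$\sup_{t\in\mathbb R}\bigg|\mu\bigg(\frac{\sum_{i\in\Gamma_n}v\circ T^i}{n^{d/2}}\le t\bigg)-\Phi(t/\sigma_v)\bigg|\le C\max\{n^{-d/2+\epsilon},n^{-1}\},$$ where $\sigma_v=\sqrt{\sigma_v^2}$ and $\Phi$ is the cumulative distribution function of a standard Gaussian.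
   Context: Let $A$ be a finite alphabet and $d$ a positive integer. The space $A^{\mathbb Z^d}$ carries the prodiscrete topology and the shift operators $(T^ix)_j=x_{i+j}$, $i,j\in\mathbb Z^d$; $\mathcal T=\{T^i\}_{i\in\mathbb Z^d}$. $X\subseteq A^{\mathbb Z^d}$ is a closed shift-invariant set (subshift), $\mathcal B$ its Borel $\sigma$-algebra, and $\mu$ a $\mathcal T$-invariant probability measure on $(X,\mathcal B)$. $C(X)$ is the space of continuous functions $X\to\mathbb R$, and $\mathbb E_\mu$ is expectation with respect to $\mu$. For $k\ge0$, $B_k=[-k,k]^d\cap\mathbb Z^d$. For bounded $v\colon X\to\mathbb R$, $\delta_k(v)=\sup\{|v(x)-v(x')|: x,x'\in X,\ x|_{B_k}=x'|_{B_k}\}$. For $p\ge0$, $v\in C(X)$ is $p$-regular if $\sum_{k=1}^\infty k^p\delta_k(v)<\infty$. An iid system is a tuple $(\Lambda^{\mathbb Z^d},\mathcal F^{\otimes\mathbb Z^d},\mathbb P^{\mathbb Z^d},\mathcal S)$ where $(\Lambda,\mathcal F,\mathbb P)$ is a standard Borel probability space and $\mathcal S=\{S^i\}_{i\in\mathbb Z^d}$ is the group of shifts, $(S^iy)_j=y_{i+j}$. The system $(X,\mathcal B,\mu,\mathcal T)$ is a finitary factor of an iid system if there exist an iid system and a shift-invariant $G_\delta$ set $Y\subseteq\Lambda^{\mathbb Z^d}$ with $\mathbb P^{\mathbb Z^d}(Y)=1$ such that, with $\mathcal A$ the $\sigma$-algebra induced by $\mathcal F^{\otimes \mathbb Z^d}$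 on $Y$: (I) there is an $\mathcal A$-measurable map $\pi\colon Y\to X$ (factor map) with $\pi_*(\mathbb P^{\mathbb Z^d}|_Y)=\mu$ and $T^i\circ\pi=\pi\circ S^i$ for all $i\in\mathbb Z^d$; (II) there is an $\mathcal A$-measurable function $R\colon Y\to\mathbb Z_{\ge0}$ (coding radius of $\pi$) such that whenever $y,y'\in Y$ satisfy $y|_{B_{R(y)}}=y'|_{B_{R(y)}}$, then $(\pi y)_{\mathbf 0}=(\pi y')_{\mathbf 0}$. $\mathbb E$ without subscript is expectation with respect to $\mathbb P^{\mathbb Z^d}$. The paper notes that under the hypotheses of the theorem the series defining $\sigma_v^2$ converges and is non-negative. *)

theory Defs
  imports "HOL-Probability.Probability"
begin

text \<open>The lattice Z^d is the type \<open>int ^ 'd\<close>, with d = \<open>CARD('d)\<close>; configurations are functions on it.\<close>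

definition shift_by :: "int ^ 'd \<Rightarrow> (int ^ 'd \<Rightarrow> 'b) \<Rightarrow> (int ^ 'd \<Rightarrow> 'b)"
  where "shift_by i x = (\<lambda>j. x (i + j))"

definition centered_box :: "nat \<Rightarrow> (int ^ 'd) set"
  where "centered_box k = {i. \<forall>m. - int k \<le> i $ m \<and> i $ m \<le> int k}"

definition corner_box :: "nat \<Rightarrow> (int ^ 'd) set"
  where "corner_box n = {i. \<forall>m. 0 \<le> i $ m \<and> i $ m \<le> int n - 1}"

definition borel_of :: "'b topology \<Rightarrow> 'b measure"
  where "borel_of T = sigma (topspace T) {U. openin T U}"

definition polish_topology :: "'b topology \<Rightarrow> bool"
  where "polish_topology T \<longleftrightarrow> completely_metrizable_space T \<and> second_countable T"

definition config_topology :: "'b topology \<Rightarrow> (int ^ 'd \<Rightarrow> 'b) topology"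
  where "config_topology T = product_topology (\<lambda>_. T) UNIV"

definition prodiscrete :: "(int ^ 'd \<Rightarrow> 'a) topology"
  where "prodiscrete = config_topology (discrete_topology UNIV)"

definition subshift :: "(int ^ 'd \<Rightarrow> 'a::finite) set \<Rightarrow> bool"
  where "subshift X \<longleftrightarrow> closedin prodiscrete X \<and> (\<forall>i. shift_by i ` X = X)"

definition invariant_prob :: "(int ^ 'd \<Rightarrow> 'a::finite) set \<Rightarrow> (int ^ 'd \<Rightarrow> 'a) measure \<Rightarrow> bool"
  where "invariant_prob X \<mu> \<longleftrightarrow>
    prob_space \<mu> \<and> space \<mu> = X \<and> sets \<mu> = sets (borel_of (subtopology prodiscrete X)) \<and>
    (\<forall>i. distr \<mu> \<mu> (shift_by i) = \<mu>)"

text \<open>Functions on X are represented by total functions; only their values on X matter.\<close>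

definition continuous_fun_on :: "(int ^ 'd \<Rightarrow> 'a::finite) set \<Rightarrow> ((int ^ 'd \<Rightarrow> 'a) \<Rightarrow> real) \<Rightarrow> bool"
  where "continuous_fun_on X v \<longleftrightarrow> continuous_map (subtopology prodiscrete X) euclideanreal v"

definition osc :: "(int ^ 'd \<Rightarrow> 'a::finite) set \<Rightarrow> ((int ^ 'd \<Rightarrow> 'a) \<Rightarrow> real) \<Rightarrow> nat \<Rightarrow> real"
  where "osc X v k =
    Sup {\<bar>v x - v x'\<bar> | x x'. x \<in> X \<and> x' \<in> X \<and> (\<forall>j\<in>centered_box k. x j = x' j)}"

text \<open>The series over k \<ge> 1 is indexed by k + 1 with k \<ge> 0.\<close>

definition regular_fun ::
  "(int ^ 'd \<Rightarrow> 'a::finite) set \<Rightarrow> real \<Rightarrow> ((int ^ 'd \<Rightarrow> 'a) \<Rightarrow> real) \<Rightarrow> bool"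
  where "regular_fun X p v \<longleftrightarrow>
    0 \<le> p \<and> continuous_fun_on X v \<and> summable (\<lambda>k. real (Suc k) powr p * osc X v (Suc k))"

text \<open>
  A standard Borel probability space is given together with a Polish topology \<open>L\<close> on its carrier
  that generates its sigma-algebra; the G-delta condition on \<open>Y\<close> below refers to the product of
  this topology.
\<close>

definition standard_borel_prob :: "'l topology \<Rightarrow> 'l measure \<Rightarrow> bool"
  where "standard_borel_prob L P \<longleftrightarrow>
    polish_topology L \<and> prob_space P \<and> space P = topspace L \<and> sets P = sets (borel_of L)"

definition iid_measure :: "'l measure \<Rightarrow> (int ^ 'd \<Rightarrow> 'l) measure"
  where "iid_measure P = Pi\<^sub>M UNIV (\<lambda>_. P)"

text \<open>
  \<open>(X, \<mu>)\<close> is a finitary factor, with factor map \<open>\<pi>\<close> defined on \<open>Y\<close> and coding radius \<open>R\<close>,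
  of the iid system over \<open>P\<close>. Values of \<open>\<pi>\<close> and \<open>R\<close> outside \<open>Y\<close> are irrelevant.
\<close>

definition finitary_factor ::
  "'l topology \<Rightarrow> 'l measure \<Rightarrow> (int ^ 'd \<Rightarrow> 'l) set \<Rightarrow>
   ((int ^ 'd \<Rightarrow> 'l) \<Rightarrow> (int ^ 'd \<Rightarrow> 'a::finite)) \<Rightarrow> ((int ^ 'd \<Rightarrow> 'l) \<Rightarrow> nat) \<Rightarrow>
   (int ^ 'd \<Rightarrow> 'a) set \<Rightarrow> (int ^ 'd \<Rightarrow> 'a) measure \<Rightarrow> bool"
  where "finitary_factor L P Y \<pi> R X \<mu> \<longleftrightarrow>
    subshift X \<and> invariant_prob X \<mu> \<and> standard_borel_prob L P \<and>
    gdelta_in (config_topology L) Y \<and> (\<forall>i. shift_by i ` Y = Y) \<and> measure (iid_measure P) Y = 1 \<and>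
    \<pi> \<in> restrict_space (iid_measure P) Y \<rightarrow>\<^sub>M \<mu> \<and>
    distr (restrict_space (iid_measure P) Y) \<mu> \<pi> = \<mu> \<and>
    (\<forall>i. \<forall>y\<in>Y. shift_by i (\<pi> y) = \<pi> (shift_by i y)) \<and>
    R \<in> restrict_space (iid_measure P) Y \<rightarrow>\<^sub>M count_space UNIV \<and>
    (\<forall>y\<in>Y. \<forall>y'\<in>Y. (\<forall>j\<in>centered_box (R y). y j = y' j) \<longrightarrow> \<pi> y 0 = \<pi> y' 0)"

text \<open>
  The sum over the lattice is unconditional; \<open>infsum\<close> is 0 when the family is not summable, so a
  positive value entails convergence.
\<close>

definition asymp_var :: "(int ^ 'd \<Rightarrow> 'a::finite) measure \<Rightarrow> ((int ^ 'd \<Rightarrow> 'a) \<Rightarrow> real) \<Rightarrow> real"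
  where "asymp_var \<mu> v = (\<Sum>\<^sub>\<infinity>i. (\<integral>x. v x * v (shift_by i x) \<partial>\<mu>))"

definition h_exp :: "real \<Rightarrow> real \<Rightarrow> real \<Rightarrow> real"
  where "h_exp d \<epsilon> q = (3 / 2 - 1 / q) * d + (d\<^sup>2 / \<epsilon> - 2 * d) * ((q + 1) / q) - 1 / 2"

end

theory Submission
  imports Defs
begin

text \<open>
  Read through \<open>\<pi>\<close>, the sums are sums of a bounded stationary field on an iid configuration whose
  value at a site is changed little, in mean, when the configuration is resampled outside a large
  ball: if the ball has radius \<open>k\<close>, the regularity of \<open>v\<close> controls the error on the event that the
  coding radii of the sites within distance \<open>k'\<close>, about \<open>k powr (H / (p + 1))\<close>, are at most \<open>k - k'\<close>,
  and Markov's inequality controls the rest. The error is \<open>O(k powr -H)\<close> with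
  \<open>H = h_exp d \<epsilon> q + 1\<close>. Splicing two independent configurations turns this into decorrelation of
  functions of distant parts of the field.

  Stein's method for locally dependent bounded variables, with neighbourhoods of radius \<open>m\<close> and
  smoothed indicators, then applies directly, without passing to an \<open>m\<close>-dependent field. It gives a
  Kolmogorov distance of order \<open>m^(2d) n^(-d/2) + m^(-\<kappa>)\<close> plus the relative error of the variance,
  where any \<open>\<kappa> < H - d\<close> is allowed. With \<open>m\<close> about \<open>n powr (\<epsilon> / (2 d))\<close> both terms are
  \<open>O(n powr (-d/2 + \<epsilon>))\<close>, since then \<open>n powr (-d/2 + \<epsilon>) = m powr -(d^2/\<epsilon> - 2 d)\<close>; the boundary of the
  box contributes the \<open>1/n\<close>.
\<close>

subsection \<open>Gaussian tails, the Stein equation and smoothing\<close>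

text \<open>The radius \<open>m\<close> is dictated by the remainder of Stein's expansion:
  \<open>n^d\<close> sites, each contributing a product of \<open>1/s\<close>, \<open>m^d/s\<close>
  and \<open>m^d/s\<close>, with \<open>s\<close> of order \<open>n^(d/2)\<close>. This is
  \<open>m^(2d) n^(-d/2)\<close>; the fluctuation of the local quadratic sums is smaller, of order
  \<open>m^(3d/2) n^(-d/2)\<close>. Keeping the remainder below \<open>n^(-d/2 + \<epsilon>)\<close>
  gives the exponent \<open>\<epsilon>/(2d)\<close>. Put \<open>D = d^2/\<epsilon> - 2 d\<close>.
  Since \<open>q \<ge> 3\<close>, \<open>H \<ge> D + d + 1/2 + d/6\<close>. The share
  \<open>D\<close> is the decay in \<open>m\<close> that the rate demands, \<open>d\<close> is lost
  in summing over the lattice, and the surplus yields a first moment of the covariances for the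
  boundary term once \<open>D \<ge> 1/2\<close>. The field has no finite range, so no term vanishes
  by independence. Each use of independence becomes a comparison of two configurations that agree on
  a ball. The comparison holds only in mean, hence the bounded test functions throughout.\<close>

abbreviation (input) gauss :: "real measure" where "gauss \<equiv> std_normal_distribution"

lemma std_normal_density_le_1: "std_normal_density x \<le> 1"
proof -
  have 1: "1 \<le> sqrt (2 * pi)" using pi_gt3 by (simp add: real_le_rsqrt)
  have "exp (- x\<^sup>2 / 2) \<le> 1" by simp
  hence "exp (- x\<^sup>2 / 2) \<le> sqrt (2 * pi)" using 1 by linarith
  thus ?thesis unfolding std_normal_density_def
    using 1 by (simp add: divide_simps)
qed

interpretation gauss: prob_space gauss
  by (rule prob_space_normal_density) simp

interpretation gauss: real_distribution gauss
  by standard auto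

lemma std_normal_measure_Ioc_le:
  assumes "a \<le> b" shows "measure gauss {a<..b} \<le> b - a"
proof -
  have "emeasure gauss {a<..b} = (\<integral>\<^sup>+x. ennreal (std_normal_density x) * indicator {a<..b} x \<partial>lborel)"
    by (subst emeasure_density) auto
  also have "\<dots> \<le> (\<integral>\<^sup>+x. indicator {a<..b} x \<partial>lborel)"
    by (intro nn_integral_mono) (auto simp: indicator_def std_normal_density_le_1)
  also have "\<dots> = ennreal (b - a)" using assms by simp
  finally show ?thesis using assms by (simp add: gauss.emeasure_eq_measure)
qed

lemma std_normal_cdf_diff_le:
  assumes "a \<le> b" shows "cdf gauss b - cdf gauss a \<le> b - a"
proof (cases "a = b")
  case False
  hence "cdf gauss b - cdf gauss a = measure gauss {a<..b}"
    using assms by (intro gauss.cdf_diff_eq) auto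
  thus ?thesis using std_normal_measure_Ioc_le[OF assms] by simp
qed simp

lemma std_normal_deriv:
  "(std_normal_density has_real_derivative - x * std_normal_density x) (at x)"
  unfolding std_normal_density_def
  by (auto intro!: derivative_eq_intros simp: field_simps power2_eq_square)

text \<open>On the tail \<open>w \<le> x\<close>, and the density is minus an antiderivative of
  \<open>x\<close> times itself.\<close>

lemma std_normal_Mills:
  assumes "0 < w"
  shows "w * measure gauss {w..} \<le> std_normal_density w"
proof -
  have lim: "((\<lambda>x. - std_normal_density x) \<longlongrightarrow> 0) at_top"
    unfolding std_normal_density_def by real_asymp
  have "(\<integral>\<^sup>+x. ennreal (x * std_normal_density x) * indicator {w..} x \<partial>lborel) = ennreal (0 - - std_normal_density w)"
    by (rule nn_integral_FTC_atLeast[OF _ _ _ lim])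
       (use assms in \<open>auto intro!: derivative_eq_intros std_normal_deriv[THEN DERIV_cong]\<close>)
  moreover have "ennreal w * emeasure gauss {w..} \<le> (\<integral>\<^sup>+x. ennreal (x * std_normal_density x) * indicator {w..} x \<partial>lborel)"
    by (subst emeasure_density, simp, simp, subst nn_integral_cmult[symmetric], simp)
       (use assms in \<open>intro nn_integral_mono, auto simp: indicator_def ennreal_mult'[symmetric] mult_right_mono intro!: ennreal_leI\<close>)
  ultimately show ?thesis
    using assms by (simp add: gauss.emeasure_eq_measure ennreal_mult'[symmetric])
qed

lemma std_normal_reflect: "measure gauss {..-w} = measure gauss {w..}"
proof -
  have "emeasure gauss {..-w} = (\<integral>\<^sup>+x. ennreal (std_normal_density x) * indicator {..-w} x \<partial>lborel)"
    by (subst emeasure_density) auto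
  also have "\<dots> = (\<integral>\<^sup>+x. ennreal (std_normal_density (-x)) * indicator {..-w} (-x) \<partial>lborel)"
    by (subst nn_integral_real_affine[where c="-1" and t=0]) auto
  also have "\<dots> = (\<integral>\<^sup>+x. ennreal (std_normal_density x) * indicator {w..} x \<partial>lborel)"
    by (intro nn_integral_cong) (auto simp: indicator_def std_normal_density_def)
  also have "\<dots> = emeasure gauss {w..}" by (subst emeasure_density) auto
  finally show ?thesis by (simp add: gauss.emeasure_eq_measure)
qed

text \<open>The integral of \<open>h - c\<close> against the density up to \<open>w\<close>, divided
  by the density at \<open>w\<close>, solves the equation. Because \<open>h\<close> has values
  between 0 and 1, the bounds are absolute and do not see how steep \<open>h\<close> is; continuity
  of \<open>h\<close> gives a derivative at every point, as the mean value theorem requires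
  later.\<close>

lemma stein_solution:
  fixes h :: "real \<Rightarrow> real"
  assumes cont: "continuous_on UNIV h" and h01: "\<And>x. 0 \<le> h x" "\<And>x. h x \<le> 1"
  defines "c \<equiv> (\<integral>x. h x \<partial>gauss)"
  obtains f f' where "\<And>w. (f has_real_derivative f' w) (at w)"
    "\<And>w. f' w = w * f w + (h w - c)" "\<And>w. \<bar>f w\<bar> \<le> 6" "\<And>w. \<bar>f' w\<bar> \<le> 2"
    "continuous_on UNIV f'"
proof -
  let ?p = std_normal_density
  define g where "g = (\<lambda>x. (h x - c) * ?p x)"
  have hm[measurable]: "h \<in> borel_measurable borel"
    using cont by (rule borel_measurable_continuous_onI)
  have inth: "integrable gauss h"
    by (rule gauss.integrable_const_bound[where B=1]) (use h01 in auto)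
  have c01: "0 \<le> c" "c \<le> 1"
    unfolding c_def using h01 inth
    by (auto intro!: integral_nonneg_AE gauss.integral_le_const)
  have hc: "\<bar>h x - c\<bar> \<le> 1" for x using h01[of x] c01 by linarith
  have intp: "integrable lborel ?p" by simp
  have intg: "integrable lborel g"
    by (rule Bochner_Integration.integrable_bound[OF intp])
       (auto simp: g_def abs_mult intro!: mult_left_le_one_le hc)
  have int0: "(\<integral>x. g x \<partial>lborel) = 0"
  proof -
    have "(\<integral>x. g x \<partial>lborel) = (\<integral>x. h x - c \<partial>gauss)"
      unfolding g_def by (subst integral_density) (auto simp: mult.commute)
    also have "\<dots> = 0" using inth gauss.prob_space by (simp add: c_def)
    finally show ?thesis .
  qed
  define \<Psi> where "\<Psi> w = (LINT x:{..w}|lborel. g x)" for w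
  have sint: "set_integrable lborel S g" if "S \<in> sets lborel" for S
    using set_integrable_subset[of lborel UNIV g S] intg that by (auto simp: set_integrable_def)
  have bnd: "\<bar>LINT x:S|lborel. g x\<bar> \<le> measure gauss S" if [measurable]: "S \<in> sets borel" for S
  proof -
    have "\<bar>LINT x:S|lborel. g x\<bar> \<le> (LINT x:S|lborel. \<bar>g x\<bar>)"
      using set_integral_norm_bound[OF sint, of S] that by simp
    also have "\<dots> \<le> (LINT x:S|lborel. ?p x)"
    proof (rule set_integral_mono)
      show "set_integrable lborel S (\<lambda>x. \<bar>g x\<bar>)" using set_integrable_abs[OF sint, of S] that by simp
      show "set_integrable lborel S ?p"
        using set_integrable_subset[of lborel UNIV ?p S] that by (auto simp: set_integrable_def)
    qed (auto simp: g_def abs_mult intro!: mult_left_le_one_le hc)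
    also have "\<dots> = (\<integral>x. indicator S x \<partial>gauss)"
      unfolding set_lebesgue_integral_def by (subst integral_density) (auto simp: mult.commute)
    also have "\<dots> = measure gauss S" by simp
    finally show ?thesis .
  qed
  \<comment> \<open>Since \<open>g\<close> has total integral 0, \<open>\<Psi> w\<close> is also
    minus an upper tail, the form that Mills' bound controls for positive \<open>w\<close>.\<close>
  have \<Psi>_up: "\<Psi> w = - (LINT x:{w<..}|lborel. g x)" for w
  proof -
    have "(LINT x:{..w} \<union> {w<..}|lborel. g x) = \<Psi> w + (LINT x:{w<..}|lborel. g x)"
      unfolding \<Psi>_def by (rule set_integral_Un) (auto intro!: sint)
    moreover have "{..w} \<union> {w<..} = UNIV" by auto
    ultimately show ?thesis using int0 by (simp add: set_lebesgue_integral_def)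
  qed
  have D\<Psi>: "(\<Psi> has_real_derivative g w) (at w)" for w
  proof -
    \<comment> \<open>The fundamental theorem is applied on a bounded window round \<open>w\<close>;
      step \<open>2\<close> identifies its Henstock-Kurzweil integral with the increment of
      \<open>\<Psi>\<close>.\<close>
    have gc: "continuous_on {w-1..w+1} g"
      unfolding g_def std_normal_density_def
      by (intro continuous_intros continuous_on_subset[OF cont]) auto
    have "((\<lambda>u. integral {w-1..u} g) has_vector_derivative g w) (at w within {w-1..w+1})"
      by (rule integral_has_vector_derivative[OF gc]) auto
    hence "((\<lambda>u. integral {w-1..u} g) has_real_derivative g w) (at w)"
      by (simp add: has_real_derivative_iff_has_vector_derivative at_within_Icc_at)
    hence 1: "((\<lambda>u. \<Psi> (w-1) + integral {w-1..u} g) has_real_derivative g w) (at w)"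
      by (auto intro!: derivative_eq_intros)
    have 2: "\<Psi> (w-1) + integral {w-1..u} g = \<Psi> u" if "u > w - 1" for u
    proof -
      have "(LINT x:{..w-1} \<union> {w-1<..u}|lborel. g x) = \<Psi> (w-1) + (LINT x:{w-1<..u}|lborel. g x)"
        unfolding \<Psi>_def by (rule set_integral_Un) (auto intro!: sint)
      moreover have "{..w-1} \<union> {w-1<..u} = {..u}" using that by auto
      moreover have "(LINT x:{w-1<..u}|lborel. g x) = (LINT x:{w-1..u}|lborel. g x)"
        by (rule set_integral_cong_set)
           (auto simp: set_borel_measurable_def g_def intro!: AE_I[where N="{w-1}"])
      moreover have "(LINT x:{w-1..u}|lborel. g x) = integral {w-1..u} g"
        by (rule set_borel_integral_eq_integral) (auto intro!: sint)
      ultimately show ?thesis unfolding \<Psi>_def by simp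
    qed
    show ?thesis
      by (rule DERIV_cong_ev[THEN iffD1, OF refl _ refl 1])
         (use 2 eventually_gt_at_top in \<open>auto intro!: eventually_mono[OF eventually_nhds_in_open[of "{w-1<..}"]]\<close>)
  qed
  define f where "f w = \<Psi> w / ?p w" for w
  define f' where "f' w = w * f w + (h w - c)" for w
  have ppos: "?p w > 0" for w by (simp add: normal_density_pos)
  have Df: "(f has_real_derivative f' w) (at w)" for w
    unfolding f_def
    by (rule DERIV_cong[OF DERIV_divide[OF D\<Psi> std_normal_deriv]])
       (use ppos[of w] in \<open>auto simp: f'_def f_def g_def field_simps power2_eq_square\<close>)
  \<comment> \<open>The factor \<open>\<bar>w\<bar>\<close> is the one in Mills' bound, so the
    density cancels. Negative \<open>w\<close> is reduced to the upper tail by reflection.\<close>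
  have wf: "\<bar>w\<bar> * \<bar>f w\<bar> \<le> 1" for w
  proof (cases w "0::real" rule: linorder_cases)
    case less
    have "\<bar>\<Psi> w\<bar> \<le> measure gauss {-w..}"
      using bnd[of "{..w}"] std_normal_reflect[of "-w"] by (simp add: \<Psi>_def)
    hence "\<bar>w\<bar> * \<bar>\<Psi> w\<bar> \<le> -w * measure gauss {-w..}" using less by (intro mult_mono) auto
    also have "\<dots> \<le> ?p w" using std_normal_Mills[of "-w"] less by (simp add: std_normal_density_def)
    finally show ?thesis using ppos[of w] by (simp add: f_def abs_divide divide_simps)
  next
    case greater
    have "\<bar>\<Psi> w\<bar> \<le> measure gauss {w<..}"
      using bnd[of "{w<..}"] by (simp add: \<Psi>_up)
    also have "\<dots> \<le> measure gauss {w..}" by (intro gauss.finite_measure_mono) auto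
    finally have "\<bar>w\<bar> * \<bar>\<Psi> w\<bar> \<le> w * measure gauss {w..}" using greater by (intro mult_mono) auto
    also have "\<dots> \<le> ?p w" using std_normal_Mills[of w] greater by simp
    finally show ?thesis using ppos[of w] by (simp add: f_def abs_divide divide_simps)
  qed auto
  have f6: "\<bar>f w\<bar> \<le> 6" for w
  proof (cases "\<bar>w\<bar> \<le> 1")
    case True
    have "\<bar>\<Psi> w\<bar> \<le> 1" unfolding \<Psi>_def by (rule order_trans[OF bnd gauss.prob_le_1]) simp
    \<comment> \<open>Origin of the 6: on \<open>[-1, 1]\<close> the exponential is at least
      \<open>1/2\<close> and \<open>sqrt (2 * pi)\<close> is at most 3. Beyond this interval
      \<open>wf\<close> already gives a bound of 1.\<close>
    moreover have "1 \<le> 6 * ?p w"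
    proof -
      have "w\<^sup>2 \<le> 1" using True by (simp add: abs_square_le_1)
      hence "1/2 \<le> exp (-1/2::real)" using exp_ge_add_one_self[of "-1/2::real"] by simp
      also have "\<dots> \<le> exp (- w\<^sup>2/2)" using \<open>w\<^sup>2 \<le> 1\<close> by simp
      finally have "1/2 \<le> exp (- w\<^sup>2/2)" .
      moreover have "sqrt (2*pi) \<le> sqrt (3\<^sup>2)"
      proof (rule real_sqrt_le_mono)
        show "2 * pi \<le> 3\<^sup>2" using pi_less_4 by simp
      qed
      ultimately have "sqrt (2*pi) \<le> 6 * exp (- w\<^sup>2/2)" by simp
      thus ?thesis unfolding std_normal_density_def by (simp add: divide_simps)
    qed
    ultimately show ?thesis using ppos[of w] by (simp add: f_def abs_divide divide_simps)
  next
    case False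
    hence "1 * \<bar>f w\<bar> \<le> \<bar>w\<bar> * \<bar>f w\<bar>" by (intro mult_right_mono) auto
    thus ?thesis using wf[of w] by linarith
  qed
  have f'2: "\<bar>f' w\<bar> \<le> 2" for w
    using wf[of w] hc[of w] by (simp add: f'_def abs_mult[symmetric])
  have "continuous_on UNIV f" using Df by (meson DERIV_continuous_on has_field_derivative_at_within)
  hence "continuous_on UNIV f'" unfolding f'_def by (intro continuous_intros cont)
  thus thesis using that[of f f'] Df f6 f'2 by (auto simp: f'_def)
qed

section \<open>Smoothed half-line indicators and a self-improving bound for the Kolmogorov
  distance\<close>

definition ramp :: "real \<Rightarrow> real \<Rightarrow> real \<Rightarrow> real"
  where "ramp z l w = max 0 (min 1 ((z + l - w) / l))"

lemma continuous_on_ramp [continuous_intros]: "continuous_on S (ramp z l)"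
proof (cases "l = 0")
  case False
  thus ?thesis unfolding ramp_def [abs_def] by (intro continuous_intros) auto
qed (simp add: ramp_def [abs_def])

lemma ramp_bounds: "0 \<le> ramp z l w" "ramp z l w \<le> 1"
  by (auto simp: ramp_def)

lemma ramp_eq:
  assumes "0 < l"
  shows "w \<le> z \<Longrightarrow> ramp z l w = 1" "z + l \<le> w \<Longrightarrow> ramp z l w = 0"
  using assms by (auto simp: ramp_def min_def max_def field_simps)

lemma ramp_measurable [measurable]: "ramp z l \<in> borel_measurable borel"
  by (intro borel_measurable_continuous_onI continuous_on_ramp)

lemma ramp_lipschitz:
  assumes "0 < l"
  shows "\<bar>ramp z l u - ramp z l w\<bar> \<le> \<bar>u - w\<bar> / l"
proof -
  have "\<bar>ramp z l u - ramp z l w\<bar> \<le> \<bar>(z + l - u) / l - (z + l - w) / l\<bar>"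
    unfolding ramp_def by (auto simp: max_def min_def)
  also have "\<dots> = \<bar>u - w\<bar> / l" using assms by (simp add: diff_divide_distrib[symmetric] abs_minus_commute)
  finally show ?thesis .
qed

context prob_space
begin

lemma expectation_ramp_bounds:
  assumes [measurable]: "W \<in> borel_measurable M" and "0 < l"
  shows "measure M {\<omega>\<in>space M. W \<omega> \<le> z} \<le> expectation (\<lambda>\<omega>. ramp z l (W \<omega>))"
    and "expectation (\<lambda>\<omega>. ramp z l (W \<omega>)) \<le> measure M {\<omega>\<in>space M. W \<omega> \<le> z + l}"
proof -
  have int: "integrable M (\<lambda>\<omega>. ramp z l (W \<omega>))"
    by (rule integrable_const_bound[where B=1]) (auto simp: ramp_bounds)
  have "expectation (indicator {\<omega>\<in>space M. W \<omega> \<le> z}) \<le> expectation (\<lambda>\<omega>. ramp z l (W \<omega>))"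
    by (intro integral_mono int) (auto simp: indicator_def ramp_bounds ramp_eq[OF assms(2)] emeasure_eq_measure)
  thus "measure M {\<omega>\<in>space M. W \<omega> \<le> z} \<le> expectation (\<lambda>\<omega>. ramp z l (W \<omega>))"
    by simp
  have "expectation (\<lambda>\<omega>. ramp z l (W \<omega>)) \<le> expectation (indicator {\<omega>\<in>space M. W \<omega> \<le> z + l})"
    by (intro integral_mono int) (auto simp: indicator_def ramp_bounds ramp_eq[OF assms(2)] emeasure_eq_measure)
  thus "expectation (\<lambda>\<omega>. ramp z l (W \<omega>)) \<le> measure M {\<omega>\<in>space M. W \<omega> \<le> z + l}"
    by simp
qed

text \<open>
  The window probability on the right is at most twice the Kolmogorov distance plus the Gaussian
  mass of the window; its factor \<open>1/4\<close> lets it be absorbed.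
\<close>

lemma kolmogorov_bootstrap:
  assumes [measurable]: "W \<in> borel_measurable M" and "0 < G" "0 \<le> t"
    and ramp: "\<And>z. \<bar>expectation (\<lambda>\<omega>. ramp z (4 * G) (W \<omega>)) - (\<integral>x. ramp z (4 * G) x \<partial>gauss)\<bar>
      \<le> a + measure M {\<omega>\<in>space M. z - t < W \<omega> \<and> W \<omega> \<le> z + 4 * G + t} / 4"
  shows "\<bar>measure M {\<omega>\<in>space M. W \<omega> \<le> z} - cdf gauss z\<bar> \<le> 10 * G + 2 * a + t"
proof -
  define F where "F z = measure M {\<omega>\<in>space M. W \<omega> \<le> z}" for z
  define Q where "Q = (SUP z. \<bar>F z - cdf gauss z\<bar>)"
  have "\<bar>F z - cdf gauss z\<bar> \<le> 1" for z
  proof -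
    have "0 \<le> F z" "F z \<le> 1" "0 \<le> cdf gauss z" "cdf gauss z \<le> 1"
      by (auto simp: F_def cdf_def)
    thus ?thesis by linarith
  qed
  \<comment> \<open>Finiteness of \<open>Q\<close> is what allows \<open>Q / 2\<close> to be
    subtracted from both sides at the end.\<close>
  hence "bdd_above (range (\<lambda>z. \<bar>F z - cdf gauss z\<bar>))" by (auto intro!: bdd_aboveI[where M=1])
  hence Q: "\<bar>F z - cdf gauss z\<bar> \<le> Q" for z unfolding Q_def by (intro cSUP_upper) auto
  have I: "measure M {\<omega>\<in>space M. z - t < W \<omega> \<and> W \<omega> \<le> z + 4 * G + t} \<le> 2 * Q + 4 * G + 2 * t" for z
  proof -
    have "measure M {\<omega>\<in>space M. z - t < W \<omega> \<and> W \<omega> \<le> z + 4 * G + t}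
        = measure M ({\<omega>\<in>space M. W \<omega> \<le> z + 4 * G + t} - {\<omega>\<in>space M. W \<omega> \<le> z - t})"
      by (rule arg_cong[where f="measure M"]) auto
    also have "\<dots> = F (z + 4 * G + t) - F (z - t)"
      unfolding F_def using assms(2,3) by (intro finite_measure_Diff) auto
    finally show ?thesis
      using Q[of "z + 4 * G + t"] Q[of "z - t"] std_normal_cdf_diff_le[of "z - t" "z + 4 * G + t"] assms(2,3)
      by linarith
  qed
  have cdf_alt: "cdf gauss z = measure gauss {x\<in>space gauss. x \<le> z}" for z
    by (simp add: cdf_def atMost_def)
  \<comment> \<open>The smoothing width costs \<open>4 * G\<close> through the Gaussian distribution
    function, and a quarter of the window bound \<open>I\<close> adds
    \<open>Q / 2 + G + t / 2\<close>.\<close>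
  have main: "\<bar>F z - cdf gauss z\<bar> \<le> 5 * G + a + t / 2 + Q / 2" for z
  proof -
    have "F z \<le> expectation (\<lambda>\<omega>. ramp z (4 * G) (W \<omega>))"
      unfolding F_def by (rule expectation_ramp_bounds) (use assms(2) in auto)
    moreover have "(\<integral>x. ramp z (4 * G) x \<partial>gauss) \<le> cdf gauss (z + 4 * G)"
      unfolding cdf_alt by (rule gauss.expectation_ramp_bounds) (use assms(2) in auto)
    ultimately have 1: "F z - cdf gauss z \<le> 5 * G + a + t / 2 + Q / 2"
      using ramp[of z] I[of z] std_normal_cdf_diff_le[of z "z + 4 * G"] assms(2) by linarith
    \<comment> \<open>For the lower bound the slope has to end at \<open>z\<close>, so the ramp is
      moved to the left by its width.\<close>
    let ?y = "z - 4 * G"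
    have "expectation (\<lambda>\<omega>. ramp ?y (4 * G) (W \<omega>)) \<le> F (?y + 4 * G)"
      unfolding F_def by (rule expectation_ramp_bounds) (use assms(2) in auto)
    moreover have "cdf gauss ?y \<le> (\<integral>x. ramp ?y (4 * G) x \<partial>gauss)"
      unfolding cdf_alt by (rule gauss.expectation_ramp_bounds) (use assms(2) in auto)
    ultimately have 2: "cdf gauss z - F z \<le> 5 * G + a + t / 2 + Q / 2"
      using ramp[of ?y] I[of ?y] std_normal_cdf_diff_le[of ?y z] assms(2) by simp
    show ?thesis using 1 2 by linarith
  qed
  have "Q \<le> 5 * G + a + t / 2 + Q / 2"
    unfolding Q_def by (rule cSUP_least) (use main in \<open>auto simp: Q_def\<close>)
  thus ?thesis using Q[of z] unfolding F_def by linarith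
qed

end

subsection \<open>Lattice boxes and sums of powers of the sup norm\<close>

definition sup_norm :: "int ^ 'd \<Rightarrow> nat"
  where "sup_norm i = Max (range (\<lambda>m. nat \<bar>i $ m\<bar>))"

lemma nth_le_sup_norm: "nat \<bar>i $ m\<bar> \<le> sup_norm i"
  unfolding sup_norm_def by (intro Max_ge) auto

lemma sup_norm_le_iff: "sup_norm i \<le> k \<longleftrightarrow> (\<forall>m. nat \<bar>i $ m\<bar> \<le> k)"
  unfolding sup_norm_def by (subst Max_le_iff) auto

lemma centered_box_iff: "i \<in> centered_box k \<longleftrightarrow> sup_norm i \<le> k"
  unfolding centered_box_def sup_norm_le_iff
  by (auto simp: nat_le_iff abs_le_iff minus_le_iff)

lemma sup_norm_minus [simp]: "sup_norm (- i) = sup_norm i"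
  unfolding sup_norm_def by simp

lemma sup_norm_minus_commute: "sup_norm (i - j) = sup_norm (j - i)"
  using sup_norm_minus[of "i - j"] by simp

lemma sup_norm_triangle: "sup_norm (i + j) \<le> sup_norm i + sup_norm j"
  unfolding sup_norm_le_iff
proof
  fix m show "nat \<bar>(i + j) $ m\<bar> \<le> sup_norm i + sup_norm j"
    using nth_le_sup_norm[of i m] nth_le_sup_norm[of j m] by simp
qed

lemma sup_norm_triangle_diff: "sup_norm (i - k) \<le> sup_norm (i - j) + sup_norm (j - k)"
  using sup_norm_triangle[of "i - j" "j - k"] by simp

lemma sup_norm_0 [simp]: "sup_norm 0 = 0"
  using sup_norm_le_iff[of 0 0] by simp

lemma vec_box_eq: "{i::'b ^ 'd. \<forall>m. i $ m \<in> S m} = vec_lambda ` PiE UNIV S"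
proof (intro equalityI subsetI)
  fix i assume "i \<in> {i::'b ^ 'd. \<forall>m. i $ m \<in> S m}"
  hence "vec_nth i \<in> PiE UNIV S" by auto
  thus "i \<in> vec_lambda ` PiE UNIV S" by (metis image_eqI vec_nth_inverse)
qed auto

lemma inj_vec_lambda: "inj_on vec_lambda S"
  by (auto simp: inj_on_def vec_lambda_inject)

lemma finite_vec_box:
  assumes "\<And>m. finite (S m)"
  shows "finite {i::'b ^ 'd. \<forall>m. i $ m \<in> S m}"
  unfolding vec_box_eq using assms by (intro finite_imageI finite_PiE) auto

lemma card_vec_box: "card {i::'b ^ 'd. \<forall>m. i $ m \<in> S m} = (\<Prod>m\<in>UNIV. card (S m))"
  unfolding vec_box_eq by (subst card_image[OF inj_vec_lambda]) (auto simp: card_PiE)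

lemma centered_box_eq: "centered_box k = {i::int ^ 'd. \<forall>m. i $ m \<in> {- int k..int k}}"
  by (auto simp: centered_box_def)

lemma corner_box_eq: "corner_box n = {i::int ^ 'd. \<forall>m. i $ m \<in> {0..int n - 1}}"
  by (auto simp: corner_box_def)

lemma finite_centered_box [simp]: "finite (centered_box k)"
  unfolding centered_box_eq by (rule finite_vec_box) auto

lemma finite_corner_box [simp]: "finite (corner_box n)"
  unfolding corner_box_eq by (rule finite_vec_box) auto

lemma card_centered_box: "card (centered_box k :: (int ^ 'd) set) = (2 * k + 1) ^ CARD('d)"
  unfolding centered_box_eq card_vec_box by (simp add: nat_add_distrib nat_mult_distrib)

lemma card_corner_box: "card (corner_box n :: (int ^ 'd) set) = n ^ CARD('d)"
  unfolding corner_box_eq card_vec_box by simp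

lemma card_ball: "card {j::int ^ 'd. sup_norm (j - i) \<le> k} = (2 * k + 1) ^ CARD('d)"
  and finite_ball [simp]: "finite {j::int ^ 'd. sup_norm (j - i) \<le> k}"
proof -
  have *: "{j::int ^ 'd. sup_norm (j - i) \<le> k} = (\<lambda>j. j + i) ` centered_box k"
    by (auto simp: centered_box_iff image_iff intro!: bexI[of _ "_ - i"])
  show "card {j::int ^ 'd. sup_norm (j - i) \<le> k} = (2 * k + 1) ^ CARD('d)"
    unfolding * by (subst card_image) (auto simp: card_centered_box)
  show "finite {j::int ^ 'd. sup_norm (j - i) \<le> k}" unfolding * by simp
qed

text \<open>Some coordinate \<open>m\<close> of \<open>i + k\<close> must leave its interval. At
  most \<open>\<bar>k $ m\<bar>\<close> values of \<open>i $ m\<close> do so, and the other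
  coordinates are free: a boundary layer.\<close>

lemma card_corner_box_exit:
  "card {i \<in> corner_box n. i + k \<notin> corner_box n}
    \<le> CARD('d) * sup_norm k * n ^ (CARD('d) - 1)" for k :: "int ^ 'd"
proof -
  define S where "S m m' = (if m' = m then {0..int n - 1} - {- (k $ m)..int n - 1 - k $ m} else {0..int n - 1})" for m m' :: 'd
  have sub: "{i \<in> corner_box n. i + k \<notin> corner_box n} \<subseteq> (\<Union>m. {i. \<forall>m'. i $ m' \<in> S m m'})"
  proof
    fix i assume i: "i \<in> {i \<in> corner_box n. i + k \<notin> corner_box n}"
    then obtain m where "\<not> (0 \<le> i $ m + k $ m \<and> i $ m + k $ m \<le> int n - 1)"
      by (auto simp: corner_box_def)
    hence "\<forall>m'. i $ m' \<in> S m m'" using i by (auto simp: S_def corner_box_def)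
    thus "i \<in> (\<Union>m. {i. \<forall>m'. i $ m' \<in> S m m'})" by blast
  qed
  have fin: "finite (S m m')" for m m' by (auto simp: S_def)
  have c: "card {i::int ^ 'd. \<forall>m'. i $ m' \<in> S m m'} \<le> sup_norm k * n ^ (CARD('d) - 1)" for m
  proof -
    have "card {i::int ^ 'd. \<forall>m'. i $ m' \<in> S m m'} = (\<Prod>m'\<in>UNIV. card (S m m'))"
      by (rule card_vec_box)
    also have "\<dots> = card (S m m) * (\<Prod>m'\<in>UNIV - {m}. card (S m m'))"
      by (subst prod.remove[of _ m]) auto
    also have "(\<Prod>m'\<in>UNIV - {m}. card (S m m')) = (\<Prod>m'\<in>UNIV - {m}. n)"
      by (rule prod.cong) (auto simp: S_def)
    also have "\<dots> = n ^ (CARD('d) - 1)" by (simp add: card_Diff_singleton)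
    also have "card (S m m) \<le> sup_norm k"
    proof -
      have "S m m \<subseteq> {0..<- (k $ m)} \<union> {int n - k $ m..<int n}" by (auto simp: S_def)
      moreover have "card ({0..<- (k $ m)} \<union> {int n - k $ m..<int n}) \<le> nat \<bar>k $ m\<bar>"
        by (rule order_trans[OF card_Un_le]) simp
      ultimately have "card (S m m) \<le> nat \<bar>k $ m\<bar>"
        by (meson card_mono finite_UnI finite_atLeastLessThan_int order_trans)
      thus ?thesis using nth_le_sup_norm[of k m] by linarith
    qed
    finally show ?thesis by simp
  qed
  have "card {i \<in> corner_box n. i + k \<notin> corner_box n} \<le> card (\<Union>m. {i. \<forall>m'. i $ m' \<in> S m m'})"
    by (rule card_mono[OF _ sub]) (auto intro!: finite_vec_box fin)
  also have "\<dots> \<le> (\<Sum>m\<in>UNIV. card {i::int ^ 'd. \<forall>m'. i $ m' \<in> S m m'})"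
    by (rule card_UN_le) simp
  also have "\<dots> \<le> (\<Sum>m\<in>(UNIV::'d set). sup_norm k * n ^ (CARD('d) - 1))"
    by (intro sum_mono c)
  finally show ?thesis by simp
qed

text \<open>The sup norm dominates every coordinate, so the summand is at most a product of
  one-dimensional powers with exponent \<open>H\<close> divided by the dimension, which exceeds 1.
  Over a box the sum of the product factorises; each factor is at most \<open>2 * s\<close>, where
  both signs are covered and 0 is counted twice.\<close>

lemma sum_sup_norm_bounded:
  assumes "real CARD('d) < H"
  obtains K where "0 < K" "\<And>S::(int ^ 'd) set. finite S \<Longrightarrow> (\<Sum>j\<in>S. (1 + real (sup_norm j)) powr - H) \<le> K"
proof -
  let ?d = "real CARD('d)"
  define \<phi> where "\<phi> a = (1 + \<bar>real_of_int a\<bar>) powr (- H / ?d)" for a :: int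
  have "summable (\<lambda>n. real n powr (- H / ?d))"
    using assms by (subst summable_real_powr_iff) (auto simp: divide_simps)
  hence sm: "summable (\<lambda>n. real (Suc n) powr (- H / ?d))" by (subst summable_Suc_iff)
  define s where "s = (\<Sum>n. real (Suc n) powr (- H / ?d))"
  have one: "(\<Sum>a\<in>{- int k..int k}. \<phi> a) \<le> 2 * s" for k
  proof -
    have nn: "(\<Sum>n\<in>{0..k}. real (Suc n) powr (- H / ?d)) \<le> s"
      unfolding s_def by (rule sum_le_suminf[OF sm]) auto
    have "(\<Sum>a\<in>{- int k..int k}. \<phi> a) \<le> (\<Sum>a\<in>int ` {0..k} \<union> (\<lambda>n. - int n) ` {0..k}. \<phi> a)"
    proof (rule sum_mono2)
      show "{- int k..int k} \<subseteq> int ` {0..k} \<union> (\<lambda>n. - int n) ` {0..k}"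
      proof
        fix a assume a: "a \<in> {- int k..int k}"
        hence "a = int (nat a) \<and> nat a \<in> {0..k} \<or> a = - int (nat (- a)) \<and> nat (- a) \<in> {0..k}" by auto
        thus "a \<in> int ` {0..k} \<union> (\<lambda>n. - int n) ` {0..k}" by blast
      qed
    qed (auto simp: \<phi>_def)
    also have "\<dots> \<le> (\<Sum>a\<in>int ` {0..k}. \<phi> a) + (\<Sum>a\<in>(\<lambda>n. - int n) ` {0..k}. \<phi> a)"
      by (subst sum_Un) (auto simp: \<phi>_def intro!: sum_nonneg)
    also have "\<dots> = (\<Sum>n\<in>{0..k}. \<phi> (int n)) + (\<Sum>n\<in>{0..k}. \<phi> (- int n))"
      by (subst (1 2) sum.reindex) (auto simp: inj_on_def o_def)
    also have "\<dots> = 2 * (\<Sum>n\<in>{0..k}. real (Suc n) powr (- H / ?d))"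
      by (simp add: \<phi>_def add.commute)
    finally show ?thesis using nn by simp
  qed
  have pw: "(1 + real (sup_norm j)) powr - H \<le> (\<Prod>m\<in>UNIV. \<phi> (j $ m))" for j :: "int ^ 'd"
  proof -
    have "(1 + real (sup_norm j)) powr - H = (\<Prod>m\<in>(UNIV::'d set). (1 + real (sup_norm j)) powr (- H / ?d))"
      by (simp add: powr_realpow[symmetric] powr_powr)
    also have "\<dots> \<le> (\<Prod>m\<in>UNIV. \<phi> (j $ m))"
    proof (rule prod_mono, safe)
      fix m
      have "\<bar>real_of_int (j $ m)\<bar> \<le> real (sup_norm j)"
        using nth_le_sup_norm[of j m] by linarith
      thus "(1 + real (sup_norm j)) powr (- H / ?d) \<le> \<phi> (j $ m)"
        unfolding \<phi>_def using assms by (intro powr_mono2') auto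
    qed auto
    finally show ?thesis .
  qed
  show thesis
  proof (rule that[of "max 1 ((2 * s) ^ CARD('d))"])
    fix S :: "(int ^ 'd) set" assume S: "finite S"
    define k where "k = Max (insert 0 (sup_norm ` S))"
    have "S \<subseteq> centered_box k" using S by (auto simp: centered_box_iff k_def)
    hence "(\<Sum>j\<in>S. (1 + real (sup_norm j)) powr - H) \<le> (\<Sum>j\<in>(centered_box k :: (int ^ 'd) set). (1 + real (sup_norm j)) powr - H)"
      by (intro sum_mono2[OF finite_centered_box]) auto
    also have "\<dots> \<le> (\<Sum>j\<in>(centered_box k :: (int ^ 'd) set). \<Prod>m\<in>UNIV. \<phi> (j $ m))"
      by (intro sum_mono pw)
    also have "\<dots> = (\<Sum>x\<in>PiE UNIV (\<lambda>_::'d. {- int k..int k}). \<Prod>m\<in>UNIV. \<phi> (x m))"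
      unfolding centered_box_eq vec_box_eq by (subst sum.reindex[OF inj_vec_lambda]) simp
    also have "\<dots> = (\<Prod>m\<in>(UNIV::'d set). \<Sum>a\<in>{- int k..int k}. \<phi> a)"
      by (subst prod_sum_PiE) auto
    also have "\<dots> \<le> (2 * s) ^ CARD('d)"
      unfolding prod_constant by (rule power_mono[OF one]) (auto simp: \<phi>_def intro!: sum_nonneg)
    finally show "(\<Sum>j\<in>S. (1 + real (sup_norm j)) powr - H) \<le> max 1 ((2 * s) ^ CARD('d))" by linarith
  qed auto
qed

text \<open>The share \<open>H'\<close> of the exponent pays for the summation; the rest is
  evaluated at the smallest distance and becomes a rate.\<close>

lemma sum_sup_norm_tail:
  fixes H H' K r :: real and S :: "(int ^ 'd) set"
  assumes K: "\<And>S::(int ^ 'd) set. finite S \<Longrightarrow> (\<Sum>j\<in>S. (1 + real (sup_norm j)) powr - H') \<le> K"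
    and "H' \<le> H" "finite S" "\<And>j. j \<in> S \<Longrightarrow> r \<le> 1 + real (sup_norm j)" "0 < r"
  shows "(\<Sum>j\<in>S. (1 + real (sup_norm j)) powr - H) \<le> K * r powr - (H - H')"
proof -
  have "(\<Sum>j\<in>S. (1 + real (sup_norm j)) powr - H)
      \<le> (\<Sum>j\<in>S. (1 + real (sup_norm j)) powr - H' * r powr - (H - H'))"
  proof (rule sum_mono)
    fix j assume j: "j \<in> S"
    have "(1 + real (sup_norm j)) powr - H = (1 + real (sup_norm j)) powr - H' * (1 + real (sup_norm j)) powr - (H - H')"
      by (simp add: powr_add[symmetric])
    also have "\<dots> \<le> (1 + real (sup_norm j)) powr - H' * r powr - (H - H')"
      using assms(2,4,5) j by (intro mult_left_mono powr_mono2') auto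
    finally show "(1 + real (sup_norm j)) powr - H \<le> (1 + real (sup_norm j)) powr - H' * r powr - (H - H')" .
  qed
  also have "\<dots> = (\<Sum>j\<in>S. (1 + real (sup_norm j)) powr - H') * r powr - (H - H')"
    by (simp add: sum_distrib_right)
  also have "\<dots> \<le> K * r powr - (H - H')" by (intro mult_right_mono K assms) auto
  finally show ?thesis .
qed

subsection \<open>Decoupling of weakly dependent fields\<close>

text \<open>
  \<open>mrg U (x, y)\<close> stands for the configuration that follows \<open>x\<close> on \<open>U\<close> and \<open>y\<close> off \<open>U\<close>.
\<close>

locale weak_field = prob_space M
  for M :: "'o measure" +
  fixes X :: "int ^ 'd \<Rightarrow> 'o \<Rightarrow> real" and mrg :: "(int ^ 'd) set \<Rightarrow> 'o \<times> 'o \<Rightarrow> 'o"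
    and V A H :: real and c :: "int ^ 'd \<Rightarrow> real"
  assumes X_meas [measurable]: "\<And>i. X i \<in> borel_measurable M"
    and X_bound: "\<And>i \<omega>. \<omega> \<in> space M \<Longrightarrow> \<bar>X i \<omega>\<bar> \<le> V"
    and X_mean: "\<And>i. expectation (X i) = 0"
    and X_cov: "\<And>i j. expectation (\<lambda>\<omega>. X i \<omega> * X j \<omega>) = c (j - i)"
    and mrg_meas [measurable]: "\<And>U. mrg U \<in> M \<Otimes>\<^sub>M M \<rightarrow>\<^sub>M M"
    and mrg_distr: "\<And>U. distr (M \<Otimes>\<^sub>M M) M (mrg U) = M"
    and X_fst: "\<And>i k U. (\<And>j. sup_norm (j - i) \<le> k \<Longrightarrow> j \<in> U) \<Longrightarrow>
      (\<integral>z. \<bar>X i (mrg U z) - X i (fst z)\<bar> \<partial>(M \<Otimes>\<^sub>M M)) \<le> A * (1 + real k) powr - H"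
    and X_snd: "\<And>i k U. (\<And>j. sup_norm (j - i) \<le> k \<Longrightarrow> j \<notin> U) \<Longrightarrow>
      (\<integral>z. \<bar>X i (mrg U z) - X i (snd z)\<bar> \<partial>(M \<Otimes>\<^sub>M M)) \<le> A * (1 + real k) powr - H"
    and V_pos: "0 < V" and A_nonneg: "0 \<le> A" and H_gt: "real CARD('d) < H"
begin

sublocale MM: pair_prob_space M M ..

lemma integrable_bounded:
  assumes "f \<in> borel_measurable M" "\<And>\<omega>. \<omega> \<in> space M \<Longrightarrow> \<bar>f \<omega>\<bar> \<le> (b::real)"
  shows "integrable M f"
  by (rule integrable_const_bound[where B=b]) (use assms in auto)

lemma MM_integrable_bounded:
  assumes "f \<in> borel_measurable (M \<Otimes>\<^sub>M M)" "\<And>\<omega>. \<omega> \<in> space (M \<Otimes>\<^sub>M M) \<Longrightarrow> \<bar>f \<omega>\<bar> \<le> (b::real)"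
  shows "integrable (M \<Otimes>\<^sub>M M) f"
  by (rule MM.integrable_const_bound[where B=b]) (use assms in auto)

lemma mrg_space: "z \<in> space (M \<Otimes>\<^sub>M M) \<Longrightarrow> mrg U z \<in> space M"
  using mrg_meas by (rule measurable_space)

text \<open>The splice of an independent pair has law \<open>M\<close> again, so both expectations
  live on one space: \<open>F\<close> times \<open>G\<close> at the splice against \<open>F\<close>
  at the first and \<open>G\<close> at the second configuration. Exchanging one factor at a time
  costs the bound of the other. Both integrals are small when \<open>F\<close> depends mostly on
  sites in \<open>U\<close> and \<open>G\<close> mostly on sites off \<open>U\<close>.\<close>

lemma decouple:
  fixes F G :: "'o \<Rightarrow> real"
  assumes [measurable]: "F \<in> borel_measurable M" "G \<in> borel_measurable M"
    and F: "\<And>\<omega>. \<omega> \<in> space M \<Longrightarrow> \<bar>F \<omega>\<bar> \<le> a" and G: "\<And>\<omega>. \<omega> \<in> space M \<Longrightarrow> \<bar>G \<omega>\<bar> \<le> b"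
  shows "\<bar>expectation (\<lambda>\<omega>. F \<omega> * G \<omega>) - expectation F * expectation G\<bar>
    \<le> b * (\<integral>z. \<bar>F (mrg U z) - F (fst z)\<bar> \<partial>(M \<Otimes>\<^sub>M M)) + a * (\<integral>z. \<bar>G (mrg U z) - G (snd z)\<bar> \<partial>(M \<Otimes>\<^sub>M M))"
proof -
  obtain \<omega>0 where "\<omega>0 \<in> space M" using not_empty by blast
  hence ab: "0 \<le> a" "0 \<le> b" by (auto intro: order_trans[OF abs_ge_zero F] order_trans[OF abs_ge_zero G])
  have fs: "fst z \<in> space M" "snd z \<in> space M" if "z \<in> space (M \<Otimes>\<^sub>M M)" for z
    using that by (auto simp: space_pair_measure)
  have 1: "expectation (\<lambda>\<omega>. F \<omega> * G \<omega>) = (\<integral>z. F (mrg U z) * G (mrg U z) \<partial>(M \<Otimes>\<^sub>M M))"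
    by (subst mrg_distr[of U, symmetric], subst integral_distr) auto
  have i2: "integrable (M \<Otimes>\<^sub>M M) (\<lambda>z. F (fst z) * G (snd z))"
    by (rule MM_integrable_bounded[where b="a*b"])
       (use F G fs ab in \<open>auto simp: abs_mult intro!: mult_mono\<close>)
  have 2: "expectation F * expectation G = (\<integral>z. F (fst z) * G (snd z) \<partial>(M \<Otimes>\<^sub>M M))"
    using MM.integral_fst'[OF i2] by simp
  have i1: "integrable (M \<Otimes>\<^sub>M M) (\<lambda>z. F (mrg U z) * G (mrg U z))"
    by (rule MM_integrable_bounded[where b="a*b"])
       (use F G mrg_space ab in \<open>auto simp: abs_mult intro!: mult_mono\<close>)
  have i3: "integrable (M \<Otimes>\<^sub>M M) (\<lambda>z. \<bar>F (mrg U z) - F (fst z)\<bar>)"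
  proof (rule MM_integrable_bounded[where b="2*a"])
    fix z assume "z \<in> space (M \<Otimes>\<^sub>M M)"
    thus "\<bar>\<bar>F (mrg U z) - F (fst z)\<bar>\<bar> \<le> 2 * a"
      using F[of "mrg U z"] F[of "fst z"] mrg_space[of z U] fs[of z] by auto
  qed simp
  have i4: "integrable (M \<Otimes>\<^sub>M M) (\<lambda>z. \<bar>G (mrg U z) - G (snd z)\<bar>)"
  proof (rule MM_integrable_bounded[where b="2*b"])
    fix z assume "z \<in> space (M \<Otimes>\<^sub>M M)"
    thus "\<bar>\<bar>G (mrg U z) - G (snd z)\<bar>\<bar> \<le> 2 * b"
      using G[of "mrg U z"] G[of "snd z"] mrg_space[of z U] fs[of z] by auto
  qed simp
  have "\<bar>expectation (\<lambda>\<omega>. F \<omega> * G \<omega>) - expectation F * expectation G\<bar>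
      = \<bar>\<integral>z. F (mrg U z) * G (mrg U z) - F (fst z) * G (snd z) \<partial>(M \<Otimes>\<^sub>M M)\<bar>"
    unfolding 1 2 using i1 i2 by simp
  also have "\<dots> \<le> (\<integral>z. \<bar>F (mrg U z) * G (mrg U z) - F (fst z) * G (snd z)\<bar> \<partial>(M \<Otimes>\<^sub>M M))"
    using integral_norm_bound[of "M \<Otimes>\<^sub>M M" "\<lambda>z. F (mrg U z) * G (mrg U z) - F (fst z) * G (snd z)"] by simp
  also have "\<dots> \<le> (\<integral>z. b * \<bar>F (mrg U z) - F (fst z)\<bar> + a * \<bar>G (mrg U z) - G (snd z)\<bar> \<partial>(M \<Otimes>\<^sub>M M))"
  proof (rule integral_mono)
    fix z assume z: "z \<in> space (M \<Otimes>\<^sub>M M)"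
    have "\<bar>F (mrg U z) * G (mrg U z) - F (fst z) * G (snd z)\<bar>
        = \<bar>G (mrg U z) * (F (mrg U z) - F (fst z)) + F (fst z) * (G (mrg U z) - G (snd z))\<bar>"
      by (simp add: algebra_simps)
    also have "\<dots> \<le> \<bar>G (mrg U z)\<bar> * \<bar>F (mrg U z) - F (fst z)\<bar> + \<bar>F (fst z)\<bar> * \<bar>G (mrg U z) - G (snd z)\<bar>"
      by (rule order_trans[OF abs_triangle_ineq]) (simp add: abs_mult)
    also have "\<dots> \<le> b * \<bar>F (mrg U z) - F (fst z)\<bar> + a * \<bar>G (mrg U z) - G (snd z)\<bar>"
      using F G fs[OF z] mrg_space[OF z] by (intro add_mono mult_right_mono) auto
    finally show "\<bar>F (mrg U z) * G (mrg U z) - F (fst z) * G (snd z)\<bar>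
      \<le> b * \<bar>F (mrg U z) - F (fst z)\<bar> + a * \<bar>G (mrg U z) - G (snd z)\<bar>" .
  qed (use i1 i2 i3 i4 in auto)
  also have "\<dots> = b * (\<integral>z. \<bar>F (mrg U z) - F (fst z)\<bar> \<partial>(M \<Otimes>\<^sub>M M)) + a * (\<integral>z. \<bar>G (mrg U z) - G (snd z)\<bar> \<partial>(M \<Otimes>\<^sub>M M))"
    using i3 i4 by simp
  finally show ?thesis .
qed

lemma MM_integrable_X:
  "integrable (M \<Otimes>\<^sub>M M) (\<lambda>z. \<bar>X i (mrg U z) - X i (fst z)\<bar>)"
  "integrable (M \<Otimes>\<^sub>M M) (\<lambda>z. \<bar>X i (mrg U z) - X i (snd z)\<bar>)"
proof -
  have "\<bar>X i (mrg U z)\<bar> \<le> V \<and> \<bar>X i (fst z)\<bar> \<le> V \<and> \<bar>X i (snd z)\<bar> \<le> V" if "z \<in> space (M \<Otimes>\<^sub>M M)" for z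
    using that mrg_space[OF that] X_bound by (auto simp: space_pair_measure)
  thus "integrable (M \<Otimes>\<^sub>M M) (\<lambda>z. \<bar>X i (mrg U z) - X i (fst z)\<bar>)"
    "integrable (M \<Otimes>\<^sub>M M) (\<lambda>z. \<bar>X i (mrg U z) - X i (snd z)\<bar>)"
    by (intro MM_integrable_bounded[where b="2*V"], simp, fastforce)+
qed

lemma X_fst_le:
  assumes "\<And>j. sup_norm (j - i) \<le> k \<Longrightarrow> j \<in> U" "0 < r" "r \<le> 1 + real k"
  shows "(\<integral>z. \<bar>X i (mrg U z) - X i (fst z)\<bar> \<partial>(M \<Otimes>\<^sub>M M)) \<le> A * r powr - H"
  by (rule order_trans[OF X_fst[OF assms(1)]])
     (use assms(2,3) H_gt in \<open>auto intro!: mult_left_mono powr_mono2' A_nonneg\<close>)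

lemma X_snd_le:
  assumes "\<And>j. sup_norm (j - i) \<le> k \<Longrightarrow> j \<notin> U" "0 < r" "r \<le> 1 + real k"
  shows "(\<integral>z. \<bar>X i (mrg U z) - X i (snd z)\<bar> \<partial>(M \<Otimes>\<^sub>M M)) \<le> A * r powr - H"
  by (rule order_trans[OF X_snd[OF assms(1)]])
     (use assms(2,3) H_gt in \<open>auto intro!: mult_left_mono powr_mono2' A_nonneg\<close>)

text \<open>Balls of about half the distance around \<open>0\<close> and \<open>k\<close> are
  disjoint, so one splice is close to the first configuration at one site and to the second at the
  other. The summand \<open>V\<^sup>2\<close> is there for \<open>k = 0\<close>.\<close>

lemma cov_decay: "\<bar>c k\<bar> \<le> (V\<^sup>2 + 2 * V * A * 4 powr H) * (1 + real (sup_norm k)) powr - H"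
proof (cases "sup_norm k = 0")
  case True
  have "\<bar>c k\<bar> = \<bar>expectation (\<lambda>\<omega>. X 0 \<omega> * X k \<omega>)\<bar>" by (simp add: X_cov)
  also have "\<dots> \<le> expectation (\<lambda>\<omega>. \<bar>X 0 \<omega> * X k \<omega>\<bar>)"
    using integral_norm_bound[of M "\<lambda>\<omega>. X 0 \<omega> * X k \<omega>"] by simp
  also have "\<dots> \<le> V * V"
    by (rule integral_le_const[OF integrable_bounded[where b="V*V"]])
       (use V_pos in \<open>auto simp: abs_mult intro!: mult_mono X_bound AE_I2\<close>)
  also have "\<dots> \<le> V\<^sup>2 + 2 * V * A * 4 powr H" using V_pos A_nonneg by (simp add: power2_eq_square)
  finally show ?thesis using True by simp
next
  case False
  define N where "N = sup_norm k"
  \<comment> \<open>Rounding \<open>N - 1\<close> rather than \<open>N\<close> gives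
    \<open>2 * r < N\<close> strictly, which makes the two balls disjoint, and still leaves
    \<open>1 + r\<close> at least \<open>(1 + N) / 4\<close>.\<close>
  define r where "r = (N - 1) div 2"
  have r: "2 * r < N" "(1 + real N) / 4 \<le> 1 + real r" using False by (auto simp: r_def N_def; linarith)+
  let ?U = "{l. sup_norm (l - 0) \<le> r}"
  have "\<bar>c k\<bar> = \<bar>expectation (\<lambda>\<omega>. X 0 \<omega> * X k \<omega>) - expectation (X 0) * expectation (X k)\<bar>"
    by (simp add: X_cov X_mean)
  also have "\<dots> \<le> V * (\<integral>z. \<bar>X 0 (mrg ?U z) - X 0 (fst z)\<bar> \<partial>(M \<Otimes>\<^sub>M M)) + V * (\<integral>z. \<bar>X k (mrg ?U z) - X k (snd z)\<bar> \<partial>(M \<Otimes>\<^sub>M M))"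
    by (rule decouple) (auto intro: X_bound)
  also have "\<dots> \<le> V * (A * ((1 + real N) / 4) powr - H) + V * (A * ((1 + real N) / 4) powr - H)"
  proof (intro add_mono mult_left_mono X_fst_le[where k=r] X_snd_le[where k=r])
    fix j assume "sup_norm (j - k) \<le> r"
    thus "j \<notin> ?U" using r(1) sup_norm_triangle_diff[of k 0 j] sup_norm_minus_commute[of k j]
      by (simp add: N_def)
  qed (use r V_pos in auto)
  also have "\<dots> = (2 * V * A * 4 powr H) * (1 + real N) powr - H"
    by (simp add: powr_divide powr_minus divide_simps)
  also have "\<dots> \<le> (V\<^sup>2 + 2 * V * A * 4 powr H) * (1 + real N) powr - H"
    by (intro mult_right_mono) auto
  finally show ?thesis by (simp add: N_def)
qed

end

section \<open>Sums over a finite region: near independence of a site and the remote part\<close>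

lemma sum_sup_norm_shift:
  "(\<Sum>j\<in>S. g (sup_norm (j - i))) = (\<Sum>j\<in>(\<lambda>j. j - i) ` S. g (sup_norm j))"
  by (subst sum.reindex) (auto simp: inj_on_def)

text \<open>The exponent is split as \<open>H = H' + \<kappa>\<close>: the share \<open>H'\<close>,
  above the dimension, makes lattice sums converge with bound \<open>K\<close>, and
  \<open>\<kappa>\<close> survives as the rate. Later \<open>\<Gamma>\<close> is the box of side
  \<open>n\<close>, \<open>s\<close> its Gaussian normalisation, and \<open>nb\<close> a round upper
  bound for the number of sites in a ball of radius \<open>m\<close>.\<close>

locale weak_field_scaled = weak_field M X mrg V A H c
  for M :: "'o measure" and X :: "int ^ 'd \<Rightarrow> 'o \<Rightarrow> real" and mrg V A H c +
  fixes H' K :: real and \<Gamma> :: "(int ^ 'd) set" and s :: real and m :: nat and nb :: real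
  assumes H': "real CARD('d) < H'" "H' < H"
    and K: "\<And>S::(int ^ 'd) set. finite S \<Longrightarrow> (\<Sum>j\<in>S. (1 + real (sup_norm j)) powr - H') \<le> K"
    and fin: "finite \<Gamma>" "\<Gamma> \<noteq> {}" and s_pos: "0 < s" and m_pos: "1 \<le> m"
    and nb_eq: "nb = (3 * real m) ^ CARD('d)"
begin

abbreviation "\<kappa> \<equiv> H - H'"

lemma K_nonneg: "0 \<le> K" using K[of "{}"] by simp

lemma tail_sum:
  fixes i :: "int ^ 'd" and S :: "(int ^ 'd) set"
  assumes "finite S" "\<And>j. j \<in> S \<Longrightarrow> r \<le> 1 + real (sup_norm (j - i))" "0 < r"
  shows "(\<Sum>j\<in>S. (1 + real (sup_norm (j - i))) powr - H) \<le> K * r powr - \<kappa>"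
  unfolding sum_sup_norm_shift[of "\<lambda>n. (1 + real n) powr - H"]
  by (rule sum_sup_norm_tail[where H'=H' and K=K]) (use assms H' K in auto)

text \<open>What is left of the normalised sum once the sites within \<open>r\<close> of
  \<open>i\<close> are removed; \<open>X i\<close> would be independent of it in a field of range
  \<open>r\<close>.\<close>

definition tail_field :: "int ^ 'd \<Rightarrow> nat \<Rightarrow> 'o \<Rightarrow> real"
  where "tail_field i r \<omega> = (\<Sum>j\<in>{j\<in>\<Gamma>. r < sup_norm (j - i)}. X j \<omega>) / s"

lemma tail_field_meas [measurable]: "tail_field i r \<in> borel_measurable M"
  unfolding tail_field_def by measurable

lemma abs_sum_X_le:
  assumes "\<omega> \<in> space M"
  shows "\<bar>(\<Sum>j\<in>S. X j \<omega>) / s\<bar> \<le> (\<Sum>j\<in>S. V) / s"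
proof -
  have "\<bar>\<Sum>j\<in>S. X j \<omega>\<bar> \<le> (\<Sum>j\<in>S. V)"
    by (intro order_trans[OF sum_abs] sum_mono X_bound assms)
  thus ?thesis using s_pos by (simp add: divide_right_mono)
qed

text \<open>Because \<open>X i\<close> has mean 0, only the decoupling error remains, and it has two
  parts. The increment of \<open>f\<close> is at most \<open>L / s\<close> times the volume of a
  ball, of order \<open>r^d\<close>; against the error \<open>r powr -H\<close> of
  \<open>X i\<close> this leaves \<open>r powr -\<kappa>\<close>, as \<open>H'\<close> exceeds the
  dimension. The errors of the remote sites enter through the Lipschitz constant and sum to the same
  order.\<close>

lemma tail_field_step:
  fixes f :: "real \<Rightarrow> real"
  assumes lip: "\<And>a b. \<bar>f a - f b\<bar> \<le> L * \<bar>a - b\<bar>" and [measurable]: "f \<in> borel_measurable borel" and "1 \<le> r"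
  shows "\<bar>expectation (\<lambda>\<omega>. X i \<omega> * (f (tail_field i r \<omega>) - f (tail_field i (2 * r) \<omega>)))\<bar>
    \<le> L / s * (V * A * (5 ^ CARD('d) * 2 powr H + 2 * 4 powr H * K)) * real r powr - \<kappa>"
proof -
  have L: "0 \<le> L" using lip[of 1 0] by simp
  define G where "G \<omega> = f (tail_field i r \<omega>) - f (tail_field i (2 * r) \<omega>)" for \<omega>
  have [measurable]: "G \<in> borel_measurable M" unfolding G_def by measurable
  define b where "b = L / s * (V * real ((4 * r + 1) ^ CARD('d)))"
  have Gb: "\<bar>G \<omega>\<bar> \<le> b" if \<omega>: "\<omega> \<in> space M" for \<omega>
  proof -
    let ?R = "{j\<in>\<Gamma>. r < sup_norm (j - i) \<and> sup_norm (j - i) \<le> 2 * r}"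
    have "{j\<in>\<Gamma>. r < sup_norm (j - i)} = {j\<in>\<Gamma>. 2 * r < sup_norm (j - i)} \<union> ?R" by auto
    hence "tail_field i r \<omega> - tail_field i (2 * r) \<omega> = (\<Sum>j\<in>?R. X j \<omega>) / s"
      using fin unfolding tail_field_def
      by (subst \<open>{j\<in>\<Gamma>. r < sup_norm (j - i)} = _\<close>, subst sum.union_disjoint) (auto simp: add_divide_distrib)
    also have "\<bar>\<dots>\<bar> \<le> (\<Sum>j\<in>?R. V) / s"
      by (rule abs_sum_X_le[OF \<omega>])
    also have "\<dots> \<le> (V * real ((4 * r + 1) ^ CARD('d))) / s"
    proof -
      have "card ?R \<le> card {j. sup_norm (j - i) \<le> 2 * r}" by (rule card_mono) auto
      also have "\<dots> = (4 * r + 1) ^ CARD('d)" by (simp add: card_ball)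
      finally have "real (card ?R) \<le> real ((4 * r + 1) ^ CARD('d))" by (rule of_nat_mono)
      thus ?thesis using s_pos V_pos by (auto intro!: divide_right_mono mult_left_mono simp: mult.commute)
    qed
    finally have "L * \<bar>tail_field i r \<omega> - tail_field i (2 * r) \<omega>\<bar> \<le> L * ((V * real ((4 * r + 1) ^ CARD('d))) / s)"
      by (rule mult_left_mono[OF _ L])
    thus ?thesis unfolding G_def b_def using lip[of "tail_field i r \<omega>" "tail_field i (2 * r) \<omega>"] by simp
  qed
  have b0: "0 \<le> b" using L s_pos V_pos by (auto simp: b_def)
  define k where "k = r div 2"
  let ?U = "{l. sup_norm (l - i) \<le> k}"
  have e1: "(\<integral>z. \<bar>X i (mrg ?U z) - X i (fst z)\<bar> \<partial>(M \<Otimes>\<^sub>M M)) \<le> A * (real r / 2) powr - H"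
    by (rule X_fst_le[where k=k]) (use \<open>1 \<le> r\<close> in \<open>auto simp: k_def\<close>)
  \<comment> \<open>A ball about \<open>j\<close> that just misses the ball of radius
    \<open>k\<close> about \<open>i\<close>. As \<open>k\<close> is at most half the distance, 1
    plus its radius is at least a quarter of \<open>1 + sup_norm (j - i)\<close>.\<close>
  have e2: "(\<integral>z. \<bar>X j (mrg ?U z) - X j (snd z)\<bar> \<partial>(M \<Otimes>\<^sub>M M)) \<le> A * ((1 + real (sup_norm (j - i))) / 4) powr - H"
    if j: "r < sup_norm (j - i)" for j
  proof (rule X_snd_le[where k="sup_norm (j - i) - k - 1"])
    fix l assume "sup_norm (l - j) \<le> sup_norm (j - i) - k - 1"
    thus "l \<notin> ?U" using j sup_norm_triangle_diff[of j i l] sup_norm_minus_commute[of j l] by (simp add: k_def)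
  qed (use j \<open>1 \<le> r\<close> in \<open>auto simp: k_def\<close>)
  have e3: "(\<integral>z. \<bar>tail_field i r' (mrg ?U z) - tail_field i r' (snd z)\<bar> \<partial>(M \<Otimes>\<^sub>M M))
      \<le> A * 4 powr H * K * real r powr - \<kappa> / s" if "r \<le> r'" for r'
  proof -
    let ?R = "{j\<in>\<Gamma>. r' < sup_norm (j - i)}"
    have "(\<integral>z. \<bar>tail_field i r' (mrg ?U z) - tail_field i r' (snd z)\<bar> \<partial>(M \<Otimes>\<^sub>M M))
      \<le> (\<integral>z. (\<Sum>j\<in>?R. \<bar>X j (mrg ?U z) - X j (snd z)\<bar>) / s \<partial>(M \<Otimes>\<^sub>M M))"
    proof (rule integral_mono')
      fix z
      have "\<bar>tail_field i r' (mrg ?U z) - tail_field i r' (snd z)\<bar> = \<bar>\<Sum>j\<in>?R. X j (mrg ?U z) - X j (snd z)\<bar> / s"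
        using s_pos by (simp add: tail_field_def sum_subtractf diff_divide_distrib[symmetric])
      also have "\<dots> \<le> (\<Sum>j\<in>?R. \<bar>X j (mrg ?U z) - X j (snd z)\<bar>) / s"
        using s_pos by (intro divide_right_mono sum_abs) auto
      finally show "\<bar>tail_field i r' (mrg ?U z) - tail_field i r' (snd z)\<bar> \<le> \<dots>" .
    qed (use s_pos in \<open>auto intro!: integrable_sum integrable_divide MM_integrable_X sum_nonneg divide_nonneg_nonneg\<close>)
    also have "\<dots> = (\<Sum>j\<in>?R. \<integral>z. \<bar>X j (mrg ?U z) - X j (snd z)\<bar> \<partial>(M \<Otimes>\<^sub>M M)) / s"
      by (simp add: MM_integrable_X Bochner_Integration.integral_sum)
    also have "\<dots> \<le> (\<Sum>j\<in>?R. A * ((1 + real (sup_norm (j - i))) / 4) powr - H) / s"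
      using s_pos that by (intro divide_right_mono sum_mono e2) auto
    also have "\<dots> = A * 4 powr H * (\<Sum>j\<in>?R. (1 + real (sup_norm (j - i))) powr - H) / s"
      by (simp add: sum_distrib_left powr_divide powr_minus divide_simps mult_ac)
    also have "\<dots> \<le> A * 4 powr H * (K * real r powr - \<kappa>) / s"
      using s_pos that fin \<open>1 \<le> r\<close> A_nonneg by (intro divide_right_mono mult_left_mono tail_sum) auto
    finally show ?thesis by (simp add: mult_ac)
  qed
  have ti: "integrable (M \<Otimes>\<^sub>M M) (\<lambda>z. \<bar>tail_field i r' (mrg ?U z) - tail_field i r' (snd z)\<bar>)" for r'
  proof (rule MM_integrable_bounded[where b="card \<Gamma> * V / s + card \<Gamma> * V / s"])
    fix z assume z: "z \<in> space (M \<Otimes>\<^sub>M M)"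
    have *: "\<bar>tail_field i r' \<omega>\<bar> \<le> card \<Gamma> * V / s" if \<omega>: "\<omega> \<in> space M" for \<omega>
    proof -
      have "\<bar>tail_field i r' \<omega>\<bar> \<le> (\<Sum>j\<in>{j\<in>\<Gamma>. r' < sup_norm (j - i)}. V) / s"
        unfolding tail_field_def by (rule abs_sum_X_le[OF \<omega>])
      also have "\<dots> \<le> (\<Sum>j\<in>\<Gamma>. V) / s"
        using s_pos V_pos fin by (intro divide_right_mono sum_mono2) auto
      finally show ?thesis by simp
    qed
    have "mrg ?U z \<in> space M" "snd z \<in> space M" using z mrg_space by (auto simp: space_pair_measure)
    from *[OF this(1)] *[OF this(2)]
    show "\<bar>\<bar>tail_field i r' (mrg ?U z) - tail_field i r' (snd z)\<bar>\<bar> \<le> card \<Gamma> * V / s + card \<Gamma> * V / s"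
      unfolding abs_abs by (rule order_trans[OF abs_triangle_ineq4 add_mono])
  qed simp
  have e4: "(\<integral>z. \<bar>G (mrg ?U z) - G (snd z)\<bar> \<partial>(M \<Otimes>\<^sub>M M)) \<le> L * (2 * (A * 4 powr H * K * real r powr - \<kappa> / s))"
  proof -
    have "(\<integral>z. \<bar>G (mrg ?U z) - G (snd z)\<bar> \<partial>(M \<Otimes>\<^sub>M M))
      \<le> (\<integral>z. L * \<bar>tail_field i r (mrg ?U z) - tail_field i r (snd z)\<bar>
          + L * \<bar>tail_field i (2 * r) (mrg ?U z) - tail_field i (2 * r) (snd z)\<bar> \<partial>(M \<Otimes>\<^sub>M M))"
    proof (rule integral_mono')
      fix z
      show "\<bar>G (mrg ?U z) - G (snd z)\<bar> \<le> L * \<bar>tail_field i r (mrg ?U z) - tail_field i r (snd z)\<bar>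
          + L * \<bar>tail_field i (2 * r) (mrg ?U z) - tail_field i (2 * r) (snd z)\<bar>"
        unfolding G_def
        using lip[of "tail_field i r (mrg ?U z)" "tail_field i r (snd z)"]
          lip[of "tail_field i (2 * r) (mrg ?U z)" "tail_field i (2 * r) (snd z)"] by linarith
    qed (use ti L in auto)
    also have "\<dots> = L * ((\<integral>z. \<bar>tail_field i r (mrg ?U z) - tail_field i r (snd z)\<bar> \<partial>(M \<Otimes>\<^sub>M M))
          + (\<integral>z. \<bar>tail_field i (2 * r) (mrg ?U z) - tail_field i (2 * r) (snd z)\<bar> \<partial>(M \<Otimes>\<^sub>M M)))"
      using ti by (simp add: distrib_left)
    also have "\<dots> \<le> L * (2 * (A * 4 powr H * K * real r powr - \<kappa> / s))"
      unfolding mult_2 using e3[of r] e3[of "r + r"] by (intro mult_left_mono L add_mono) auto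
    finally show ?thesis .
  qed
  have "\<bar>expectation (\<lambda>\<omega>. X i \<omega> * G \<omega>)\<bar> = \<bar>expectation (\<lambda>\<omega>. X i \<omega> * G \<omega>) - expectation (X i) * expectation G\<bar>"
    by (simp add: X_mean)
  also have "\<dots> \<le> b * (\<integral>z. \<bar>X i (mrg ?U z) - X i (fst z)\<bar> \<partial>(M \<Otimes>\<^sub>M M)) + V * (\<integral>z. \<bar>G (mrg ?U z) - G (snd z)\<bar> \<partial>(M \<Otimes>\<^sub>M M))"
    by (rule decouple) (auto intro: X_bound Gb)
  also have "\<dots> \<le> b * (A * (real r / 2) powr - H) + V * (L * (2 * (A * 4 powr H * K * real r powr - \<kappa> / s)))"
    using e1 e4 b0 V_pos by (intro add_mono mult_left_mono) auto
  also have "b * (A * (real r / 2) powr - H) \<le> L / s * (V * A * (5 ^ CARD('d) * 2 powr H)) * real r powr - \<kappa>"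
  proof -
    have "real ((4 * r + 1) ^ CARD('d)) * (real r / 2) powr - H \<le> (5 ^ CARD('d) * 2 powr H) * real r powr - \<kappa>"
    proof -
      have "real ((4 * r + 1) ^ CARD('d)) \<le> (5 * real r) ^ CARD('d)"
        using \<open>1 \<le> r\<close> unfolding of_nat_power by (intro power_mono) auto
      hence "real ((4 * r + 1) ^ CARD('d)) * (real r / 2) powr - H \<le> (5 * real r) ^ CARD('d) * (real r / 2) powr - H"
        by (intro mult_right_mono) auto
      also have "\<dots> = (5 ^ CARD('d) * 2 powr H) * (real r powr real CARD('d) * real r powr - H)"
        using \<open>1 \<le> r\<close> by (simp add: powr_divide powr_minus divide_simps power_mult_distrib powr_realpow)
      also have "real r powr real CARD('d) * real r powr - H \<le> real r powr - \<kappa>"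
        using \<open>1 \<le> r\<close> H' by (simp add: powr_add[symmetric] powr_mono)
      finally show ?thesis by (simp add: mult_left_mono)
    qed
    hence "L / s * (V * A) * (real ((4 * r + 1) ^ CARD('d)) * (real r / 2) powr - H)
        \<le> L / s * (V * A) * ((5 ^ CARD('d) * 2 powr H) * real r powr - \<kappa>)"
      using L s_pos V_pos A_nonneg by (intro mult_left_mono) auto
    thus ?thesis by (simp add: b_def mult_ac)
  qed
  finally show ?thesis unfolding G_def using s_pos by (simp add: algebra_simps add_divide_distrib)
qed

end

lemma (in prob_space) expectation_abs_le_sqrt:
  fixes Z :: "'a \<Rightarrow> real"
  assumes [measurable]: "Z \<in> borel_measurable M" and b: "\<And>\<omega>. \<omega> \<in> space M \<Longrightarrow> \<bar>Z \<omega>\<bar> \<le> b"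
  shows "expectation (\<lambda>\<omega>. \<bar>Z \<omega>\<bar>) \<le> sqrt (expectation (\<lambda>\<omega>. (Z \<omega>)\<^sup>2))"
proof -
  have i1: "integrable M (\<lambda>\<omega>. \<bar>Z \<omega>\<bar>)" by (rule integrable_const_bound[where B=b]) (use b in auto)
  have i2: "integrable M (\<lambda>\<omega>. \<bar>Z \<omega>\<bar>\<^sup>2)"
  proof (rule integrable_const_bound[where B="b\<^sup>2"])
    show "AE \<omega> in M. norm (\<bar>Z \<omega>\<bar>\<^sup>2) \<le> b\<^sup>2"
    proof (rule AE_I2)
      fix \<omega> assume "\<omega> \<in> space M"
      thus "norm (\<bar>Z \<omega>\<bar>\<^sup>2) \<le> b\<^sup>2" using power_mono[OF b, of \<omega> 2] by simp
    qed
  qed simp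
  have "(expectation (\<lambda>\<omega>. \<bar>Z \<omega>\<bar>))\<^sup>2 \<le> expectation (\<lambda>\<omega>. (Z \<omega>)\<^sup>2)"
    using variance_eq[OF i1 i2] variance_positive[of "\<lambda>\<omega>. \<bar>Z \<omega>\<bar>"] by simp
  thus ?thesis by (rule real_le_rsqrt)
qed

context weak_field_scaled
begin

text \<open>
  Replacing \<open>X i\<close> by its approximation at radius \<open>m\<close> in one step would cost \<open>m powr -H\<close> times the
  size of \<open>f\<close>, which is too much after summation over \<open>i\<close>. Telescoping over dyadic radii pairs each
  error with an increment of \<open>f\<close>, which is small.
\<close>

lemma tail_field_decorr:
  fixes f :: "real \<Rightarrow> real"
  assumes lip: "\<And>a b. \<bar>f a - f b\<bar> \<le> L * \<bar>a - b\<bar>" and [measurable]: "f \<in> borel_measurable borel"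
    and fb: "\<And>a. \<bar>f a\<bar> \<le> B"
  shows "\<bar>expectation (\<lambda>\<omega>. X i \<omega> * f (tail_field i m \<omega>))\<bar>
    \<le> L / s * (V * A * (5 ^ CARD('d) * 2 powr H + 2 * 4 powr H * K)) / (1 - 2 powr - \<kappa>) * real m powr - \<kappa>"
proof -
  define C where "C = V * A * (5 ^ CARD('d) * 2 powr H + 2 * 4 powr H * K)"
  have L: "0 \<le> L" using lip[of 1 0] by simp
  have C: "0 \<le> C" using V_pos A_nonneg K_nonneg by (simp add: C_def)
  define e where "e l = expectation (\<lambda>\<omega>. X i \<omega> * f (tail_field i (2 ^ l * m) \<omega>))" for l
  define N where "N = Max (insert 0 ((\<lambda>j. sup_norm (j - i)) ` \<Gamma>))"
  have int: "integrable M (\<lambda>\<omega>. X i \<omega> * f (tail_field i r \<omega>))" for r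
    by (rule integrable_bounded[where b="V * B"])
       (use V_pos in \<open>auto simp: abs_mult intro!: mult_mono X_bound fb\<close>)
  \<comment> \<open>After \<open>N\<close> doublings the radius exceeds the distance from
    \<open>i\<close> to every site of \<open>\<Gamma>\<close>. The last tail field is therefore 0,
    and the telescoping ends in \<open>f 0\<close> times the mean of \<open>X i\<close>, which is
    0.\<close>
  have empty: "{j\<in>\<Gamma>. 2 ^ N * m < sup_norm (j - i)} = {}"
  proof -
    have "sup_norm (j - i) \<le> 2 ^ N * m" if "j \<in> \<Gamma>" for j
    proof -
      have "sup_norm (j - i) \<le> N" unfolding N_def using fin that by (intro Max_ge) auto
      also have "N \<le> 2 ^ N" by (rule less_imp_le, rule less_exp)
      also have "\<dots> \<le> 2 ^ N * m" using m_pos by simp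
      finally show ?thesis .
    qed
    thus ?thesis by force
  qed
  have "tail_field i (2 ^ N * m) = (\<lambda>_. 0)" unfolding tail_field_def fun_eq_iff empty by simp
  hence eN: "e N = 0" by (simp add: e_def X_mean)
  have step: "\<bar>e l - e (Suc l)\<bar> \<le> L / s * C * real m powr - \<kappa> * (2 powr - \<kappa>) ^ l" for l
  proof -
    have "e l - e (Suc l) = expectation (\<lambda>\<omega>. X i \<omega> * (f (tail_field i (2 ^ l * m) \<omega>) - f (tail_field i (2 * (2 ^ l * m)) \<omega>)))"
      unfolding e_def using int by (simp add: right_diff_distrib mult_ac)
    also have "\<bar>\<dots>\<bar> \<le> L / s * C * real (2 ^ l * m) powr - \<kappa>"
      unfolding C_def by (rule tail_field_step[OF lip]) (use m_pos in auto)
    also have "real (2 ^ l * m) powr - \<kappa> = real m powr - \<kappa> * (2 powr - \<kappa>) ^ l"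
      by (simp add: powr_mult powr_powr powr_realpow[symmetric] mult_ac)
    finally show ?thesis by (simp add: mult_ac)
  qed
  have q: "0 \<le> (2::real) powr - \<kappa>" "(2::real) powr - \<kappa> < 1"
    using H' by (auto intro: powr_less_one)
  have "e 0 = (\<Sum>l<N. e l - e (Suc l))" using eN by (subst sum_lessThan_telescope') simp
  also have "\<bar>\<dots>\<bar> \<le> (\<Sum>l<N. L / s * C * real m powr - \<kappa> * (2 powr - \<kappa>) ^ l)"
    by (intro order_trans[OF sum_abs] sum_mono step)
  also have "\<dots> = L / s * C * real m powr - \<kappa> * (\<Sum>l<N. (2 powr - \<kappa>) ^ l)"
    by (simp add: sum_distrib_left)
  also have "\<dots> \<le> L / s * C * real m powr - \<kappa> * (1 / (1 - 2 powr - \<kappa>))"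
  proof (rule mult_left_mono)
    have "(\<Sum>l<N. ((2::real) powr - \<kappa>) ^ l) \<le> (\<Sum>l. (2 powr - \<kappa>) ^ l)"
      using q by (intro sum_le_suminf summable_geometric) auto
    also have "\<dots> = 1 / (1 - 2 powr - \<kappa>)" using q by (intro suminf_geometric) auto
    finally show "(\<Sum>l<N. ((2::real) powr - \<kappa>) ^ l) \<le> 1 / (1 - 2 powr - \<kappa>)" .
  qed (use L C s_pos in auto)
  finally show ?thesis by (simp add: e_def C_def)
qed

section \<open>Local quadratic sums, their fluctuation, and the decomposition of the total\<close>

definition near :: "int ^ 'd \<Rightarrow> (int ^ 'd) set"
  where "near i = {j\<in>\<Gamma>. sup_norm (j - i) \<le> m}"

text \<open>Summed over \<open>\<Gamma>\<close> and divided by \<open>s\<^sup>2\<close>, this is the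
  random coefficient of \<open>f'\<close> in Stein's expansion; it should be close to 1.\<close>

definition quad :: "int ^ 'd \<Rightarrow> 'o \<Rightarrow> real"
  where "quad i \<omega> = X i \<omega> * (\<Sum>j\<in>near i. X j \<omega>)"

lemma quad_meas [measurable]: "quad i \<in> borel_measurable M"
  unfolding quad_def by measurable

lemma finite_near [simp]: "finite (near i)" using fin by (simp add: near_def)

lemma card_near: "real (card (near i)) \<le> (3 * real m) ^ CARD('d)"
proof -
  have "card (near i) \<le> card {j. sup_norm (j - i) \<le> m}" by (rule card_mono) (auto simp: near_def)
  hence "real (card (near i)) \<le> real ((2 * m + 1) ^ CARD('d))" unfolding card_ball by (rule of_nat_mono)
  also have "\<dots> \<le> (3 * real m) ^ CARD('d)"
    using m_pos unfolding of_nat_power by (intro power_mono) auto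
  finally show ?thesis .
qed

lemma nb_pos: "0 < nb" using m_pos by (simp add: nb_eq)

lemma near_sum_le:
  assumes "\<omega> \<in> space M" shows "\<bar>\<Sum>j\<in>near i. X j \<omega>\<bar> \<le> V * nb"
proof -
  have "\<bar>\<Sum>j\<in>near i. X j \<omega>\<bar> \<le> (\<Sum>j\<in>near i. V)"
    by (intro order_trans[OF sum_abs] sum_mono X_bound assms)
  also have "\<dots> \<le> V * nb" using V_pos card_near[of i] by (simp add: nb_eq mult.commute mult_left_mono)
  finally show ?thesis .
qed

lemma quad_le:
  assumes "\<omega> \<in> space M" shows "\<bar>quad i \<omega>\<bar> \<le> V\<^sup>2 * nb"
proof -
  have "\<bar>quad i \<omega>\<bar> \<le> V * (V * nb)"
    unfolding quad_def abs_mult using V_pos near_sum_le[OF assms] X_bound[OF assms] by (intro mult_mono) auto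
  thus ?thesis by (simp add: power2_eq_square mult_ac)
qed

text \<open>Each product sees only sites within \<open>m\<close> of its centre. Up to distance
  \<open>4 * m\<close> boundedness is used; beyond it, the two neighbourhoods lie well inside
  opposite sides of a ball of half the distance, and decoupling applies.\<close>

lemma quad_cov:
  "\<bar>expectation (\<lambda>\<omega>. quad i \<omega> * quad i' \<omega>) - expectation (quad i) * expectation (quad i')\<bar>
    \<le> (if sup_norm (i' - i) \<le> 4 * m then 2 * V ^ 4 * nb\<^sup>2 else 0)
      + 4 * V ^ 3 * nb\<^sup>2 * A * 8 powr H * (1 + real (sup_norm (i' - i))) powr - H"
proof (cases "sup_norm (i' - i) \<le> 4 * m")
  case True
  have a: "\<bar>expectation (quad i)\<bar> \<le> V\<^sup>2 * nb" for i
  proof -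
    have "\<bar>expectation (quad i)\<bar> \<le> expectation (\<lambda>\<omega>. \<bar>quad i \<omega>\<bar>)"
      using integral_norm_bound[of M "quad i"] by simp
    also have "\<dots> \<le> V\<^sup>2 * nb"
      by (rule integral_le_const[OF integrable_bounded[where b="V\<^sup>2 * nb"]]) (auto intro!: AE_I2 quad_le)
    finally show ?thesis .
  qed
  have b: "\<bar>expectation (\<lambda>\<omega>. quad i \<omega> * quad i' \<omega>)\<bar> \<le> (V\<^sup>2 * nb) * (V\<^sup>2 * nb)"
  proof -
    have "\<bar>expectation (\<lambda>\<omega>. quad i \<omega> * quad i' \<omega>)\<bar> \<le> expectation (\<lambda>\<omega>. \<bar>quad i \<omega> * quad i' \<omega>\<bar>)"
      using integral_norm_bound[of M "\<lambda>\<omega>. quad i \<omega> * quad i' \<omega>"] by simp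
    also have "\<dots> \<le> (V\<^sup>2 * nb) * (V\<^sup>2 * nb)"
      by (rule integral_le_const[OF integrable_bounded[where b="(V\<^sup>2 * nb) * (V\<^sup>2 * nb)"]])
         (use nb_pos in \<open>auto intro!: AE_I2 mult_mono quad_le simp: abs_mult\<close>)
    finally show ?thesis .
  qed
  have "\<bar>expectation (quad i) * expectation (quad i')\<bar> \<le> (V\<^sup>2 * nb) * (V\<^sup>2 * nb)"
    unfolding abs_mult using a nb_pos by (intro mult_mono) auto
  with b have "\<bar>expectation (\<lambda>\<omega>. quad i \<omega> * quad i' \<omega>) - expectation (quad i) * expectation (quad i')\<bar>
    \<le> 2 * ((V\<^sup>2 * nb) * (V\<^sup>2 * nb))" by linarith
  also have "\<dots> = 2 * V ^ 4 * nb\<^sup>2" by (simp add: power2_eq_square power4_eq_xxxx mult_ac)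
  finally show ?thesis using True V_pos A_nonneg by (simp add: add_increasing2)
next
  case False
  define N where "N = sup_norm (i' - i)"
  define r where "r = N div 2"
  let ?U = "{l. sup_norm (l - i) \<le> r}"
  \<comment> \<open>A common lower bound for 1 plus the two radii used below, \<open>r - m\<close>
    and \<open>N - r - m - 1\<close>; it holds because \<open>4 * m < N\<close>.\<close>
  let ?t = "(1 + real N) / 8"
  have N: "4 * m < N" using False by (simp add: N_def)
  have sq: "\<bar>a * b - a' * b'\<bar> \<le> V * \<bar>a - a'\<bar> + V * \<bar>b - b'\<bar>" if "\<bar>b\<bar> \<le> V" "\<bar>a'\<bar> \<le> V" for a b a' b' :: real
  proof -
    have "\<bar>a * b - a' * b'\<bar> = \<bar>b * (a - a') + a' * (b - b')\<bar>" by (simp add: algebra_simps)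
    also have "\<dots> \<le> \<bar>b\<bar> * \<bar>a - a'\<bar> + \<bar>a'\<bar> * \<bar>b - b'\<bar>"
      by (rule order_trans[OF abs_triangle_ineq]) (simp add: abs_mult)
    also have "\<dots> \<le> V * \<bar>a - a'\<bar> + V * \<bar>b - b'\<bar>" using that by (intro add_mono mult_right_mono) auto
    finally show ?thesis .
  qed
  \<comment> \<open>Here \<open>p\<close> is a projection of the pair: \<open>fst\<close> for the
    product at \<open>i\<close>, \<open>snd\<close> for the one at \<open>i'\<close>.\<close>
  have gen: "(\<integral>z. \<bar>quad k (mrg ?U z) - quad k (p z)\<bar> \<partial>(M \<Otimes>\<^sub>M M)) \<le> 2 * V * nb * (A * ?t powr - H)"
    if p: "\<And>z. z \<in> space (M \<Otimes>\<^sub>M M) \<Longrightarrow> p z \<in> space M" "p \<in> M \<Otimes>\<^sub>M M \<rightarrow>\<^sub>M M"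
      and ip: "\<And>j. integrable (M \<Otimes>\<^sub>M M) (\<lambda>z. \<bar>X j (mrg ?U z) - X j (p z)\<bar>)"
      and ep: "\<And>j. sup_norm (j - k) \<le> m \<Longrightarrow> (\<integral>z. \<bar>X j (mrg ?U z) - X j (p z)\<bar> \<partial>(M \<Otimes>\<^sub>M M)) \<le> A * ?t powr - H"
    for k p
  proof -
    have "(\<integral>z. \<bar>quad k (mrg ?U z) - quad k (p z)\<bar> \<partial>(M \<Otimes>\<^sub>M M))
      \<le> (\<integral>z. (\<Sum>j\<in>near k. V * \<bar>X k (mrg ?U z) - X k (p z)\<bar> + V * \<bar>X j (mrg ?U z) - X j (p z)\<bar>) \<partial>(M \<Otimes>\<^sub>M M))"
    proof (rule integral_mono')
      fix z assume z: "z \<in> space (M \<Otimes>\<^sub>M M)"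
      have "\<bar>quad k (mrg ?U z) - quad k (p z)\<bar> = \<bar>\<Sum>j\<in>near k. X k (mrg ?U z) * X j (mrg ?U z) - X k (p z) * X j (p z)\<bar>"
        by (simp add: quad_def sum_distrib_left sum_subtractf)
      also have "\<dots> \<le> (\<Sum>j\<in>near k. \<bar>X k (mrg ?U z) * X j (mrg ?U z) - X k (p z) * X j (p z)\<bar>)" by (rule sum_abs)
      also have "\<dots> \<le> (\<Sum>j\<in>near k. V * \<bar>X k (mrg ?U z) - X k (p z)\<bar> + V * \<bar>X j (mrg ?U z) - X j (p z)\<bar>)"
        by (intro sum_mono sq X_bound mrg_space p z)
      finally show "\<bar>quad k (mrg ?U z) - quad k (p z)\<bar> \<le> \<dots>" .
    qed (use V_pos ip in \<open>auto intro!: sum_nonneg\<close>)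
    also have "\<dots> = (\<Sum>j\<in>near k. V * (\<integral>z. \<bar>X k (mrg ?U z) - X k (p z)\<bar> \<partial>(M \<Otimes>\<^sub>M M)) + V * (\<integral>z. \<bar>X j (mrg ?U z) - X j (p z)\<bar> \<partial>(M \<Otimes>\<^sub>M M)))"
      using ip by (simp add: Bochner_Integration.integral_sum)
    also have "\<dots> \<le> (\<Sum>j\<in>near k. V * (A * ?t powr - H) + V * (A * ?t powr - H))"
      using V_pos by (intro sum_mono add_mono mult_left_mono ep) (auto simp: near_def)
    also have "\<dots> = real (card (near k)) * (2 * V * (A * ?t powr - H))" by simp
    also have "\<dots> \<le> nb * (2 * V * (A * ?t powr - H))"
      using V_pos A_nonneg card_near[of k] by (intro mult_right_mono) (auto simp: nb_eq)
    finally show ?thesis by (simp add: mult_ac)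
  qed
  have e1: "(\<integral>z. \<bar>quad i (mrg ?U z) - quad i (fst z)\<bar> \<partial>(M \<Otimes>\<^sub>M M)) \<le> 2 * V * nb * (A * ?t powr - H)"
  proof (rule gen)
    fix j assume j: "sup_norm (j - i) \<le> m"
    show "(\<integral>z. \<bar>X j (mrg ?U z) - X j (fst z)\<bar> \<partial>(M \<Otimes>\<^sub>M M)) \<le> A * ?t powr - H"
    proof (rule X_fst_le[where k="r - m"])
      fix l assume "sup_norm (l - j) \<le> r - m"
      thus "l \<in> ?U" using sup_norm_triangle_diff[of l i j] j N by (simp add: r_def)
    qed (use N in \<open>auto simp: r_def\<close>)
  qed (auto simp: space_pair_measure MM_integrable_X)
  have e2: "(\<integral>z. \<bar>quad i' (mrg ?U z) - quad i' (snd z)\<bar> \<partial>(M \<Otimes>\<^sub>M M)) \<le> 2 * V * nb * (A * ?t powr - H)"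
  proof (rule gen)
    fix j assume j: "sup_norm (j - i') \<le> m"
    show "(\<integral>z. \<bar>X j (mrg ?U z) - X j (snd z)\<bar> \<partial>(M \<Otimes>\<^sub>M M)) \<le> A * ?t powr - H"
    proof (rule X_snd_le[where k="N - r - m - 1"])
      fix l assume l: "sup_norm (l - j) \<le> N - r - m - 1"
      show "l \<notin> ?U"
      proof
        assume "l \<in> ?U"
        moreover have "N \<le> sup_norm (i' - j) + sup_norm (j - i)" unfolding N_def by (rule sup_norm_triangle_diff)
        moreover have "sup_norm (j - i) \<le> sup_norm (j - l) + sup_norm (l - i)" by (rule sup_norm_triangle_diff)
        ultimately show False
          using l j N sup_norm_minus_commute[of j l] sup_norm_minus_commute[of j i'] by (simp add: r_def)
      qed
    qed (use N in \<open>auto simp: r_def\<close>)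
  qed (auto simp: space_pair_measure MM_integrable_X)
  have "\<bar>expectation (\<lambda>\<omega>. quad i \<omega> * quad i' \<omega>) - expectation (quad i) * expectation (quad i')\<bar>
    \<le> (V\<^sup>2 * nb) * (\<integral>z. \<bar>quad i (mrg ?U z) - quad i (fst z)\<bar> \<partial>(M \<Otimes>\<^sub>M M)) + (V\<^sup>2 * nb) * (\<integral>z. \<bar>quad i' (mrg ?U z) - quad i' (snd z)\<bar> \<partial>(M \<Otimes>\<^sub>M M))"
    by (rule decouple) (auto intro: quad_le)
  also have "\<dots> \<le> (V\<^sup>2 * nb) * (2 * V * nb * (A * ?t powr - H)) + (V\<^sup>2 * nb) * (2 * V * nb * (A * ?t powr - H))"
    using nb_pos by (intro add_mono mult_left_mono e1 e2) auto
  also have "\<dots> = 4 * V ^ 3 * nb\<^sup>2 * A * 8 powr H * (1 + real N) powr - H"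
    by (simp add: powr_divide powr_minus divide_simps power2_eq_square power3_eq_cube)
  finally show ?thesis using False by (simp add: N_def)
qed

text \<open>A given \<open>i\<close> has at most \<open>(9 * m)^d\<close> partners within distance
  \<open>4 * m\<close>, and its covariances with the remaining ones are summable, so the variance
  grows only linearly in the number of sites.\<close>

lemma quad_sum_variance:
  "expectation (\<lambda>\<omega>. ((\<Sum>i\<in>\<Gamma>. quad i \<omega>) - (\<Sum>i\<in>\<Gamma>. expectation (quad i)))\<^sup>2)
    \<le> real (card \<Gamma>) * nb\<^sup>2 * (2 * V ^ 4 * (9 * real m) ^ CARD('d) + 4 * V ^ 3 * A * 8 powr H * K)"
proof -
  have iq: "integrable M (quad i)" for i
    by (rule integrable_bounded[where b="V\<^sup>2 * nb"]) (auto intro: quad_le)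
  have iqq: "integrable M (\<lambda>\<omega>. quad i \<omega> * quad j \<omega>)" for i j
    by (rule integrable_bounded[where b="(V\<^sup>2 * nb) * (V\<^sup>2 * nb)"])
       (use nb_pos in \<open>auto intro!: mult_mono quad_le simp: abs_mult\<close>)
  let ?e = "\<lambda>i. expectation (quad i)"
  have "expectation (\<lambda>\<omega>. ((\<Sum>i\<in>\<Gamma>. quad i \<omega>) - (\<Sum>i\<in>\<Gamma>. ?e i))\<^sup>2)
    = expectation (\<lambda>\<omega>. \<Sum>i\<in>\<Gamma>. \<Sum>j\<in>\<Gamma>. (quad i \<omega> - ?e i) * (quad j \<omega> - ?e j))"
    by (simp add: sum_subtractf[symmetric] power2_eq_square sum_product)
  also have "\<dots> = (\<Sum>i\<in>\<Gamma>. \<Sum>j\<in>\<Gamma>. expectation (\<lambda>\<omega>. (quad i \<omega> - ?e i) * (quad j \<omega> - ?e j)))"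
    using iq iqq by (simp add: Bochner_Integration.integral_sum algebra_simps)
  also have "\<dots> = (\<Sum>i\<in>\<Gamma>. \<Sum>j\<in>\<Gamma>. expectation (\<lambda>\<omega>. quad i \<omega> * quad j \<omega>) - ?e i * ?e j)"
    using iq iqq by (intro sum.cong refl) (simp add: algebra_simps prob_space)
  also have "\<dots> \<le> (\<Sum>i\<in>\<Gamma>. \<Sum>j\<in>\<Gamma>. (if sup_norm (j - i) \<le> 4 * m then 2 * V ^ 4 * nb\<^sup>2 else 0)
      + 4 * V ^ 3 * nb\<^sup>2 * A * 8 powr H * (1 + real (sup_norm (j - i))) powr - H)"
    by (intro sum_mono order_trans[OF abs_ge_self quad_cov])
  also have "\<dots> \<le> (\<Sum>i\<in>\<Gamma>. 2 * V ^ 4 * nb\<^sup>2 * (9 * real m) ^ CARD('d) + 4 * V ^ 3 * nb\<^sup>2 * A * 8 powr H * K)"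
  proof (rule sum_mono)
    fix i
    have "(\<Sum>j\<in>\<Gamma>. if sup_norm (j - i) \<le> 4 * m then 2 * V ^ 4 * nb\<^sup>2 else 0) = 2 * V ^ 4 * nb\<^sup>2 * real (card {j\<in>\<Gamma>. sup_norm (j - i) \<le> 4 * m})"
      using fin by (simp add: sum.If_cases Int_def)
    also have "real (card {j\<in>\<Gamma>. sup_norm (j - i) \<le> 4 * m}) \<le> (9 * real m) ^ CARD('d)"
    proof -
      have "card {j\<in>\<Gamma>. sup_norm (j - i) \<le> 4 * m} \<le> card {j. sup_norm (j - i) \<le> 4 * m}" by (rule card_mono) auto
      hence "real (card {j\<in>\<Gamma>. sup_norm (j - i) \<le> 4 * m}) \<le> real ((2 * (4 * m) + 1) ^ CARD('d))"
        by (simp only: card_ball of_nat_le_iff)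
      also have "\<dots> \<le> (9 * real m) ^ CARD('d)"
        using m_pos unfolding of_nat_power by (intro power_mono) auto
      finally show ?thesis .
    qed
    finally have 1: "(\<Sum>j\<in>\<Gamma>. if sup_norm (j - i) \<le> 4 * m then 2 * V ^ 4 * nb\<^sup>2 else 0) \<le> 2 * V ^ 4 * nb\<^sup>2 * (9 * real m) ^ CARD('d)"
      using V_pos by (simp add: mult_left_mono)
    have "(\<Sum>j\<in>\<Gamma>. 4 * V ^ 3 * nb\<^sup>2 * A * 8 powr H * (1 + real (sup_norm (j - i))) powr - H)
      = 4 * V ^ 3 * nb\<^sup>2 * A * 8 powr H * (\<Sum>j\<in>\<Gamma>. (1 + real (sup_norm (j - i))) powr - H)"
      by (simp add: sum_distrib_left)
    also have "\<dots> \<le> 4 * V ^ 3 * nb\<^sup>2 * A * 8 powr H * (K * 1 powr - \<kappa>)"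
      using V_pos A_nonneg fin by (intro mult_left_mono tail_sum) auto
    finally have 2: "(\<Sum>j\<in>\<Gamma>. 4 * V ^ 3 * nb\<^sup>2 * A * 8 powr H * (1 + real (sup_norm (j - i))) powr - H)
      \<le> 4 * V ^ 3 * nb\<^sup>2 * A * 8 powr H * K" by simp
    show "(\<Sum>j\<in>\<Gamma>. (if sup_norm (j - i) \<le> 4 * m then 2 * V ^ 4 * nb\<^sup>2 else 0)
      + 4 * V ^ 3 * nb\<^sup>2 * A * 8 powr H * (1 + real (sup_norm (j - i))) powr - H)
      \<le> 2 * V ^ 4 * nb\<^sup>2 * (9 * real m) ^ CARD('d) + 4 * V ^ 3 * nb\<^sup>2 * A * 8 powr H * K"
      unfolding sum.distrib using 1 2 by (rule add_mono)
  qed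
  also have "\<dots> = real (card \<Gamma>) * nb\<^sup>2 * (2 * V ^ 4 * (9 * real m) ^ CARD('d) + 4 * V ^ 3 * A * 8 powr H * K)"
    by (simp add: algebra_simps)
  finally show ?thesis .
qed

lemma expectation_quad: "expectation (quad i) = (\<Sum>j\<in>near i. c (j - i))"
proof -
  have "integrable M (\<lambda>\<omega>. X i \<omega> * X j \<omega>)" for j
    by (rule integrable_bounded[where b="V * V"])
       (use V_pos in \<open>auto intro!: mult_mono X_bound simp: abs_mult\<close>)
  thus ?thesis unfolding quad_def sum_distrib_left by (simp add: Bochner_Integration.integral_sum X_cov)
qed

definition total :: "'o \<Rightarrow> real"
  where "total \<omega> = (\<Sum>i\<in>\<Gamma>. X i \<omega>) / s"

lemma total_meas [measurable]: "total \<in> borel_measurable M"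
  unfolding total_def by measurable

lemma total_eq: "total \<omega> = (\<Sum>j\<in>near i. X j \<omega>) / s + tail_field i m \<omega>"
proof -
  have "\<Gamma> = near i \<union> {j\<in>\<Gamma>. m < sup_norm (j - i)}" by (auto simp: near_def)
  hence "(\<Sum>j\<in>\<Gamma>. X j \<omega>) = (\<Sum>j\<in>near i. X j \<omega>) + (\<Sum>j\<in>{j\<in>\<Gamma>. m < sup_norm (j - i)}. X j \<omega>)"
    using fin by (subst \<open>\<Gamma> = _\<close>, subst sum.union_disjoint) (auto simp: near_def)
  thus ?thesis by (simp add: total_def tail_field_def add_divide_distrib)
qed

lemma total_bounded: "\<omega> \<in> space M \<Longrightarrow> \<bar>total \<omega>\<bar> \<le> real (card \<Gamma>) * V / s"
  unfolding total_def using abs_sum_X_le[of \<omega> \<Gamma>] by simp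

text \<open>Needed because the Stein remainder contains the factor \<open>\<bar>w\<bar>\<close>. The
  second moment is a double sum of covariances, each row of which is bounded by their
  summability.\<close>

lemma expectation_total_abs:
  "expectation (\<lambda>\<omega>. \<bar>total \<omega>\<bar>) \<le> sqrt (real (card \<Gamma>) * ((V\<^sup>2 + 2 * V * A * 4 powr H) * K) / s\<^sup>2)"
proof -
  have ixx: "integrable M (\<lambda>\<omega>. X i \<omega> * X j \<omega>)" for i j
    by (rule integrable_bounded[where b="V * V"])
       (use V_pos in \<open>auto intro!: mult_mono X_bound simp: abs_mult\<close>)
  have "expectation (\<lambda>\<omega>. (total \<omega>)\<^sup>2) = (\<Sum>i\<in>\<Gamma>. \<Sum>j\<in>\<Gamma>. c (j - i)) / s\<^sup>2"
    unfolding total_def power_divide power2_eq_square[of "sum _ _"] sum_product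
    using ixx by (simp add: Bochner_Integration.integral_sum X_cov)
  also have "\<dots> \<le> (\<Sum>i\<in>\<Gamma>. (V\<^sup>2 + 2 * V * A * 4 powr H) * K) / s\<^sup>2"
  proof (intro divide_right_mono sum_mono)
    fix i
    have "(\<Sum>j\<in>\<Gamma>. c (j - i)) \<le> (\<Sum>j\<in>\<Gamma>. (V\<^sup>2 + 2 * V * A * 4 powr H) * (1 + real (sup_norm (j - i))) powr - H)"
      by (intro sum_mono order_trans[OF abs_ge_self cov_decay])
    also have "\<dots> \<le> (V\<^sup>2 + 2 * V * A * 4 powr H) * (K * 1 powr - \<kappa>)"
      unfolding sum_distrib_left[symmetric] using V_pos A_nonneg fin by (intro mult_left_mono tail_sum) auto
    finally show "(\<Sum>j\<in>\<Gamma>. c (j - i)) \<le> (V\<^sup>2 + 2 * V * A * 4 powr H) * K" by simp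
  qed simp
  finally have "expectation (\<lambda>\<omega>. (total \<omega>)\<^sup>2) \<le> real (card \<Gamma>) * ((V\<^sup>2 + 2 * V * A * 4 powr H) * K) / s\<^sup>2" by simp
  thus ?thesis
    by (intro order_trans[OF expectation_abs_le_sqrt[OF total_meas total_bounded]] real_sqrt_le_mono)
qed

end

subsection \<open>The Kolmogorov distance for fixed parameters\<close>

text \<open>The location of \<open>\<xi>\<close> is recorded because the ramp will have to be
  compared at \<open>\<xi>\<close> and at \<open>a\<close>.\<close>

lemma mvt_between:
  fixes f :: "real \<Rightarrow> real"
  assumes "\<And>w. (f has_real_derivative f' w) (at w)"
  shows "\<exists>\<xi>. f a - f b = (a - b) * f' \<xi> \<and> \<bar>\<xi> - a\<bar> \<le> \<bar>a - b\<bar>"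
proof (cases a b rule: linorder_cases)
  case less
  obtain \<xi> where "a < \<xi>" "\<xi> < b" "f b - f a = (b - a) * f' \<xi>" using MVT2[OF less assms] by auto
  thus ?thesis by (intro exI[of _ \<xi>]) (auto simp: algebra_simps)
next
  case greater
  obtain \<xi> where "b < \<xi>" "\<xi> < a" "f a - f b = (a - b) * f' \<xi>" using MVT2[OF greater assms] by auto
  thus ?thesis by (intro exI[of _ \<xi>]) (auto simp: algebra_simps)
qed auto

text \<open>The derivative \<open>f'\<close> is as steep as the ramp, so a second-order expansion
  would cost \<open>1 / l\<close> everywhere. Stein's equation expresses an increment of
  \<open>f'\<close> through increments of \<open>f\<close>, which are harmless, and one of the ramp,
  which vanishes unless \<open>w\<close> is within \<open>t\<close> of the slope. The price
  \<open>1 / l\<close> is thus paid on a window only.\<close>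

lemma stein_remainder:
  fixes f f' :: "real \<Rightarrow> real"
  assumes f: "\<And>w. (f has_real_derivative f' w) (at w)" "\<And>w. f' w = w * f w + (ramp z l w - c)"
    "\<And>w. \<bar>f w\<bar> \<le> 6" "\<And>w. \<bar>f' w\<bar> \<le> 2" and "0 < l" "\<bar>e\<bar> \<le> t"
  shows "\<bar>f w - f (w - e) - e * f' w\<bar> \<le> t\<^sup>2 * (6 + 2 * \<bar>w\<bar> + (if z - t < w \<and> w \<le> z + l + t then 1 / l else 0))"
proof -
  obtain \<xi> where \<xi>: "f w - f (w - e) = e * f' \<xi>" "\<bar>\<xi> - w\<bar> \<le> \<bar>e\<bar>"
    using mvt_between[OF f(1), of w "w - e"] by auto
  have t: "0 \<le> t" "\<bar>\<xi> - w\<bar> \<le> t" using \<xi>(2) assms(6) by linarith+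
  obtain \<eta> where \<eta>: "f \<xi> - f w = (\<xi> - w) * f' \<eta>" using mvt_between[OF f(1), of \<xi> w] by auto
  have "\<bar>w * (f \<xi> - f w)\<bar> \<le> \<bar>w\<bar> * (t * 2)"
    unfolding \<eta> abs_mult using t f(4) by (intro mult_left_mono mult_mono) auto
  moreover have "\<bar>(\<xi> - w) * f \<xi>\<bar> \<le> t * 6"
    unfolding abs_mult using t f(3) by (intro mult_mono) auto
  moreover have "\<bar>ramp z l \<xi> - ramp z l w\<bar> \<le> t * (if z - t < w \<and> w \<le> z + l + t then 1 / l else 0)"
  proof (cases "z - t < w \<and> w \<le> z + l + t")
    case True
    have "\<bar>\<xi> - w\<bar> / l \<le> t / l" using t \<open>0 < l\<close> by (intro divide_right_mono) auto
    thus ?thesis using True ramp_lipschitz[OF \<open>0 < l\<close>, of z \<xi> w] by simp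
  next
    case False
    hence "w \<le> z \<and> \<xi> \<le> z \<or> z + l \<le> w \<and> z + l \<le> \<xi>" using t by linarith
    hence "ramp z l \<xi> = ramp z l w" by (elim disjE conjE) (simp_all add: ramp_eq[OF \<open>0 < l\<close>])
    thus ?thesis using t \<open>0 < l\<close> by simp
  qed
  moreover have "f' \<xi> - f' w = (\<xi> - w) * f \<xi> + w * (f \<xi> - f w) + (ramp z l \<xi> - ramp z l w)"
    unfolding f(2)[of \<xi>] f(2)[of w] by (simp add: algebra_simps)
  ultimately have "\<bar>f' \<xi> - f' w\<bar> \<le> t * 6 + \<bar>w\<bar> * (t * 2) + t * (if z - t < w \<and> w \<le> z + l + t then 1 / l else 0)"
    by linarith
  also have "\<dots> = t * (6 + 2 * \<bar>w\<bar> + (if z - t < w \<and> w \<le> z + l + t then 1 / l else 0))"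
    by (simp add: algebra_simps)
  finally have "\<bar>e\<bar> * \<bar>f' \<xi> - f' w\<bar> \<le> t * (t * (6 + 2 * \<bar>w\<bar> + (if z - t < w \<and> w \<le> z + l + t then 1 / l else 0)))"
    using assms(6) t by (intro mult_mono) auto
  thus ?thesis using \<xi>(1) by (simp add: abs_mult[symmetric] right_diff_distrib power2_eq_square mult_ac)
qed

context weak_field_scaled
begin

text \<open>\<open>t\<close> bounds a normalised neighbourhood sum, and \<open>G\<close> is the
  total weight of the Stein remainders: the number of sites times \<open>V / s\<close> times
  \<open>t\<^sup>2\<close>. With a ramp of width \<open>4 * G\<close>, the product of this weight
  and the slope is exactly \<open>1/4\<close>, the coefficient that
  \<open>kolmogorov_bootstrap\<close> absorbs.\<close>

lemma stein_bound:
  fixes z :: real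
  defines "t \<equiv> V * nb / s"
  defines "G \<equiv> real (card \<Gamma>) * V / s * t\<^sup>2"
  shows "\<bar>expectation (\<lambda>\<omega>. ramp z (4 * G) (total \<omega>)) - (\<integral>x. ramp z (4 * G) x \<partial>gauss)\<bar>
    \<le> (2 * expectation (\<lambda>\<omega>. \<bar>1 - (\<Sum>i\<in>\<Gamma>. quad i \<omega>) / s\<^sup>2\<bar>)
      + real (card \<Gamma>) / s\<^sup>2 * (2 * (V * A * (5 ^ CARD('d) * 2 powr H + 2 * 4 powr H * K)) / (1 - 2 powr - \<kappa>) * real m powr - \<kappa>)
      + G * (6 + 2 * expectation (\<lambda>\<omega>. \<bar>total \<omega>\<bar>)))
      + measure M {\<omega>\<in>space M. z - t < total \<omega> \<and> total \<omega> \<le> z + 4 * G + t} / 4"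
proof -
  have t: "0 < t" using V_pos nb_pos s_pos by (simp add: t_def)
  have G: "0 < G" unfolding G_def using V_pos s_pos t fin by (simp add: card_gt_0_iff)
  define c0 where "c0 = (\<integral>x. ramp z (4 * G) x \<partial>gauss)"
  obtain f f' where f: "\<And>w. (f has_real_derivative f' w) (at w)"
    "\<And>w. f' w = w * f w + (ramp z (4 * G) w - c0)" "\<And>w. \<bar>f w\<bar> \<le> 6" "\<And>w. \<bar>f' w\<bar> \<le> 2"
    "continuous_on UNIV f'"
    by (rule stein_solution[OF continuous_on_ramp ramp_bounds, of z "4 * G", folded c0_def]) (rule that)
  have [measurable]: "f \<in> borel_measurable borel"
    using f(1) by (intro borel_measurable_continuous_onI) (meson DERIV_continuous_on has_field_derivative_at_within)
  have lip: "\<bar>f a - f b\<bar> \<le> 2 * \<bar>a - b\<bar>" for a b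
  proof -
    obtain \<xi> where "f a - f b = (a - b) * f' \<xi>" using mvt_between[OF f(1), of a b] by blast
    thus ?thesis using mult_left_mono[OF f(4)[of \<xi>], of "\<bar>a - b\<bar>"] by (simp add: abs_mult mult.commute)
  qed
  define S where "S \<omega> = (\<Sum>i\<in>\<Gamma>. quad i \<omega>)" for \<omega>
  define I where "I = {\<omega>\<in>space M. z - t < total \<omega> \<and> total \<omega> \<le> z + 4 * G + t}"
  have [measurable]: "S \<in> borel_measurable M" "I \<in> sets M" unfolding S_def I_def by measurable
  \<comment> \<open>Were \<open>X i\<close> independent of the sites further than \<open>m\<close>,
    this would have mean 0; here \<open>tail_field_decorr\<close> makes its mean small.\<close>
  define T where "T \<omega> = (\<Sum>i\<in>\<Gamma>. X i \<omega> * f (tail_field i m \<omega>)) / s" for \<omega>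
  define q where "q \<omega> = \<bar>1 - S \<omega> / s\<^sup>2\<bar>" for \<omega>
  have point: "\<bar>ramp z (4 * G) (total \<omega>) - c0 + T \<omega>\<bar> \<le> 2 * q \<omega> + G * (6 + 2 * \<bar>total \<omega>\<bar>) + indicator I \<omega> / 4"
    if \<omega>: "\<omega> \<in> space M" for \<omega>
  proof -
    define e where "e i = (\<Sum>j\<in>near i. X j \<omega>) / s" for i
    let ?W = "total \<omega>"
    let ?J = "if z - t < ?W \<and> ?W \<le> z + 4 * G + t then 1 / (4 * G) else 0"
    have eT: "tail_field i m \<omega> = ?W - e i" for i unfolding e_def using total_eq[of \<omega> i] by simp
    have et: "\<bar>e i\<bar> \<le> t" for i
      unfolding e_def t_def using near_sum_le[OF \<omega>, of i] s_pos by (simp add: divide_right_mono)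
    have 1: "(\<Sum>i\<in>\<Gamma>. X i \<omega> / s * (e i * f' ?W)) = f' ?W * (S \<omega> / s\<^sup>2)"
      by (simp add: S_def quad_def e_def sum_distrib_left sum_divide_distrib power2_eq_square mult_ac)
    have 2: "(\<Sum>i\<in>\<Gamma>. X i \<omega> / s * f ?W) = ?W * f ?W"
      by (simp add: total_def sum_distrib_right sum_divide_distrib)
    have "ramp z (4 * G) ?W - c0 = f' ?W - ?W * f ?W" using f(2)[of ?W] by simp
    \<comment> \<open>In the product of the total with \<open>f\<close>, each site compares
      \<open>f\<close> at the total with \<open>f\<close> at the total without its neighbourhood.
      The linear parts form \<open>S\<close>, the values at the tail fields form \<open>T\<close>,
      and the rest is left to \<open>stein_remainder\<close>.\<close>
    also have "\<dots> = f' ?W * (1 - S \<omega> / s\<^sup>2) - (\<Sum>i\<in>\<Gamma>. X i \<omega> / s * (f ?W - f (?W - e i) - e i * f' ?W)) - T \<omega>"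
      using 1 2 by (simp add: T_def eT sum_subtractf right_diff_distrib sum_divide_distrib)
    finally have "\<bar>ramp z (4 * G) ?W - c0 + T \<omega>\<bar>
      \<le> \<bar>f' ?W * (1 - S \<omega> / s\<^sup>2)\<bar> + \<bar>\<Sum>i\<in>\<Gamma>. X i \<omega> / s * (f ?W - f (?W - e i) - e i * f' ?W)\<bar>" by simp
    also have "\<dots> \<le> 2 * q \<omega> + (\<Sum>i\<in>\<Gamma>. V / s * (t\<^sup>2 * (6 + 2 * \<bar>?W\<bar> + ?J)))"
    proof (rule add_mono)
      show "\<bar>f' ?W * (1 - S \<omega> / s\<^sup>2)\<bar> \<le> 2 * q \<omega>"
        unfolding q_def abs_mult by (rule mult_right_mono[OF f(4)]) simp
      show "\<bar>\<Sum>i\<in>\<Gamma>. X i \<omega> / s * (f ?W - f (?W - e i) - e i * f' ?W)\<bar> \<le> (\<Sum>i\<in>\<Gamma>. V / s * (t\<^sup>2 * (6 + 2 * \<bar>?W\<bar> + ?J)))"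
      proof (intro order_trans[OF sum_abs] sum_mono)
        fix i
        show "\<bar>X i \<omega> / s * (f ?W - f (?W - e i) - e i * f' ?W)\<bar> \<le> V / s * (t\<^sup>2 * (6 + 2 * \<bar>?W\<bar> + ?J))"
          unfolding abs_mult
        proof (rule mult_mono)
          show "\<bar>X i \<omega> / s\<bar> \<le> V / s" using X_bound[OF \<omega>] s_pos by (simp add: divide_right_mono)
          show "\<bar>f ?W - f (?W - e i) - e i * f' ?W\<bar> \<le> t\<^sup>2 * (6 + 2 * \<bar>?W\<bar> + ?J)"
            by (rule stein_remainder[OF f(1-4) _ et]) (use G in auto)
        qed (use V_pos s_pos in auto)
      qed
    qed
    also have "(\<Sum>i\<in>\<Gamma>. V / s * (t\<^sup>2 * (6 + 2 * \<bar>?W\<bar> + ?J))) = G * (6 + 2 * \<bar>?W\<bar>) + G * ?J"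
      unfolding sum_constant G_def by (simp add: algebra_simps)
    also have "G * ?J = indicator I \<omega> / 4" using G \<omega> by (auto simp: I_def)
    finally show ?thesis by simp
  qed
  have iq: "integrable M q"
  proof (rule integrable_bounded[where b="1 + real (card \<Gamma>) * (V\<^sup>2 * nb) / s\<^sup>2"])
    fix \<omega> assume \<omega>: "\<omega> \<in> space M"
    have "\<bar>S \<omega>\<bar> \<le> (\<Sum>i\<in>\<Gamma>. V\<^sup>2 * nb)"
      unfolding S_def by (intro order_trans[OF sum_abs] sum_mono quad_le \<omega>)
    hence "\<bar>S \<omega> / s\<^sup>2\<bar> \<le> real (card \<Gamma>) * (V\<^sup>2 * nb) / s\<^sup>2" by (simp add: divide_right_mono)
    moreover have "\<bar>q \<omega>\<bar> \<le> 1 + \<bar>S \<omega> / s\<^sup>2\<bar>" unfolding q_def by linarith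
    ultimately show "\<bar>q \<omega>\<bar> \<le> 1 + real (card \<Gamma>) * (V\<^sup>2 * nb) / s\<^sup>2" by (rule order_trans[rotated, OF add_left_mono])
  qed (unfold q_def [abs_def], measurable)
  have iW: "integrable M (\<lambda>\<omega>. \<bar>total \<omega>\<bar>)"
    by (rule integrable_bounded[where b="real (card \<Gamma>) * V / s"]) (auto simp: total_bounded)
  have ixf: "integrable M (\<lambda>\<omega>. X i \<omega> * f (tail_field i m \<omega>))" for i
    by (rule integrable_bounded[where b="V * 6"])
       (use V_pos f(3) in \<open>auto simp: abs_mult intro!: mult_mono X_bound\<close>)
  have iT: "integrable M T" unfolding T_def using ixf by auto
  have ir: "integrable M (\<lambda>\<omega>. ramp z (4 * G) (total \<omega>))"
    by (rule integrable_bounded[where b=1]) (auto simp: ramp_bounds)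
  have ET: "\<bar>expectation T\<bar> \<le> real (card \<Gamma>) / s\<^sup>2 * (2 * (V * A * (5 ^ CARD('d) * 2 powr H + 2 * 4 powr H * K)) / (1 - 2 powr - \<kappa>) * real m powr - \<kappa>)"
  proof -
    have alg: "(\<Sum>i\<in>\<Gamma>. 2 / s * C / p * r) / s = real (card \<Gamma>) / s\<^sup>2 * (2 * C / p * r)" for C p r
      by (simp add: power2_eq_square)
    have E: "expectation T = (\<Sum>i\<in>\<Gamma>. expectation (\<lambda>\<omega>. X i \<omega> * f (tail_field i m \<omega>))) / s"
      unfolding T_def using ixf by (simp add: Bochner_Integration.integral_sum)
    have "\<bar>\<Sum>i\<in>\<Gamma>. expectation (\<lambda>\<omega>. X i \<omega> * f (tail_field i m \<omega>))\<bar>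
      \<le> (\<Sum>i\<in>\<Gamma>. 2 / s * (V * A * (5 ^ CARD('d) * 2 powr H + 2 * 4 powr H * K)) / (1 - 2 powr - \<kappa>) * real m powr - \<kappa>)"
      by (intro order_trans[OF sum_abs] sum_mono tail_field_decorr[OF lip _ f(3)]) measurable
    from divide_right_mono[OF this less_imp_le[OF s_pos]] show ?thesis
      unfolding E abs_divide abs_of_pos[OF s_pos] alg .
  qed
  have "\<bar>expectation (\<lambda>\<omega>. ramp z (4 * G) (total \<omega>)) - c0 + expectation T\<bar>
      = \<bar>expectation (\<lambda>\<omega>. ramp z (4 * G) (total \<omega>) - c0 + T \<omega>)\<bar>"
    using ir iT by (simp add: prob_space)
  also have "\<dots> \<le> expectation (\<lambda>\<omega>. \<bar>ramp z (4 * G) (total \<omega>) - c0 + T \<omega>\<bar>)"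
    using integral_norm_bound[of M "\<lambda>\<omega>. ramp z (4 * G) (total \<omega>) - c0 + T \<omega>"] by simp
  also have "\<dots> \<le> expectation (\<lambda>\<omega>. 2 * q \<omega> + G * (6 + 2 * \<bar>total \<omega>\<bar>) + indicator I \<omega> / 4)"
    using iq iW ir iT by (intro integral_mono point) (auto simp: emeasure_eq_measure)
  also have "\<dots> = 2 * expectation q + G * (6 + 2 * expectation (\<lambda>\<omega>. \<bar>total \<omega>\<bar>)) + measure M I / 4"
    using iq iW by (simp add: prob_space emeasure_eq_measure algebra_simps)
  finally have *: "\<bar>expectation (\<lambda>\<omega>. ramp z (4 * G) (total \<omega>)) - c0 + expectation T\<bar>
    \<le> 2 * expectation q + G * (6 + 2 * expectation (\<lambda>\<omega>. \<bar>total \<omega>\<bar>)) + measure M I / 4" .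
  have combine: "\<bar>x\<bar> \<le> (2 * a + b + g) + d / 4" if "\<bar>x + y\<bar> \<le> 2 * a + g + d / 4" "\<bar>y\<bar> \<le> b" for x y a b g d :: real
    using that by linarith
  show ?thesis
    using combine[OF * ET] unfolding q_def [abs_def] S_def I_def c0_def .
qed

text \<open>The distance of the quadratic sum from \<open>s\<^sup>2\<close> is split at its mean.
  The deviation of the mean is deterministic and is kept in terms of the covariances; the
  fluctuation is bounded by the standard deviation.\<close>

lemma kolmogorov_bound:
  fixes z :: real
  defines "t \<equiv> V * nb / s"
  defines "G \<equiv> real (card \<Gamma>) * V / s * t\<^sup>2"
  shows "\<bar>measure M {\<omega>\<in>space M. total \<omega> \<le> z} - cdf gauss z\<bar>
    \<le> 10 * G + 2 * (2 * (\<bar>1 - (\<Sum>i\<in>\<Gamma>. \<Sum>j\<in>near i. c (j - i)) / s\<^sup>2\<bar>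
          + sqrt (real (card \<Gamma>) * nb\<^sup>2 * (2 * V ^ 4 * (9 * real m) ^ CARD('d) + 4 * V ^ 3 * A * 8 powr H * K)) / s\<^sup>2)
      + real (card \<Gamma>) / s\<^sup>2 * (2 * (V * A * (5 ^ CARD('d) * 2 powr H + 2 * 4 powr H * K)) / (1 - 2 powr - \<kappa>) * real m powr - \<kappa>)
      + G * (6 + 2 * sqrt (real (card \<Gamma>) * ((V\<^sup>2 + 2 * V * A * 4 powr H) * K) / s\<^sup>2))) + t"
proof -
  have t: "0 < t" using V_pos nb_pos s_pos by (simp add: t_def)
  have G: "0 < G" unfolding G_def using V_pos s_pos t fin by (simp add: card_gt_0_iff)
  define Z where "Z \<omega> = (\<Sum>i\<in>\<Gamma>. quad i \<omega>) - (\<Sum>i\<in>\<Gamma>. expectation (quad i))" for \<omega>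
  have [measurable]: "Z \<in> borel_measurable M" unfolding Z_def by measurable
  have Zb: "\<bar>Z \<omega>\<bar> \<le> (\<Sum>i\<in>\<Gamma>. V\<^sup>2 * nb) + \<bar>\<Sum>i\<in>\<Gamma>. expectation (quad i)\<bar>" if "\<omega> \<in> space M" for \<omega>
    unfolding Z_def
    by (rule order_trans[OF abs_triangle_ineq4 add_right_mono], intro order_trans[OF sum_abs] sum_mono quad_le that)
  have iZ: "integrable M (\<lambda>\<omega>. \<bar>Z \<omega>\<bar>)" by (intro integrable_abs integrable_bounded[OF _ Zb]) auto
  let ?m = "(\<Sum>i\<in>\<Gamma>. \<Sum>j\<in>near i. c (j - i))"
  have "expectation (\<lambda>\<omega>. \<bar>1 - (\<Sum>i\<in>\<Gamma>. quad i \<omega>) / s\<^sup>2\<bar>) \<le> expectation (\<lambda>\<omega>. \<bar>1 - ?m / s\<^sup>2\<bar> + \<bar>Z \<omega>\<bar> / s\<^sup>2)"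
  proof (rule integral_mono')
    fix \<omega>
    have "1 - (\<Sum>i\<in>\<Gamma>. quad i \<omega>) / s\<^sup>2 = (1 - ?m / s\<^sup>2) - Z \<omega> / s\<^sup>2"
      by (simp add: Z_def expectation_quad diff_divide_distrib)
    thus "\<bar>1 - (\<Sum>i\<in>\<Gamma>. quad i \<omega>) / s\<^sup>2\<bar> \<le> \<bar>1 - ?m / s\<^sup>2\<bar> + \<bar>Z \<omega>\<bar> / s\<^sup>2"
      using abs_triangle_ineq4[of "1 - ?m / s\<^sup>2" "Z \<omega> / s\<^sup>2"] by simp
  qed (use iZ in auto)
  also have "\<dots> = \<bar>1 - ?m / s\<^sup>2\<bar> + expectation (\<lambda>\<omega>. \<bar>Z \<omega>\<bar>) / s\<^sup>2" using iZ by (simp add: prob_space)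
  also have "\<dots> \<le> \<bar>1 - ?m / s\<^sup>2\<bar> + sqrt (real (card \<Gamma>) * nb\<^sup>2 * (2 * V ^ 4 * (9 * real m) ^ CARD('d) + 4 * V ^ 3 * A * 8 powr H * K)) / s\<^sup>2"
  proof (intro add_left_mono divide_right_mono)
    have "expectation (\<lambda>\<omega>. \<bar>Z \<omega>\<bar>) \<le> sqrt (expectation (\<lambda>\<omega>. (Z \<omega>)\<^sup>2))"
      by (rule expectation_abs_le_sqrt[OF _ Zb]) auto
    also have "\<dots> \<le> sqrt (real (card \<Gamma>) * nb\<^sup>2 * (2 * V ^ 4 * (9 * real m) ^ CARD('d) + 4 * V ^ 3 * A * 8 powr H * K))"
      unfolding Z_def by (intro real_sqrt_le_mono quad_sum_variance)
    finally show "expectation (\<lambda>\<omega>. \<bar>Z \<omega>\<bar>) \<le> \<dots>" .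
  qed simp
  finally have q: "expectation (\<lambda>\<omega>. \<bar>1 - (\<Sum>i\<in>\<Gamma>. quad i \<omega>) / s\<^sup>2\<bar>)
    \<le> \<bar>1 - ?m / s\<^sup>2\<bar> + sqrt (real (card \<Gamma>) * nb\<^sup>2 * (2 * V ^ 4 * (9 * real m) ^ CARD('d) + 4 * V ^ 3 * A * 8 powr H * K)) / s\<^sup>2" .
  have W: "G * (6 + 2 * expectation (\<lambda>\<omega>. \<bar>total \<omega>\<bar>))
      \<le> G * (6 + 2 * sqrt (real (card \<Gamma>) * ((V\<^sup>2 + 2 * V * A * 4 powr H) * K) / s\<^sup>2))"
    using expectation_total_abs G by (intro mult_left_mono add_left_mono) auto
  have combine: "x \<le> 10 * G + 2 * (2 * b + u + d) + t"
    if "x \<le> 10 * G + 2 * (2 * a + u + e) + t" "a \<le> b" "e \<le> d" for x a b u d e :: real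
    using that by (simp add: distrib_left)
  show ?thesis
    by (rule combine[OF kolmogorov_bootstrap[OF total_meas G less_imp_le[OF t] stein_bound[folded t_def, folded G_def]] q W])
qed

end

subsection \<open>Choice of the neighbourhood size\<close>

context weak_field
begin

text \<open>This makes the \<open>infsum\<close> of the covariances a genuine sum, which can be cut
  at radius \<open>m\<close>.\<close>

lemma cov_abs_summable: "(\<lambda>k. \<bar>c k\<bar>) summable_on S"
proof -
  obtain K where K: "\<And>S::(int ^ 'd) set. finite S \<Longrightarrow> (\<Sum>j\<in>S. (1 + real (sup_norm j)) powr - H) \<le> K"
    using sum_sup_norm_bounded[OF H_gt] by metis
  let ?C = "V\<^sup>2 + 2 * V * A * 4 powr H"
  have C: "0 \<le> ?C" using V_pos A_nonneg by simp
  have "(\<Sum>k\<in>F. \<bar>c k\<bar>) \<le> ?C * K" if "finite F" for F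
  proof -
    have "(\<Sum>k\<in>F. \<bar>c k\<bar>) \<le> (\<Sum>k\<in>F. ?C * (1 + real (sup_norm k)) powr - H)"
      by (intro sum_mono cov_decay)
    also have "\<dots> \<le> ?C * K" unfolding sum_distrib_left[symmetric] by (intro mult_left_mono K that C)
    finally show ?thesis .
  qed
  thus ?thesis
    by (intro nonneg_bdd_above_summable_on bdd_aboveI[where M="?C * K"]) auto
qed

lemma cov_summable: "c summable_on S"
  by (rule abs_summable_summable) (use cov_abs_summable in simp)

text \<open>With \<open>k = j - i\<close>, the sum over the neighbours of \<open>i\<close> misses
  the \<open>k\<close> of norm above \<open>m\<close>, whose covariances are a small tail, and the
  \<open>k\<close> for which \<open>i + k\<close> leaves the box. On average over \<open>i\<close>
  the latter lose at most the fraction \<open>d * sup_norm k / n\<close> of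
  \<open>c k\<close>.\<close>

lemma variance_gap:
  fixes H' K :: real and n m :: nat
  assumes "H' \<le> H" and K: "\<And>S::(int ^ 'd) set. finite S \<Longrightarrow> (\<Sum>j\<in>S. (1 + real (sup_norm j)) powr - H') \<le> K"
    and n: "1 \<le> n" and m: "1 \<le> m"
  defines "C \<equiv> V\<^sup>2 + 2 * V * A * 4 powr H"
  shows "\<bar>(\<Sum>\<^sub>\<infinity>k. c k) - (\<Sum>i\<in>corner_box n. \<Sum>j\<in>{j\<in>corner_box n. sup_norm (j - i) \<le> m}. c (j - i)) / real n ^ CARD('d)\<bar>
    \<le> C * K * real m powr - (H - H') + real CARD('d) / real n * (\<Sum>k\<in>centered_box m. \<bar>c k\<bar> * real (sup_norm k))"
proof -
  let ?\<Gamma> = "corner_box n :: (int ^ 'd) set"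
  let ?B = "centered_box m :: (int ^ 'd) set"
  have C: "0 \<le> C" using V_pos A_nonneg by (simp add: C_def)
  define v where "v = (\<Sum>\<^sub>\<infinity>k. c k)"
  have split: "v = (\<Sum>k\<in>?B. c k) + infsum c (- ?B)"
  proof -
    have "v = infsum c (?B \<union> - ?B)" by (simp add: v_def)
    also have "\<dots> = infsum c ?B + infsum c (- ?B)" by (rule infsum_Un_disjoint[OF cov_summable cov_summable]) auto
    finally show ?thesis by simp
  qed
  have tail: "\<bar>infsum c (- ?B)\<bar> \<le> C * K * real m powr - (H - H')"
  proof -
    have "\<bar>infsum c (- ?B)\<bar> \<le> infsum (\<lambda>k. \<bar>c k\<bar>) (- ?B)"
      using norm_infsum_bound[of c "- ?B"] cov_abs_summable[of "- ?B"] by simp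
    also have "\<dots> \<le> C * K * real m powr - (H - H')"
    proof (rule infsum_le_finite_sums)
      fix F assume F: "finite F" "F \<subseteq> - ?B"
      have "(\<Sum>k\<in>F. \<bar>c k\<bar>) \<le> (\<Sum>k\<in>F. C * (1 + real (sup_norm k)) powr - H)"
        unfolding C_def by (intro sum_mono cov_decay)
      also have "\<dots> \<le> C * (K * real m powr - (H - H'))"
        unfolding sum_distrib_left[symmetric]
      proof (intro mult_left_mono C sum_sup_norm_tail[where H'=H' and K=K] K assms F)
        fix j assume "j \<in> F"
        hence "j \<notin> ?B" using F by auto
        thus "real m \<le> 1 + real (sup_norm j)" unfolding centered_box_iff by simp
      qed (use m in auto)
      finally show "(\<Sum>k\<in>F. \<bar>c k\<bar>) \<le> C * K * real m powr - (H - H')" by simp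
    qed (rule cov_abs_summable)
    finally show ?thesis .
  qed
  have inner: "(\<Sum>j\<in>{j\<in>?\<Gamma>. sup_norm (j - i) \<le> m}. c (j - i)) = (\<Sum>k\<in>?B. c k) - (\<Sum>k\<in>?B. if i + k \<in> ?\<Gamma> then 0 else c k)" for i
  proof -
    have "(\<Sum>j\<in>{j\<in>?\<Gamma>. sup_norm (j - i) \<le> m}. c (j - i)) = (\<Sum>k\<in>{k\<in>?B. i + k \<in> ?\<Gamma>}. c k)"
      by (rule sum.reindex_bij_witness[of _ "\<lambda>k. i + k" "\<lambda>j. j - i"]) (auto simp: centered_box_iff)
    also have "\<dots> = (\<Sum>k\<in>?B. if i + k \<in> ?\<Gamma> then c k else 0)"
      by (simp add: sum.inter_filter)
    also have "\<dots> = (\<Sum>k\<in>?B. c k - (if i + k \<in> ?\<Gamma> then 0 else c k))" by (rule sum.cong) auto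
    finally show ?thesis by (simp add: sum_subtractf)
  qed
  let ?R = "\<Sum>i\<in>?\<Gamma>. \<Sum>k\<in>?B. if i + k \<in> ?\<Gamma> then 0 else c k"
  have R: "\<bar>?R\<bar> \<le> real CARD('d) * real n ^ (CARD('d) - 1) * (\<Sum>k\<in>?B. \<bar>c k\<bar> * real (sup_norm k))"
  proof -
    have "\<bar>?R\<bar> \<le> (\<Sum>i\<in>?\<Gamma>. \<Sum>k\<in>?B. if i + k \<in> ?\<Gamma> then 0 else \<bar>c k\<bar>)"
      by (intro order_trans[OF sum_abs] sum_mono order_trans[OF sum_abs]) auto
    also have "\<dots> = (\<Sum>k\<in>?B. \<Sum>i\<in>?\<Gamma>. if i + k \<notin> ?\<Gamma> then \<bar>c k\<bar> else 0)"
      by (subst sum.swap) (intro sum.cong refl, auto)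
    also have "\<dots> = (\<Sum>k\<in>?B. real (card {i\<in>?\<Gamma>. i + k \<notin> ?\<Gamma>}) * \<bar>c k\<bar>)"
      by (intro sum.cong refl) (simp add: sum.inter_filter[symmetric])
    also have "\<dots> \<le> (\<Sum>k\<in>?B. (real CARD('d) * real (sup_norm k) * real n ^ (CARD('d) - 1)) * \<bar>c k\<bar>)"
    proof (intro sum_mono mult_right_mono)
      fix k :: "int ^ 'd"
      have "real (card {i\<in>?\<Gamma>. i + k \<notin> ?\<Gamma>}) \<le> real (CARD('d) * sup_norm k * n ^ (CARD('d) - 1))"
        by (rule of_nat_mono[OF card_corner_box_exit])
      thus "real (card {i\<in>?\<Gamma>. i + k \<notin> ?\<Gamma>}) \<le> real CARD('d) * real (sup_norm k) * real n ^ (CARD('d) - 1)" by simp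
    qed simp
    finally show ?thesis by (simp add: sum_distrib_left mult_ac)
  qed
  have pn: "real n ^ CARD('d) = real n ^ (CARD('d) - 1) * real n"
    by (metis One_nat_def Suc_pred power_Suc2 zero_less_card_finite)
  have "v - (\<Sum>i\<in>?\<Gamma>. \<Sum>j\<in>{j\<in>?\<Gamma>. sup_norm (j - i) \<le> m}. c (j - i)) / real n ^ CARD('d)
      = infsum c (- ?B) + ?R / real n ^ CARD('d)"
    using n unfolding inner split by (simp add: sum_subtractf card_corner_box diff_divide_distrib)
  also have "\<bar>\<dots>\<bar> \<le> \<bar>infsum c (- ?B)\<bar> + \<bar>?R\<bar> / real n ^ CARD('d)"
    by (rule order_trans[OF abs_triangle_ineq]) (simp add: abs_divide)
  also have "\<dots> \<le> C * K * real m powr - (H - H') + (real CARD('d) * real n ^ (CARD('d) - 1) * (\<Sum>k\<in>?B. \<bar>c k\<bar> * real (sup_norm k))) / real n ^ CARD('d)"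
    by (intro add_mono tail divide_right_mono R) auto
  also have "\<dots> = C * K * real m powr - (H - H') + real CARD('d) / real n * (\<Sum>k\<in>?B. \<bar>c k\<bar> * real (sup_norm k))"
    using n unfolding pn by simp
  finally show ?thesis unfolding v_def .
qed

text \<open>Two ways to bound the boundary term of \<open>variance_gap\<close>: one power of decay
  to spare yields a first moment uniform in \<open>m\<close>, and without it a factor
  \<open>m\<close> has to be accepted.\<close>

lemma weighted_cov_sum:
  fixes m :: nat
  defines "C \<equiv> V\<^sup>2 + 2 * V * A * 4 powr H"
  assumes K: "\<And>S::(int ^ 'd) set. finite S \<Longrightarrow> (\<Sum>j\<in>S. (1 + real (sup_norm j)) powr - H') \<le> K"
  shows "H' \<le> H \<Longrightarrow> (\<Sum>k\<in>centered_box m. \<bar>c k\<bar> * real (sup_norm k)) \<le> real m * (C * K)"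
    and "H' \<le> H - 1 \<Longrightarrow> (\<Sum>k\<in>centered_box m. \<bar>c k\<bar> * real (sup_norm k)) \<le> C * K"
proof -
  have C: "0 \<le> C" using V_pos A_nonneg by (simp add: C_def)
  let ?B = "centered_box m :: (int ^ 'd) set"
  assume le: "H' \<le> H"
  have "(\<Sum>k\<in>?B. \<bar>c k\<bar> * real (sup_norm k)) \<le> (\<Sum>k\<in>?B. (C * (1 + real (sup_norm k)) powr - H') * real m)"
  proof (intro sum_mono mult_mono)
    fix k assume "k \<in> ?B"
    show "\<bar>c k\<bar> \<le> C * (1 + real (sup_norm k)) powr - H'"
      using le by (intro order_trans[OF cov_decay[folded C_def]] mult_left_mono C powr_mono) auto
  qed (use C in \<open>auto simp: centered_box_iff\<close>)
  also have "\<dots> = real m * (C * (\<Sum>k\<in>?B. (1 + real (sup_norm k)) powr - H'))"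
    by (simp add: sum_distrib_left sum_distrib_right mult_ac)
  also have "\<dots> \<le> real m * (C * K)" by (intro mult_left_mono K C) auto
  finally show "(\<Sum>k\<in>?B. \<bar>c k\<bar> * real (sup_norm k)) \<le> real m * (C * K)" .
next
  have C: "0 \<le> C" using V_pos A_nonneg by (simp add: C_def)
  let ?B = "centered_box m :: (int ^ 'd) set"
  assume le: "H' \<le> H - 1"
  have "(\<Sum>k\<in>?B. \<bar>c k\<bar> * real (sup_norm k)) \<le> (\<Sum>k\<in>?B. C * (1 + real (sup_norm k)) powr - H')"
  proof (intro sum_mono)
    fix k :: "int ^ 'd"
    have "\<bar>c k\<bar> * real (sup_norm k) \<le> (C * (1 + real (sup_norm k)) powr - H) * (1 + real (sup_norm k)) powr 1"
      using C by (intro mult_mono cov_decay[folded C_def]) auto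
    also have "\<dots> = C * (1 + real (sup_norm k)) powr (1 - H)" unfolding mult.assoc powr_add[symmetric] by simp
    also have "\<dots> \<le> C * (1 + real (sup_norm k)) powr - H'" using le by (intro mult_left_mono C powr_mono) auto
    finally show "\<bar>c k\<bar> * real (sup_norm k) \<le> C * (1 + real (sup_norm k)) powr - H'" .
  qed
  also have "\<dots> \<le> C * K" unfolding sum_distrib_left[symmetric] by (intro mult_left_mono K C) auto
  finally show "(\<Sum>k\<in>?B. \<bar>c k\<bar> * real (sup_norm k)) \<le> C * K" .
qed

end

text \<open>The exponents are tuned so that \<open>n powr (\<epsilon> / (2 * d))\<close> to the
  power \<open>2 * d\<close> is \<open>n powr \<epsilon>\<close>, and to the power \<open>-D\<close>
  is exactly \<open>\<delta>\<close>. The last claim serves \<open>\<epsilon>\<close> close to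
  \<open>d / 2\<close>: there the available decay need not give the covariances a first moment, and
  the boundary costs \<open>m / n\<close>.\<close>

lemma scale_rates:
  fixes d \<epsilon> :: real and n :: nat
  assumes d: "1 \<le> d" and \<epsilon>: "0 < \<epsilon>" "\<epsilon> < d / 2" and n: "1 \<le> n"
  defines "D \<equiv> d\<^sup>2 / \<epsilon> - 2 * d"
  defines "m \<equiv> nat \<lfloor>real n powr (\<epsilon> / (2 * d))\<rfloor>"
  defines "\<delta> \<equiv> real n powr (- d / 2 + \<epsilon>)"
  shows "1 \<le> m" "real m powr (2 * d) * real n powr (- d / 2) \<le> \<delta>"
    "D \<le> k \<Longrightarrow> real m powr - k \<le> 2 powr k * \<delta>"
    "D < 1 / 2 \<Longrightarrow> real m / real n \<le> \<delta>"
proof -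
  define x where "x = real n powr (\<epsilon> / (2 * d))"
  have x1: "1 \<le> x" unfolding x_def using n \<epsilon> d by (intro ge_one_powr_ge_zero) auto
  have m: "real m \<le> x" "x - 1 < real m" using x1 unfolding m_def x_def[symmetric] by linarith+
  show m1: "1 \<le> m" using x1 by (simp add: m_def x_def[symmetric] le_nat_floor)
  \<comment> \<open>Rounding down loses at most a factor 2, the source of
    \<open>2 powr k\<close>.\<close>
  have m2: "x / 2 \<le> real m" using m m1 by linarith
  have "real m powr (2 * d) \<le> x powr (2 * d)" using m d by (intro powr_mono2) auto
  also have "x powr (2 * d) = real n powr \<epsilon>" using d by (simp add: x_def powr_powr)
  finally have "real m powr (2 * d) * real n powr (- d / 2) \<le> real n powr \<epsilon> * real n powr (- d / 2)"
    by (rule mult_right_mono) simp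
  also have "\<dots> = \<delta>" by (simp add: \<delta>_def powr_add[symmetric])
  finally show "real m powr (2 * d) * real n powr (- d / 2) \<le> \<delta>" .
  have D0: "0 \<le> D"
  proof -
    have "2 * d * \<epsilon> \<le> d * d" using \<epsilon> d by (simp add: mult.commute mult_left_mono)
    thus ?thesis using \<epsilon> by (simp add: D_def power2_eq_square field_simps)
  qed
  show "real m powr - k \<le> 2 powr k * \<delta>" if "D \<le> k"
  proof -
    have "real m powr - k \<le> (x / 2) powr - k" using m2 x1 D0 that by (intro powr_mono2') auto
    also have "\<dots> = 2 powr k * x powr - k" using x1 by (simp add: powr_divide powr_minus divide_simps)
    also have "\<dots> \<le> 2 powr k * x powr - D" using x1 that by (intro mult_left_mono powr_mono) auto
    also have "x powr - D = \<delta>"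
    proof -
      have "\<epsilon> / (2 * d) * - D = - d / 2 + \<epsilon>"
        using d \<epsilon> by (simp add: D_def divide_simps) (simp add: algebra_simps power2_eq_square)
      thus ?thesis by (simp add: x_def powr_powr \<delta>_def)
    qed
    finally show ?thesis .
  qed
  show "real m / real n \<le> \<delta>" if "D < 1 / 2"
  proof -
    have "real m / real n \<le> x / real n" using m by (intro divide_right_mono) auto
    also have "\<dots> = real n powr (\<epsilon> / (2 * d) - 1)" using n by (simp add: x_def powr_diff)
    also have "\<dots> \<le> \<delta>" unfolding \<delta>_def
    proof (rule powr_mono)
      \<comment> \<open>A small \<open>D\<close> forces \<open>d - 2 * \<epsilon> < 1 / 2\<close>,
        so \<open>\<delta>\<close> has an exponent above \<open>-1/4\<close>, whereas
        \<open>m / n\<close> is at most \<open>n powr (-3/4)\<close>.\<close>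
      have "d * d < (2 * d + 1 / 2) * \<epsilon>" using that \<epsilon> by (simp add: D_def power2_eq_square field_simps)
      hence "d * d - 2 * d * \<epsilon> < \<epsilon> / 2" by (simp add: algebra_simps)
      also have "\<dots> \<le> d / 2" using \<epsilon> by simp
      finally have "d * (d - 2 * \<epsilon>) < d * (1 / 2)" by (simp add: algebra_simps)
      hence "d - 2 * \<epsilon> < 1 / 2" using d by simp
      moreover have "\<epsilon> / (2 * d) \<le> 1 / 4" using \<epsilon> d by (simp add: field_simps)
      ultimately show "\<epsilon> / (2 * d) - 1 \<le> - d / 2 + \<epsilon>" by simp
    qed (use n in simp)
    finally show ?thesis .
  qed
qed

context weak_field
begin

lemma berry_esseen_rate:
  fixes d \<epsilon> v :: real
  defines "d \<equiv> real CARD('d)"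
  assumes \<epsilon>: "0 < \<epsilon>" "\<epsilon> < d / 2" and H: "(d\<^sup>2 / \<epsilon> - 2 * d) + d + 1 / 2 + d / 6 \<le> H"
    and v: "v = (\<Sum>\<^sub>\<infinity>k. c k)" "0 < v"
  shows "\<exists>C>0. \<forall>n\<ge>1. \<forall>z.
    \<bar>measure M {\<omega>\<in>space M. (\<Sum>i\<in>corner_box n. X i \<omega>) / (sqrt v * real n powr (d / 2)) \<le> z} - cdf gauss z\<bar>
      \<le> C * max (real n powr (- d / 2 + \<epsilon>)) (real n powr (-1))"
proof -
  define D where "D = d\<^sup>2 / \<epsilon> - 2 * d"
  have d1: "1 \<le> d" unfolding d_def by (simp add: Suc_leI)
  \<comment> \<open>Just above the dimension. If \<open>1 / 2 \<le> D\<close>, the hypothesis gives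
    \<open>H - 1 \<ge> d + d / 6\<close>, and \<open>d / 6 \<ge> 1 / 8\<close> since
    \<open>d \<ge> 1\<close>, so a first moment is available; in every case
    \<open>\<kappa> \<ge> D\<close>.\<close>
  define H1 where "H1 = d + 1 / 8"
  define \<kappa> where "\<kappa> = H - H1"
  have D0: "0 \<le> D"
  proof -
    have "2 * d * \<epsilon> \<le> d * d" using \<epsilon> d1 by (simp add: mult.commute mult_left_mono)
    thus ?thesis using \<epsilon> by (simp add: D_def power2_eq_square field_simps)
  qed
  have H1: "real CARD('d) < H1" "H1 < H" "D \<le> \<kappa>" "0 < \<kappa>" "1 / 2 \<le> D \<Longrightarrow> H1 \<le> H - 1"
    using H d1 D0 by (auto simp: H1_def d_def[symmetric] \<kappa>_def D_def[symmetric])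
  obtain K where K: "0 < K" "\<And>S::(int ^ 'd) set. finite S \<Longrightarrow> (\<Sum>j\<in>S. (1 + real (sup_norm j)) powr - H1) \<le> K"
    using sum_sup_norm_bounded[OF H1(1)] by blast
  define \<sigma> where "\<sigma> = sqrt v"
  have \<sigma>: "0 < \<sigma>" "\<sigma>\<^sup>2 = v" using v by (auto simp: \<sigma>_def)
  define C1 where "C1 = V\<^sup>2 + 2 * V * A * 4 powr H"
  define C2 where "C2 = 2 * (V * A * (5 ^ CARD('d) * 2 powr H + 2 * 4 powr H * K)) / (1 - 2 powr - \<kappa>)"
  define C3 where "C3 = 4 * V ^ 3 * A * 8 powr H * K"
  define C4 where "C4 = 9 ^ CARD('d) * (2 * V ^ 4 * 9 ^ CARD('d) + C3)"
  have "(2::real) powr - \<kappa> < 1" using H1(4) by (auto intro: powr_less_one)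
  hence Cpos: "0 < C1" "0 \<le> C2" "0 \<le> C3" "0 \<le> C4" "0 \<le> C1 * K"
    using V_pos A_nonneg K(1) by (auto simp: C1_def C2_def C3_def C4_def add_pos_nonneg)
  \<comment> \<open>The constants collect what does not depend on \<open>n\<close> in, respectively,
    the Stein remainder, a single neighbourhood sum, the variance gap, the quadratic fluctuation,
    the tail decorrelation and the mean of the absolute total.\<close>
  define cg where "cg = V ^ 3 * 9 ^ CARD('d) / \<sigma> ^ 3"
  define ct where "ct = V * 3 ^ CARD('d) / \<sigma>"
  define c1 where "c1 = (C1 * K * 2 powr \<kappa> + d * (C1 * K)) / v"
  define c2 where "c2 = sqrt C4 / v"
  define c3 where "c3 = C2 / v * 2 powr \<kappa>"
  define c4 where "c4 = sqrt (C1 * K / v)"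
  define C where "C = 10 * cg + 2 * (2 * (c1 + c2) + c3 + cg * (6 + 2 * c4)) + ct + 1"
  have cpos: "0 \<le> cg" "0 \<le> ct" "0 \<le> c1" "0 \<le> c2" "0 \<le> c3" "0 \<le> c4"
    using V_pos \<sigma>(1) Cpos d1 v(2) by (auto simp: cg_def ct_def c1_def c2_def c3_def c4_def)
  have "0 < C" unfolding C_def using cpos by (intro add_nonneg_pos add_nonneg_nonneg mult_nonneg_nonneg) auto
  moreover have "\<bar>measure M {\<omega>\<in>space M. (\<Sum>i\<in>corner_box n. X i \<omega>) / (sqrt v * real n powr (d / 2)) \<le> z} - cdf gauss z\<bar>
      \<le> C * max (real n powr (- d / 2 + \<epsilon>)) (real n powr (-1))" if n: "1 \<le> n" for n z
  proof -
    define m where "m = nat \<lfloor>real n powr (\<epsilon> / (2 * d))\<rfloor>"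
    define \<delta> where "\<delta> = real n powr (- d / 2 + \<epsilon>)"
    define u where "u = max \<delta> (real n powr (-1))"
    note rates = scale_rates[OF d1 \<epsilon> n, folded m_def \<delta>_def D_def]
    define N where "N = real n ^ CARD('d)"
    define h where "h = real n powr (d / 2)"
    define s where "s = \<sigma> * h"
    define nb where "nb = (3 * real m) ^ CARD('d)"
    have N: "0 < N" "h\<^sup>2 = N" "0 < h" "real n powr (- d / 2) = 1 / h"
      using n by (auto simp: N_def h_def power2_eq_square powr_add[symmetric] d_def powr_realpow powr_minus divide_simps)
    have s: "0 < s" "s\<^sup>2 = v * N" using \<sigma> N by (auto simp: s_def power_mult_distrib)
    have m: "1 \<le> m" by (rule rates(1))
    define y where "y = real m ^ CARD('d)"
    have y1: "1 \<le> y" using m by (simp add: y_def)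
    have "2 * d = real (CARD('d) * 2)" by (simp add: d_def)
    hence "real m powr (2 * d) = real m ^ (CARD('d) * 2)" using m by (simp only: powr_realpow of_nat_0_less_iff)
    hence ym: "real m powr (2 * d) = y\<^sup>2" unfolding y_def power_mult .
    have yu: "y\<^sup>2 / h \<le> u" using rates(2) unfolding N(4) ym by (simp add: u_def le_max_iff_disj)
    have y2: "y \<le> y\<^sup>2" using y1 by (simp add: power2_eq_square)
    have u0: "0 \<le> u" by (simp add: u_def le_max_iff_disj)
    have corner: "corner_box n \<noteq> {}"
    proof -
      have "0 \<in> corner_box n" using n by (simp add: corner_box_def)
      thus ?thesis by blast
    qed
    interpret S: weak_field_scaled M X mrg V A H c H1 K "corner_box n" s m nb
      by unfold_locales (use H1 K s m corner in \<open>auto simp: nb_def\<close>)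
    have cardN: "real (card (corner_box n :: (int ^ 'd) set)) = N" by (simp add: card_corner_box N_def)
    have nb: "nb = 3 ^ CARD('d) * y" by (simp add: nb_def y_def power_mult_distrib)
    define t where "t = V * nb / s"
    define G where "G = N * V / s * t\<^sup>2"
    have t: "t \<le> ct * u"
    proof -
      have "t = ct * (y / h)" by (simp add: t_def ct_def nb s_def)
      also have "y / h \<le> y\<^sup>2 / h" using y2 N(3) by (simp add: divide_right_mono)
      also note yu
      finally show ?thesis using cpos by (simp add: mult_left_mono)
    qed
    have G: "G \<le> cg * u"
    proof -
      have "G = cg * (y\<^sup>2 / h)"
        using N(3) \<sigma>(1) unfolding G_def t_def cg_def nb s_def N(2)[symmetric]
        by (simp add: power2_eq_square power3_eq_cube field_simps power_mult_distrib[symmetric])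
      also have "\<dots> \<le> cg * u" using yu cpos by (intro mult_left_mono) auto
      finally show ?thesis .
    qed
    have G0: "0 \<le> G" using N s V_pos by (simp add: G_def)
    define a1 where "a1 = \<bar>1 - (\<Sum>i\<in>corner_box n. \<Sum>j\<in>S.near i. c (j - i)) / s\<^sup>2\<bar>"
    have a1: "a1 \<le> c1 * u"
    proof -
      define w where "w = (\<Sum>k\<in>(centered_box m :: (int ^ 'd) set). \<bar>c k\<bar> * real (sup_norm k))"
      have w: "w / real n \<le> C1 * K * u"
      \<comment> \<open>For small \<open>D\<close> the boundary term \<open>m / n\<close> is below
        \<open>n powr (-d/2 + \<epsilon>)\<close>. Otherwise there is decay enough for a first
        moment, and the boundary costs \<open>1 / n\<close>, the second entry of the
        maximum.\<close>
      proof (cases "D < 1 / 2")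
        case True
        have "w \<le> real m * (C1 * K)"
          unfolding w_def C1_def by (rule weighted_cov_sum(1)[OF K(2)]) (use H1 in auto)
        hence "w / real n \<le> real m * (C1 * K) / real n" by (rule divide_right_mono) simp
        also have "\<dots> = (C1 * K) * (real m / real n)" by simp
        also have "\<dots> \<le> (C1 * K) * u"
          using rates(4)[OF True] Cpos by (intro mult_left_mono) (auto simp: u_def)
        finally show ?thesis by simp
      next
        case False
        have "w \<le> C1 * K"
          unfolding w_def C1_def by (rule weighted_cov_sum(2)[OF K(2)]) (use H1 False in auto)
        hence "w / real n \<le> (C1 * K) * (1 / real n)" using n by (simp add: divide_right_mono)
        also have "\<dots> \<le> (C1 * K) * u"
          using n Cpos by (intro mult_left_mono) (auto simp: u_def powr_minus divide_simps)
        finally show ?thesis by simp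
      qed
      define Y where "Y = (\<Sum>i\<in>corner_box n. \<Sum>j\<in>S.near i. c (j - i))"
      have "\<bar>v - Y / N\<bar> \<le> C1 * K * real m powr - \<kappa> + d / real n * w"
        unfolding v(1) Y_def S.near_def N_def C1_def \<kappa>_def d_def w_def
        by (rule variance_gap) (use H1 K n m in auto)
      also have "d / real n * w = d * (w / real n)" by simp
      also have "C1 * K * real m powr - \<kappa> + d * (w / real n) \<le> C1 * K * (2 powr \<kappa> * u) + d * (C1 * K * u)"
        using rates(3)[OF H1(3)] w Cpos d1
        by (intro add_mono mult_left_mono) (auto simp: u_def intro: order_trans[OF _ mult_left_mono])
      also have "\<dots> = v * (c1 * u)" using v(2) by (simp add: c1_def field_simps)
      finally have *: "\<bar>v - Y / N\<bar> \<le> v * (c1 * u)" .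
      have "a1 = \<bar>(v - Y / N) / v\<bar>"
        unfolding a1_def Y_def[symmetric] s(2) using v(2) N(1) by (simp add: field_simps)
      also have "\<dots> = \<bar>v - Y / N\<bar> / v" using v(2) by simp
      also have "\<dots> \<le> c1 * u" using * v(2) by (simp add: divide_simps mult.commute)
      finally show ?thesis .
    qed
    define a2 where "a2 = sqrt (N * nb\<^sup>2 * (2 * V ^ 4 * (9 * real m) ^ CARD('d) + C3)) / s\<^sup>2"
    have a2: "a2 \<le> c2 * u"
    proof -
      \<comment> \<open>The true order of the fluctuation is \<open>y powr (3/2) / h\<close>.
        Rounding \<open>y\<close> up to \<open>y\<^sup>2\<close> in the last factor brings it under
        the same \<open>y\<^sup>2 / h\<close> as the Stein remainder.\<close>
      have "N * nb\<^sup>2 * (2 * V ^ 4 * (9 * real m) ^ CARD('d) + C3) \<le> N * (9 ^ CARD('d) * y\<^sup>2) * ((2 * V ^ 4 * 9 ^ CARD('d) + C3) * y\<^sup>2)"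
      proof (rule mult_mono)
        have "nb\<^sup>2 = 9 ^ CARD('d) * y\<^sup>2"
          by (simp add: nb power2_eq_square power_mult_distrib[symmetric] algebra_simps)
        thus "N * nb\<^sup>2 \<le> N * (9 ^ CARD('d) * y\<^sup>2)" by simp
        have "2 * V ^ 4 * (9 * real m) ^ CARD('d) + C3 = 2 * V ^ 4 * 9 ^ CARD('d) * y + C3 * 1"
          by (simp add: y_def power_mult_distrib)
        also have "\<dots> \<le> 2 * V ^ 4 * 9 ^ CARD('d) * y\<^sup>2 + C3 * y\<^sup>2"
          using y1 y2 Cpos by (intro add_mono mult_left_mono) auto
        finally show "2 * V ^ 4 * (9 * real m) ^ CARD('d) + C3 \<le> (2 * V ^ 4 * 9 ^ CARD('d) + C3) * y\<^sup>2"
          by (simp add: algebra_simps)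
      qed (use N Cpos in auto)
      also have "\<dots> = C4 * (h * y\<^sup>2)\<^sup>2" by (simp add: C4_def N(2)[symmetric] power2_eq_square mult_ac)
      finally have "sqrt (N * nb\<^sup>2 * (2 * V ^ 4 * (9 * real m) ^ CARD('d) + C3)) \<le> sqrt (C4 * (h * y\<^sup>2)\<^sup>2)"
        by (rule real_sqrt_le_mono)
      also have "\<dots> = sqrt C4 * (h * y\<^sup>2)" using N(3) by (simp add: real_sqrt_mult abs_mult)
      finally have "a2 \<le> sqrt C4 * (h * y\<^sup>2) / s\<^sup>2" unfolding a2_def by (rule divide_right_mono) simp
      also have "\<dots> = c2 * (y\<^sup>2 / h)"
        unfolding s(2) N(2)[symmetric] c2_def using v(2) N(3) by (simp add: field_simps power2_eq_square)
      also have "\<dots> \<le> c2 * u" using yu cpos by (intro mult_left_mono) auto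
      finally show ?thesis .
    qed
    define a3 where "a3 = N / s\<^sup>2 * (C2 * real m powr - \<kappa>)"
    have a3: "a3 \<le> c3 * u"
    proof -
      have "a3 = C2 / v * real m powr - \<kappa>" unfolding a3_def s(2) using N by simp
      also have "\<dots> \<le> C2 / v * (2 powr \<kappa> * u)"
      proof (rule mult_left_mono)
        have "2 powr \<kappa> * \<delta> \<le> 2 powr \<kappa> * u" by (simp add: u_def mult_left_mono)
        thus "real m powr - \<kappa> \<le> 2 powr \<kappa> * u" using rates(3)[OF H1(3)] by (rule order_trans[rotated])
      qed (use Cpos v(2) in auto)
      finally show ?thesis by (simp add: c3_def)
    qed
    have a4: "sqrt (N * (C1 * K) / s\<^sup>2) = c4" unfolding s(2) c4_def using N by simp
    have G': "G * (6 + 2 * c4) \<le> (cg * u) * (6 + 2 * c4)"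
      using G cpos by (intro mult_right_mono) auto
    have "\<bar>measure M {\<omega>\<in>space M. S.total \<omega> \<le> z} - cdf gauss z\<bar>
      \<le> 10 * G + 2 * (2 * (a1 + a2) + a3 + G * (6 + 2 * c4)) + t"
      using S.kolmogorov_bound[of z, unfolded cardN, folded \<kappa>_def, folded C1_def C2_def C3_def t_def, folded G_def, unfolded a4]
      unfolding a1_def a2_def a3_def .
    also have "10 * G + 2 * (2 * (a1 + a2) + a3 + G * (6 + 2 * c4)) + t \<le> 10 * (cg * u) + 2 * (2 * (c1 * u + c2 * u) + c3 * u + (cg * u) * (6 + 2 * c4)) + ct * u"
      by (intro add_mono mult_left_mono G G' t a1 a2 a3) simp_all
    also have "\<dots> = (C - 1) * u" by (simp add: C_def algebra_simps)
    also have "\<dots> \<le> C * u" using u0 by (simp add: mult_right_mono)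
    finally show ?thesis unfolding S.total_def unfolding s_def h_def \<sigma>_def u_def \<delta>_def .
  qed
  ultimately show ?thesis by blast
qed

end

subsection \<open>Splicing iid configurations and the factor map\<close>

lemma shift_by_shift_by: "shift_by i (shift_by j x) = shift_by (i + j) x"
  by (simp add: shift_by_def add_ac)

lemma shift_by_0 [simp]: "shift_by 0 x = x"
  by (simp add: shift_by_def)

lemma prob_space_iid_measure: "prob_space P \<Longrightarrow> prob_space (iid_measure P)"
  unfolding iid_measure_def by (rule prob_space_PiM)

lemma distr_shift_by:
  assumes "prob_space P"
  shows "shift_by i \<in> iid_measure P \<rightarrow>\<^sub>M iid_measure P"
    and "distr (iid_measure P) (iid_measure P) (shift_by i) = (iid_measure P :: (int ^ 'd \<Rightarrow> 'l) measure)"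
proof -
  let ?M = "iid_measure P :: (int ^ 'd \<Rightarrow> 'l) measure"
  show "shift_by i \<in> ?M \<rightarrow>\<^sub>M ?M"
    unfolding iid_measure_def shift_by_def
    by (rule measurable_PiM_single') (auto simp: space_PiM)
  have "distr (Pi\<^sub>M UNIV (\<lambda>_. P)) (\<Pi>\<^sub>M j\<in>UNIV. P) (\<lambda>\<omega>. \<lambda>n\<in>UNIV. \<omega> (i + n)) = (\<Pi>\<^sub>M j\<in>(UNIV :: (int ^ 'd) set). P)"
    by (rule distr_PiM_reindex) (auto intro: assms)
  thus "distr ?M ?M (shift_by i) = ?M"
    by (simp add: iid_measure_def shift_by_def[abs_def] restrict_UNIV)
qed

definition splice_sites :: "(int ^ 'd) set \<Rightarrow> (int ^ 'd \<Rightarrow> 'l) \<times> (int ^ 'd \<Rightarrow> 'l) \<Rightarrow> int ^ 'd \<Rightarrow> 'l"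
  where "splice_sites U z j = (if j \<in> U then fst z j else snd z j)"

text \<open>It suffices to look at cylinders. The constraints at sites in \<open>U\<close> concern
  the first configuration and the others the second, so the preimage is a rectangle, and its measure
  is the same product over sites.\<close>

lemma distr_splice_sites:
  assumes "prob_space P"
  shows "splice_sites U \<in> iid_measure P \<Otimes>\<^sub>M iid_measure P \<rightarrow>\<^sub>M iid_measure P"
    and "distr (iid_measure P \<Otimes>\<^sub>M iid_measure P) (iid_measure P) (splice_sites U) = (iid_measure P :: (int ^ 'd \<Rightarrow> 'l) measure)"
proof -
  let ?M = "iid_measure P :: (int ^ 'd \<Rightarrow> 'l) measure"
  interpret P: prob_space P by fact
  interpret pp: product_prob_space "\<lambda>_. P" "UNIV :: (int ^ 'd) set" ..
  interpret M: prob_space ?M by (rule prob_space_iid_measure[OF assms])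
  have comp [measurable]: "(\<lambda>z. z j) \<in> ?M \<rightarrow>\<^sub>M P" for j unfolding iid_measure_def by measurable
  have spM: "space ?M = {x. \<forall>j. x j \<in> space P}" by (auto simp: iid_measure_def space_PiM)
  show meas: "splice_sites U \<in> ?M \<Otimes>\<^sub>M ?M \<rightarrow>\<^sub>M ?M"
  proof -
    have "(\<lambda>z j. if j \<in> U then fst z j else snd z j) \<in> ?M \<Otimes>\<^sub>M ?M \<rightarrow>\<^sub>M Pi\<^sub>M UNIV (\<lambda>_. P)"
    proof (rule measurable_PiM_single')
      fix j :: "int ^ 'd"
      show "(\<lambda>z. if j \<in> U then fst z j else snd z j) \<in> ?M \<Otimes>\<^sub>M ?M \<rightarrow>\<^sub>M P"
        by (cases "j \<in> U") (simp_all, measurable)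
    qed (auto simp: space_pair_measure spM)
    thus ?thesis unfolding splice_sites_def[abs_def] iid_measure_def by simp
  qed
  show "distr (?M \<Otimes>\<^sub>M ?M) ?M (splice_sites U) = ?M"
    unfolding iid_measure_def
  proof (rule pp.PiM_eq, goal_cases)
    case (2 J F)
    note J = 2
    let ?D = "distr (Pi\<^sub>M UNIV (\<lambda>_. P) \<Otimes>\<^sub>M Pi\<^sub>M UNIV (\<lambda>_. P)) (Pi\<^sub>M UNIV (\<lambda>_. P)) (splice_sites U)"
    have emb: "prod_emb UNIV (\<lambda>_. P) J (Pi\<^sub>E J F) = {x\<in>space ?M. \<forall>j\<in>J. x j \<in> F j}"
      unfolding iid_measure_def prod_emb_def using J by (auto simp: space_PiM Pi_iff)
    have cyl: "{x\<in>space ?M. \<forall>j\<in>S. x j \<in> F j} \<in> sets ?M" if "S \<subseteq> J" for S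
    proof (rule sets.sets_Collect_finite_All)
      fix j assume "j \<in> S"
      have "(\<lambda>x. x j) -` F j \<inter> space ?M \<in> sets ?M"
        using J(3) that \<open>j \<in> S\<close> by (intro measurable_sets[OF comp]) auto
      thus "{x\<in>space ?M. x j \<in> F j} \<in> sets ?M" by (simp add: vimage_def Int_def conj_commute)
    qed (use J that finite_subset in blast)
    have sets: "prod_emb UNIV (\<lambda>_. P) J (Pi\<^sub>E J F) \<in> sets (Pi\<^sub>M UNIV (\<lambda>_. P))"
      using J by (intro sets_PiM_I) auto
    have "emeasure ?D (prod_emb UNIV (\<lambda>_. P) J (Pi\<^sub>E J F))
        = emeasure (?M \<Otimes>\<^sub>M ?M) (splice_sites U -` prod_emb UNIV (\<lambda>_. P) J (Pi\<^sub>E J F) \<inter> space (?M \<Otimes>\<^sub>M ?M))"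
      using meas sets unfolding iid_measure_def by (intro emeasure_distr)
    also have "splice_sites U -` prod_emb UNIV (\<lambda>_. P) J (Pi\<^sub>E J F) \<inter> space (?M \<Otimes>\<^sub>M ?M)
        = {x\<in>space ?M. \<forall>j\<in>J \<inter> U. x j \<in> F j} \<times> {x\<in>space ?M. \<forall>j\<in>J - U. x j \<in> F j}"
    proof (rule set_eqI)
      fix z :: "(int ^ 'd \<Rightarrow> 'l) \<times> (int ^ 'd \<Rightarrow> 'l)"
      have "(\<forall>j\<in>J. splice_sites U z j \<in> F j) \<longleftrightarrow> (\<forall>j\<in>J \<inter> U. fst z j \<in> F j) \<and> (\<forall>j\<in>J - U. snd z j \<in> F j)"
        unfolding splice_sites_def by auto
      moreover have "z \<in> space (?M \<Otimes>\<^sub>M ?M) \<Longrightarrow> splice_sites U z \<in> space ?M"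
        by (rule measurable_space[OF meas])
      ultimately show "z \<in> splice_sites U -` prod_emb UNIV (\<lambda>_. P) J (Pi\<^sub>E J F) \<inter> space (?M \<Otimes>\<^sub>M ?M) \<longleftrightarrow>
        z \<in> {x\<in>space ?M. \<forall>j\<in>J \<inter> U. x j \<in> F j} \<times> {x\<in>space ?M. \<forall>j\<in>J - U. x j \<in> F j}"
        unfolding emb by (cases z) (simp add: space_pair_measure, blast)
    qed
    also have "emeasure (?M \<Otimes>\<^sub>M ?M) \<dots>
        = emeasure ?M {x\<in>space ?M. \<forall>j\<in>J \<inter> U. x j \<in> F j} * emeasure ?M {x\<in>space ?M. \<forall>j\<in>J - U. x j \<in> F j}"
      using J by (intro M.emeasure_pair_measure_Times cyl) auto
    also have "\<dots> = (\<Prod>j\<in>J \<inter> U. emeasure P (F j)) * (\<Prod>j\<in>J - U. emeasure P (F j))"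
      using J unfolding iid_measure_def by (subst (1 2) pp.emeasure_PiM_Collect) auto
    also have "\<dots> = (\<Prod>j\<in>J. emeasure P (F j))"
      using J by (subst prod.union_disjoint[symmetric]) (auto intro!: prod.cong)
    finally show ?case .
  qed simp
qed

section \<open>The observable read through the factor map as a stationary field\<close>

locale factor_observable =
  fixes L :: "'l topology" and P :: "'l measure" and Y :: "(int ^ 'd \<Rightarrow> 'l) set"
    and \<pi> :: "(int ^ 'd \<Rightarrow> 'l) \<Rightarrow> (int ^ 'd \<Rightarrow> 'a::finite)" and R :: "(int ^ 'd \<Rightarrow> 'l) \<Rightarrow> nat"
    and X :: "(int ^ 'd \<Rightarrow> 'a) set" and \<mu> :: "(int ^ 'd \<Rightarrow> 'a) measure" and v :: "(int ^ 'd \<Rightarrow> 'a) \<Rightarrow> real"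
  assumes factor: "finitary_factor L P Y \<pi> R X \<mu>" and cont: "continuous_fun_on X v"
    and mean0: "(\<integral>x. v x \<partial>\<mu>) = 0"
begin

abbreviation "MP \<equiv> iid_measure P :: (int ^ 'd \<Rightarrow> 'l) measure"

lemma factorD:
  "closedin prodiscrete X" "\<And>i. shift_by i ` X = X" "prob_space \<mu>" "space \<mu> = X"
  "sets \<mu> = sets (borel_of (subtopology prodiscrete X))"
  "prob_space P" "\<And>i. shift_by i ` Y = Y" "measure MP Y = 1"
  "\<pi> \<in> restrict_space MP Y \<rightarrow>\<^sub>M \<mu>" "distr (restrict_space MP Y) \<mu> \<pi> = \<mu>"
  "\<And>i y. y \<in> Y \<Longrightarrow> shift_by i (\<pi> y) = \<pi> (shift_by i y)"
  "R \<in> restrict_space MP Y \<rightarrow>\<^sub>M count_space UNIV"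
  "\<And>y y'. y \<in> Y \<Longrightarrow> y' \<in> Y \<Longrightarrow> (\<And>j. j \<in> centered_box (R y) \<Longrightarrow> y j = y' j) \<Longrightarrow> \<pi> y 0 = \<pi> y' 0"
proof -
  note ff = factor[unfolded finitary_factor_def subshift_def invariant_prob_def standard_borel_prob_def]
  show "closedin prodiscrete X" "prob_space \<mu>" "space \<mu> = X" "prob_space P" "measure MP Y = 1"
    "sets \<mu> = sets (borel_of (subtopology prodiscrete X))" "\<pi> \<in> restrict_space MP Y \<rightarrow>\<^sub>M \<mu>"
    "distr (restrict_space MP Y) \<mu> \<pi> = \<mu>" "R \<in> restrict_space MP Y \<rightarrow>\<^sub>M count_space UNIV"
    unfolding atomize_conj using ff by (elim conjE, intro conjI)
  have "\<forall>i. shift_by i ` X = X" using ff by (elim conjE)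
  thus "\<And>i. shift_by i ` X = X" by (rule spec)
  have "\<forall>i. shift_by i ` Y = Y" using ff by (elim conjE)
  thus "\<And>i. shift_by i ` Y = Y" by (rule spec)
  have "\<forall>i. \<forall>y\<in>Y. shift_by i (\<pi> y) = \<pi> (shift_by i y)" using ff by (elim conjE)
  thus "\<And>i y. y \<in> Y \<Longrightarrow> shift_by i (\<pi> y) = \<pi> (shift_by i y)" by blast
  have "\<forall>y\<in>Y. \<forall>y'\<in>Y. (\<forall>j\<in>centered_box (R y). y j = y' j) \<longrightarrow> \<pi> y 0 = \<pi> y' 0" using ff by (elim conjE)
  thus "\<And>y y'. y \<in> Y \<Longrightarrow> y' \<in> Y \<Longrightarrow> (\<And>j. j \<in> centered_box (R y) \<Longrightarrow> y j = y' j) \<Longrightarrow> \<pi> y 0 = \<pi> y' 0"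
    by blast
qed

sublocale MP: prob_space MP
  by (rule prob_space_iid_measure) (rule factorD)

lemma Y_sets [measurable]: "Y \<in> sets MP"
  using factorD(8) by (metis measure_notin_sets zero_neq_one)

lemma Y_sub: "Y \<subseteq> space MP"
  using Y_sets by (rule sets.sets_into_space)

lemma Y_Int [simp]: "Y \<inter> space MP = Y" using Y_sub by auto

lemma shift_mem_Y: "shift_by i y \<in> Y \<longleftrightarrow> y \<in> Y"
proof
  assume "shift_by i y \<in> Y"
  hence "shift_by (- i) (shift_by i y) \<in> Y" using factorD(7)[of "- i"] by blast
  thus "y \<in> Y" by (simp add: shift_by_shift_by)
qed (use factorD(7)[of i] in blast)

lemma \<pi>_in: "y \<in> Y \<Longrightarrow> \<pi> y \<in> X"
  using measurable_space[OF factorD(9), of y] Y_sub by (auto simp: space_restrict_space factorD(4))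

lemma topspace_prodiscrete [simp]: "topspace prodiscrete = UNIV"
  by (simp add: prodiscrete_def config_topology_def)

lemma continuous_map_shift: "continuous_map (subtopology prodiscrete X) (subtopology prodiscrete X) (shift_by i)"
proof (rule continuous_map_into_subtopology)
  show "continuous_map (subtopology prodiscrete X) prodiscrete (shift_by i)"
    unfolding prodiscrete_def config_topology_def shift_by_def continuous_map_componentwise_UNIV
    by (intro allI continuous_map_from_subtopology continuous_map_product_projection) simp
  show "shift_by i \<in> topspace (subtopology prodiscrete X) \<rightarrow> X"
  proof
    fix x assume "x \<in> topspace (subtopology prodiscrete X)"
    hence "shift_by i x \<in> shift_by i ` X" by simp
    thus "shift_by i x \<in> X" unfolding factorD(2) .
  qed
qed

lemma continuous_imp_measurable:
  fixes f :: "(int ^ 'd \<Rightarrow> 'a) \<Rightarrow> real"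
  assumes "continuous_map (subtopology prodiscrete X) euclideanreal f"
  shows "f \<in> borel_measurable \<mu>"
proof (rule borel_measurableI)
  fix S :: "real set" assume "open S"
  hence "openin (subtopology prodiscrete X) {x \<in> topspace (subtopology prodiscrete X). f x \<in> S}"
    using assms by (auto simp: continuous_map_def)
  hence "{x\<in>X. f x \<in> S} \<in> sets (borel_of (subtopology prodiscrete X))"
    unfolding borel_of_def
  proof (intro in_measure_of)
    show "{U. openin (subtopology prodiscrete X) U} \<subseteq> Pow (topspace (subtopology prodiscrete X))"
      using openin_subset by blast
  qed simp
  moreover have "{x\<in>X. f x \<in> S} = f -` S \<inter> space \<mu>" by (auto simp: factorD(4))
  ultimately show "f -` S \<inter> space \<mu> \<in> sets \<mu>" by (simp add: factorD(5))
qed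

lemma v_shift_measurable [measurable]: "(\<lambda>x. v (shift_by i x)) \<in> borel_measurable \<mu>"
proof (rule continuous_imp_measurable)
  have "continuous_map (subtopology prodiscrete X) euclideanreal (v \<circ> shift_by i)"
    using cont unfolding continuous_fun_on_def by (rule continuous_map_compose[OF continuous_map_shift])
  thus "continuous_map (subtopology prodiscrete X) euclideanreal (\<lambda>x. v (shift_by i x))" by (simp add: o_def)
qed

lemma v_measurable [measurable]: "v \<in> borel_measurable \<mu>"
  using v_shift_measurable[of 0] by simp

text \<open>By Tychonoff the full shift over a finite alphabet is compact, hence so is its closed
  subset \<open>X\<close>.\<close>

lemma v_bounded: obtains V where "0 < V" "\<And>x. x \<in> X \<Longrightarrow> \<bar>v x\<bar> \<le> V"
proof -
  have "compact_space (prodiscrete :: (int ^ 'd \<Rightarrow> 'a) topology)"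
    unfolding prodiscrete_def config_topology_def compact_space_product_topology
    by (simp add: compact_space_discrete_topology)
  hence "compactin prodiscrete X" using factorD(1) by (rule closedin_compact_space)
  hence "compactin (subtopology prodiscrete X) X" by simp
  hence "compactin euclideanreal (v ` X)"
    using cont unfolding continuous_fun_on_def by (rule image_compactin)
  hence "bounded (v ` X)" by (simp add: compact_imp_bounded)
  then obtain V where "0 < V" "\<forall>y\<in>v ` X. norm y \<le> V" unfolding bounded_pos by blast
  thus thesis using that[of V] by auto
qed

text \<open>The value 0 off \<open>Y\<close> makes the observable measurable and bounded on all
  configurations; since \<open>Y\<close> has full measure, integrals do not notice it.\<close>

definition obs :: "(int ^ 'd \<Rightarrow> 'l) \<Rightarrow> real"
  where "obs y = (if y \<in> Y then v (\<pi> y) else 0)"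

definition field :: "int ^ 'd \<Rightarrow> (int ^ 'd \<Rightarrow> 'l) \<Rightarrow> real"
  where "field i y = obs (shift_by i y)"

lemma field_eq: "y \<in> Y \<Longrightarrow> field i y = v (shift_by i (\<pi> y))"
  by (simp add: field_def obs_def shift_mem_Y factorD(11))

lemma shift_measurable [measurable]: "shift_by i \<in> MP \<rightarrow>\<^sub>M MP"
  by (rule distr_shift_by) (rule factorD)

lemma obs_measurable [measurable]: "obs \<in> borel_measurable MP"
proof -
  have "(\<lambda>y. v (\<pi> y)) \<in> borel_measurable (restrict_space MP Y)"
    using measurable_compose[OF factorD(9) v_measurable] .
  moreover have "(\<lambda>y. v (\<pi> y)) \<in> borel_measurable (restrict_space MP Y) \<longleftrightarrow> (\<lambda>y. if y \<in> Y then v (\<pi> y) else 0) \<in> borel_measurable MP"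
    by (rule measurable_restrict_space_iff) simp_all
  ultimately show ?thesis unfolding obs_def [abs_def] by (rule iffD1[rotated])
qed

lemma field_measurable [measurable]: "field i \<in> borel_measurable MP"
  unfolding field_def [abs_def] by measurable

lemma AE_Y: "AE y in MP. y \<in> Y"
  using factorD(8) by (subst MP.prob_eq_1[symmetric]) auto

lemma integral_factor:
  fixes F :: "(int ^ 'd \<Rightarrow> 'a) \<Rightarrow> real"
  assumes "F \<in> borel_measurable \<mu>" and G: "G \<in> borel_measurable MP" and "\<And>y. y \<in> Y \<Longrightarrow> G y = F (\<pi> y)"
  shows "(\<integral>y. G y \<partial>MP) = (\<integral>x. F x \<partial>\<mu>)"
proof -
  have "(\<integral>x. F x \<partial>\<mu>) = (\<integral>y. F (\<pi> y) \<partial>restrict_space MP Y)"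
    by (subst factorD(10)[symmetric], rule integral_distr[OF factorD(9) assms(1)])
  also have "\<dots> = (\<integral>y. indicator Y y *\<^sub>R F (\<pi> y) \<partial>MP)" by (rule integral_restrict_space) simp
  also have "\<dots> = (\<integral>y. indicator Y y *\<^sub>R G y \<partial>MP)"
    by (intro Bochner_Integration.integral_cong refl) (auto simp: indicator_def assms(3))
  also have "\<dots> = (\<integral>y. G y \<partial>MP)"
    using AE_Y G by (intro integral_cong_AE) (auto elim!: eventually_mono)
  finally show ?thesis by simp
qed

lemma field_mean: "(\<integral>y. field i y \<partial>MP) = 0"
proof -
  have "(\<integral>y. field i y \<partial>MP) = (\<integral>y. obs y \<partial>distr MP MP (shift_by i))"
    unfolding field_def by (rule integral_distr[symmetric]) measurable
  also have "\<dots> = (\<integral>y. obs y \<partial>MP)" by (simp add: distr_shift_by(2) factorD(6))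
  also have "\<dots> = (\<integral>x. v x \<partial>\<mu>)"
    by (rule integral_factor[OF v_measurable obs_measurable]) (simp add: obs_def)
  finally show ?thesis by (simp add: mean0)
qed

definition cov :: "int ^ 'd \<Rightarrow> real"
  where "cov k = (\<integral>x. v x * v (shift_by k x) \<partial>\<mu>)"

lemma field_cov: "(\<integral>y. field i y * field j y \<partial>MP) = cov (j - i)"
proof -
  have "(\<integral>y. field i y * field j y \<partial>MP) = (\<integral>y. obs (shift_by i y) * field (j - i) (shift_by i y) \<partial>MP)"
    by (simp add: field_def shift_by_shift_by)
  also have "\<dots> = (\<integral>y. obs y * field (j - i) y \<partial>distr MP MP (shift_by i))"
    by (rule integral_distr[symmetric]) measurable
  also have "\<dots> = (\<integral>y. obs y * field (j - i) y \<partial>MP)" by (simp add: distr_shift_by(2) factorD(6))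
  also have "\<dots> = cov (j - i)" unfolding cov_def
    by (rule integral_factor) (measurable, auto simp: obs_def field_eq)
  finally show ?thesis .
qed

lemma measure_factor:
  "measure \<mu> {x\<in>space \<mu>. (\<Sum>i\<in>S. v (shift_by i x)) / r \<le> t} = measure MP {y\<in>space MP. (\<Sum>i\<in>S. field i y) / r \<le> t}"
proof -
  let ?A = "{x\<in>space \<mu>. (\<Sum>i\<in>S. v (shift_by i x)) / r \<le> t}"
  let ?B = "{y\<in>space MP. (\<Sum>i\<in>S. field i y) / r \<le> t}"
  have [measurable]: "?A \<in> sets \<mu>" by measurable
  have "measure \<mu> ?A = measure (restrict_space MP Y) (\<pi> -` ?A \<inter> space (restrict_space MP Y))"
    by (subst (1) factorD(10)[symmetric], rule measure_distr[OF factorD(9)]) measurable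
  also have "\<pi> -` ?A \<inter> space (restrict_space MP Y) = ?B \<inter> Y"
    using \<pi>_in Y_sub by (auto simp: space_restrict_space factorD(4) field_eq)
  also have "measure (restrict_space MP Y) (?B \<inter> Y) = measure MP (?B \<inter> Y)"
    by (rule measure_restrict_space) auto
  also have "\<dots> = measure MP ?B"
    using AE_Y by (intro MP.finite_measure_eq_AE) (auto elim!: eventually_mono)
  finally show ?thesis .
qed

end

subsection \<open>Coupling error of an observable of the factor\<close>

context factor_observable
begin

lemma osc_facts:
  assumes V: "\<And>x. x \<in> X \<Longrightarrow> \<bar>v x\<bar> \<le> V"
  shows "x \<in> X \<Longrightarrow> x' \<in> X \<Longrightarrow> (\<And>j. sup_norm j \<le> k \<Longrightarrow> x j = x' j) \<Longrightarrow> \<bar>v x - v x'\<bar> \<le> osc X v k"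
    and "0 \<le> osc X v k" and "osc X v k \<le> 2 * V" and "k \<le> l \<Longrightarrow> osc X v l \<le> osc X v k"
proof -
  define S where "S k = {\<bar>v x - v x'\<bar> | x x'. x \<in> X \<and> x' \<in> X \<and> (\<forall>j\<in>centered_box k. x j = x' j)}" for k
  have osc: "osc X v k = Sup (S k)" for k by (simp add: osc_def S_def)
  have le: "y \<le> 2 * V" if y: "y \<in> S k" for y k
  proof -
    obtain x x' where "y = \<bar>v x - v x'\<bar>" "x \<in> X" "x' \<in> X" using y unfolding S_def by blast
    thus ?thesis using V[of x] V[of x'] by simp
  qed
  have bdd: "bdd_above (S k)" for k by (rule bdd_aboveI) (rule le)
  show 1: "\<bar>v x - v x'\<bar> \<le> osc X v k" if "x \<in> X" "x' \<in> X" "\<And>j. sup_norm j \<le> k \<Longrightarrow> x j = x' j" for x x' k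
    unfolding osc
  proof (rule cSup_upper[OF _ bdd])
    have "\<forall>j\<in>centered_box k. x j = x' j" using that(3) by (simp add: centered_box_iff)
    thus "\<bar>v x - v x'\<bar> \<in> S k" unfolding S_def using that(1,2) by blast
  qed
  \<comment> \<open>A real supremum is informative only over a nonempty set; \<open>X\<close> has a
    point because it carries a probability measure.\<close>
  interpret mu: prob_space \<mu> by (rule factorD)
  obtain x0 where x0: "x0 \<in> X" using mu.not_empty factorD(4) by auto
  have ne: "S k \<noteq> {}" for k using x0 by (auto simp: S_def)
  show "0 \<le> osc X v k" using 1[OF x0 x0, of k] by simp
  show "osc X v k \<le> 2 * V" unfolding osc by (rule cSup_least[OF ne]) (rule le)
  show "osc X v l \<le> osc X v k" if "k \<le> l"
    unfolding osc
  proof (rule cSup_subset_mono[OF ne bdd])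
    have "centered_box k \<subseteq> (centered_box l :: (int ^ 'd) set)" using that by (auto simp: centered_box_iff)
    thus "S l \<subseteq> S k" unfolding S_def by blast
  qed
qed

definition bad :: "nat \<Rightarrow> (int ^ 'd \<Rightarrow> 'l) set"
  where "bad r = {y\<in>Y. r < R y}"

lemma bad_sets [measurable]: "bad r \<in> sets MP"
proof -
  have "R -` {r<..} \<inter> space (restrict_space MP Y) \<in> sets (restrict_space MP Y)"
    using factorD(12) by (rule measurable_sets) simp
  hence "R -` {r<..} \<inter> Y \<in> sets (restrict_space MP Y)" by (simp add: space_restrict_space)
  hence "R -` {r<..} \<inter> Y \<in> sets MP" by (subst (asm) sets_restrict_space_iff) auto
  also have "R -` {r<..} \<inter> Y = bad r" by (auto simp: bad_def)
  finally show ?thesis .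
qed

text \<open>For integers \<open>r < R y\<close> means \<open>1 + r \<le> R y\<close>; then Markov's
  inequality for the power \<open>s\<close>.\<close>

lemma bad_tail:
  assumes "integrable (restrict_space MP Y) (\<lambda>y. real (R y) powr s)" and "0 < s"
  obtains C where "0 \<le> C" "\<And>r. measure MP (bad r) \<le> C * (1 + real r) powr - s"
proof -
  let ?N = "restrict_space MP Y"
  let ?C = "\<integral>y. real (R y) powr s \<partial>?N"
  show thesis
  proof (rule that[of ?C])
    show "0 \<le> ?C" by (rule integral_nonneg_AE) simp
    fix r :: nat
    have [measurable]: "R \<in> ?N \<rightarrow>\<^sub>M count_space UNIV" by (rule factorD)
    have "measure MP (bad r) = measure ?N (bad r)"
      by (rule measure_restrict_space[symmetric]) (auto simp: bad_def)
    also have "\<dots> \<le> measure ?N {y\<in>space ?N. (1 + real r) powr s \<le> real (R y) powr s}"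
    proof (rule finite_measure.finite_measure_mono)
      show "finite_measure ?N"
        by (rule prob_space.finite_measure, rule prob_space_restrict_space)
           (use factorD(8) in \<open>auto simp: MP.emeasure_eq_measure\<close>)
      show "bad r \<subseteq> {y\<in>space ?N. (1 + real r) powr s \<le> real (R y) powr s}"
        using assms(2) by (auto simp: bad_def space_restrict_space intro!: powr_mono2 subsetD[OF Y_sub])
    qed measurable
    also have "\<dots> \<le> ?C / (1 + real r) powr s"
      by (rule integral_Markov_inequality_measure[OF assms(1) sets.top]) auto
    finally show "measure MP (bad r) \<le> ?C * (1 + real r) powr - s"
      by (simp add: powr_minus divide_inverse)
  qed
qed

text \<open>If the sites within \<open>k'\<close> of \<open>i\<close> all have coding radius at most
  \<open>k - k'\<close>, they are coded from the ball of radius \<open>k\<close>, where the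
  configurations agree. The two images then coincide on a ball of radius \<open>k'\<close>, and
  \<open>osc\<close> applies. Otherwise the trivial bound \<open>2 * V\<close> is charged to each
  bad site.\<close>

lemma coupling_error:
  fixes N :: "'w measure" and V :: real
  assumes V: "\<And>x. x \<in> X \<Longrightarrow> \<bar>v x\<bar> \<le> V" "0 < V"
    and N: "prob_space N" and Z [measurable]: "Z \<in> N \<rightarrow>\<^sub>M MP" "Z' \<in> N \<rightarrow>\<^sub>M MP"
    and D: "distr N MP Z = MP" "distr N MP Z' = MP"
    and agree: "\<And>w j. w \<in> space N \<Longrightarrow> sup_norm (j - i) \<le> k \<Longrightarrow> Z w j = Z' w j" and k': "k' \<le> k"
  shows "(\<integral>w. \<bar>field i (Z w) - field i (Z' w)\<bar> \<partial>N)
    \<le> osc X v k' + 2 * V * (2 * real k' + 1) ^ CARD('d) * measure MP (bad (k - k'))"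
proof -
  interpret N: prob_space N by (rule N)
  let ?B = "centered_box k' :: (int ^ 'd) set"
  \<comment> \<open>Only the coding radius of the first configuration has to be small: the coding
    property compares a point with any other point of \<open>Y\<close> that agrees with it on that
    ball.\<close>
  define E where "E l = {w\<in>space N. shift_by (i + l) (Z w) \<in> bad (k - k')}" for l
  have shm: "(\<lambda>w. shift_by l (Z w)) \<in> N \<rightarrow>\<^sub>M MP" for l by measurable
  have E_sets [measurable]: "E l \<in> sets N" for l
    using measurable_sets[OF shm bad_sets, of "i + l" "k - k'"] by (simp add: E_def vimage_def Int_def conj_commute)
  have PE: "measure N (E l) = measure MP (bad (k - k'))" for l
  proof -
    have "measure MP (bad (k - k')) = measure (distr (distr N MP Z) MP (shift_by (i + l))) (bad (k - k'))"
      by (simp add: D distr_shift_by(2) factorD(6))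
    also have "distr (distr N MP Z) MP (shift_by (i + l)) = distr N MP (\<lambda>w. shift_by (i + l) (Z w))"
      by (simp add: distr_distr o_def)
    also have "measure \<dots> (bad (k - k')) = measure N (E l)"
      by (subst measure_distr[OF shm bad_sets]) (auto simp: E_def intro!: arg_cong[where f="measure N"])
    finally show ?thesis by simp
  qed
  have "AE y in distr N MP Z. y \<in> Y" "AE y in distr N MP Z'. y \<in> Y" unfolding D by (rule AE_Y)+
  hence aY: "AE w in N. Z w \<in> Y" "AE w in N. Z' w \<in> Y" by (auto dest: AE_distrD[rotated] intro: Z)
  have osc0: "0 \<le> osc X v k'" by (rule osc_facts(2)[OF V(1)])
  have point: "\<bar>field i (Z w) - field i (Z' w)\<bar> \<le> osc X v k' + 2 * V * (\<Sum>l\<in>?B. indicator (E l) w)"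
    if w: "w \<in> space N" and yy: "Z w \<in> Y" "Z' w \<in> Y" for w
  proof -
    let ?x = "shift_by i (\<pi> (Z w))" and ?x' = "shift_by i (\<pi> (Z' w))"
    have X: "?x \<in> X" "?x' \<in> X"
      using imageI[OF \<pi>_in[OF yy(1)], of "shift_by i"] imageI[OF \<pi>_in[OF yy(2)], of "shift_by i"]
      unfolding factorD(2) .
    have f: "field i (Z w) = v ?x" "field i (Z' w) = v ?x'" using yy by (simp_all add: field_eq)
    have ind0: "0 \<le> (\<Sum>l\<in>?B. indicator (E l) w :: real)" by (intro sum_nonneg) auto
    show ?thesis
    proof (cases "\<exists>l\<in>?B. w \<in> E l")
      case True
      then obtain l where l: "l \<in> ?B" "w \<in> E l" by blast
      have "(1::real) = indicator (E l) w" using l by simp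
      also have "\<dots> \<le> (\<Sum>l\<in>?B. indicator (E l) w)" using l by (intro member_le_sum) auto
      finally have "2 * V * 1 \<le> 2 * V * (\<Sum>l\<in>?B. indicator (E l) w)" using V(2) by (intro mult_left_mono) auto
      moreover have "\<bar>v ?x - v ?x'\<bar> \<le> 2 * V * 1" using V(1)[OF X(1)] V(1)[OF X(2)] by simp
      ultimately show ?thesis using osc0 unfolding f by linarith
    next
      case False
      have "?x l = ?x' l" if l: "sup_norm l \<le> k'" for l
      proof -
        let ?y = "shift_by (i + l) (Z w)" and ?y' = "shift_by (i + l) (Z' w)"
        have Y': "?y \<in> Y" "?y' \<in> Y" using yy by (simp_all add: shift_mem_Y)
        have "w \<notin> E l" using False l by (auto simp: centered_box_iff)
        hence Ry: "R ?y \<le> k - k'" using w Y' by (auto simp: E_def bad_def)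
        have "\<pi> ?y 0 = \<pi> ?y' 0"
        proof (rule factorD(13)[OF Y'])
          fix j :: "int ^ 'd" assume j: "j \<in> centered_box (R ?y)"
          have "sup_norm (i + l + j - i) \<le> sup_norm l + sup_norm j" using sup_norm_triangle[of l j] by (simp add: algebra_simps)
          also have "\<dots> \<le> k" using l j Ry k' by (simp add: centered_box_iff)
          finally show "?y j = ?y' j" using agree[OF w, of "i + l + j"] by (simp add: shift_by_def)
        qed
        moreover have "\<pi> ?y 0 = ?x l" "\<pi> ?y' 0 = ?x' l"
          unfolding factorD(11)[OF yy(1), symmetric] factorD(11)[OF yy(2), symmetric]
          by (simp_all add: shift_by_def)
        ultimately show ?thesis by simp
      qed
      hence "\<bar>v ?x - v ?x'\<bar> \<le> osc X v k'" by (intro osc_facts(1)[OF V(1) X])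
      thus ?thesis unfolding f using mult_nonneg_nonneg[OF _ ind0, of "2 * V"] V(2) by linarith
    qed
  qed
  have iE: "integrable N (indicator (E l) :: _ \<Rightarrow> real)" for l by (simp add: N.emeasure_eq_measure)
  have "(\<integral>w. \<bar>field i (Z w) - field i (Z' w)\<bar> \<partial>N) \<le> (\<integral>w. osc X v k' + 2 * V * (\<Sum>l\<in>?B. indicator (E l) w) \<partial>N)"
  proof (rule integral_mono_AE')
    show "integrable N (\<lambda>w. osc X v k' + 2 * V * (\<Sum>l\<in>?B. indicator (E l) w))" using iE by auto
    show "AE w in N. \<bar>field i (Z w) - field i (Z' w)\<bar> \<le> osc X v k' + 2 * V * (\<Sum>l\<in>?B. indicator (E l) w)"
      using aY AE_space by eventually_elim (rule point)
  qed (use osc0 V(2) in \<open>auto intro!: AE_I2 add_nonneg_nonneg mult_nonneg_nonneg sum_nonneg\<close>)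
  also have "\<dots> = osc X v k' + 2 * V * (\<Sum>l\<in>?B. measure N (E l))"
    using iE by (simp add: N.prob_space)
  also have "(\<Sum>l\<in>?B. measure N (E l)) = (2 * real k' + 1) ^ CARD('d) * measure MP (bad (k - k'))"
    unfolding PE by (simp add: card_centered_box add.commute)
  finally show ?thesis by (simp add: mult.assoc)
qed

end

text \<open>By monotonicity \<open>a k\<close> is at most every term of the block between
  \<open>k / 2\<close> and \<open>k\<close>. The block has at least \<open>k / 2\<close> indices
  with weights at least \<open>(k / 2) powr p\<close>, so the series dominates
  \<open>(k / 2) powr (p + 1) * a k\<close>. The summand \<open>a 0\<close> of the constant settles
  \<open>k = 0\<close>.\<close>

lemma decseq_summable_powr_bound:
  fixes a :: "nat \<Rightarrow> real"
  assumes sm: "summable (\<lambda>k. real (Suc k) powr p * a (Suc k))" and "0 \<le> p"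
    and a: "\<And>k. 0 \<le> a k" "\<And>k l. k \<le> l \<Longrightarrow> a l \<le> a k"
  obtains C where "0 \<le> C" "\<And>k. a k \<le> C * (1 + real k) powr - (p + 1)"
proof -
  define S where "S = (\<Sum>k. real (Suc k) powr p * a (Suc k))"
  have S0: "0 \<le> S" unfolding S_def using a(1) by (intro suminf_nonneg sm) auto
  have "a k \<le> (a 0 + S * 4 powr (p + 1)) * (1 + real k) powr - (p + 1)" for k
  proof (cases "k = 0")
    case True
    thus ?thesis using S0 by simp
  next
    case False
    \<comment> \<open>The series carries the index \<open>Suc j\<close>, which here runs from
      \<open>k / 2\<close>, rounded up, to \<open>k\<close>.\<close>
    define J where "J = {(k - 1) div 2..<k}"
    have cJ: "real k / 2 \<le> real (card J)" using False unfolding J_def by simp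
    have "real (card J) * ((real k / 2) powr p * a k) = (\<Sum>j\<in>J. (real k / 2) powr p * a k)" by simp
    also have "\<dots> \<le> (\<Sum>j\<in>J. real (Suc j) powr p * a (Suc j))"
    proof (intro sum_mono mult_mono powr_mono2 a)
      fix j assume j: "j \<in> J"
      show "real k / 2 \<le> real (Suc j)" using j unfolding J_def by simp linarith
      show "Suc j \<le> k" using j by (simp add: J_def)
    qed (use assms(2) a in auto)
    also have "\<dots> \<le> S" unfolding S_def
      by (rule sum_le_suminf[OF sm]) (use a in \<open>auto simp: J_def\<close>)
    finally have "real (card J) * ((real k / 2) powr p * a k) \<le> S" .
    moreover have "real k / 2 * ((real k / 2) powr p * a k) \<le> real (card J) * ((real k / 2) powr p * a k)"
      using a by (intro mult_right_mono cJ) auto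
    ultimately have "real k / 2 * (real k / 2) powr p * a k \<le> S" by (simp add: mult.assoc)
    hence "(real k / 2) powr (p + 1) * a k \<le> S" using False by (simp add: powr_add mult.commute)
    moreover have "((1 + real k) / 4) powr (p + 1) * a k \<le> (real k / 2) powr (p + 1) * a k"
      using False assms(2) a by (intro mult_right_mono powr_mono2) auto
    ultimately have "((1 + real k) / 4) powr (p + 1) * a k \<le> S" by linarith
    moreover have "y \<le> S * 4 powr e * (1 + real k) powr - e" if "((1 + real k) / 4) powr e * y \<le> S" for e y
      using that by (simp add: powr_divide powr_minus divide_simps mult_ac)
    ultimately have "a k \<le> S * 4 powr (p + 1) * (1 + real k) powr - (p + 1)" by blast
    also have "\<dots> \<le> (a 0 + S * 4 powr (p + 1)) * (1 + real k) powr - (p + 1)"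
      using a by (intro mult_right_mono) auto
    finally show ?thesis .
  qed
  thus thesis using that[of "a 0 + S * 4 powr (p + 1)"] S0 a by simp
qed

context factor_observable
begin

text \<open>Two errors compete in the choice of \<open>k'\<close>. The oscillation is of order
  \<open>k' powr -(p + 1)\<close>, which becomes \<open>k powr -H\<close> for \<open>k'\<close> of
  order \<open>k powr b\<close>. The union over about \<open>k'^d\<close> sites then costs
  \<open>k powr (b * d - s)\<close>, and the hypothesis on \<open>s\<close> with
  \<open>q \<ge> 1\<close> makes this at most \<open>k powr -H\<close>. The condition
  \<open>H \<le> p + 1\<close> keeps \<open>b \<le> 1\<close>, so that the inner ball fits.\<close>

lemma coupling_rate:
  fixes V p q s H :: real
  assumes V: "\<And>x. x \<in> X \<Longrightarrow> \<bar>v x\<bar> \<le> V" "0 < V"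
    and reg: "regular_fun X p v" and int: "integrable (restrict_space MP Y) (\<lambda>y. real (R y) powr s)"
    and q: "1 \<le> q" and H: "0 < H" "H \<le> p + 1" and s: "H * (q + real CARD('d) / (p + 1)) < s"
  obtains A where "0 \<le> A" "\<And>(N :: ((int ^ 'd \<Rightarrow> 'l) \<times> (int ^ 'd \<Rightarrow> 'l)) measure) Z Z' i k.
    prob_space N \<Longrightarrow> Z \<in> N \<rightarrow>\<^sub>M MP \<Longrightarrow> Z' \<in> N \<rightarrow>\<^sub>M MP \<Longrightarrow> distr N MP Z = MP \<Longrightarrow> distr N MP Z' = MP \<Longrightarrow>
    (\<And>w j. w \<in> space N \<Longrightarrow> sup_norm (j - i) \<le> k \<Longrightarrow> Z w j = Z' w j) \<Longrightarrow>
    (\<integral>w. \<bar>field i (Z w) - field i (Z' w)\<bar> \<partial>N) \<le> A * (1 + real k) powr - H"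
proof -
  let ?d = "real CARD('d)"
  have p0: "0 \<le> p" using reg by (simp add: regular_fun_def)
  have s0: "0 < s"
  proof -
    have "0 < H * (q + ?d / (p + 1))" using H q p0 by (intro mult_pos_pos add_pos_nonneg) auto
    thus ?thesis using s by linarith
  qed
  obtain C where C: "0 \<le> C" "\<And>k. osc X v k \<le> C * (1 + real k) powr - (p + 1)"
  proof (rule decseq_summable_powr_bound[of p "osc X v"])
    show "summable (\<lambda>k. real (Suc k) powr p * osc X v (Suc k))" using reg by (simp add: regular_fun_def)
  qed (use p0 osc_facts[OF V(1)] in auto)
  obtain T where T: "0 \<le> T" "\<And>r. measure MP (bad r) \<le> T * (1 + real r) powr - s"
    using bad_tail[OF int s0] by blast
  define b where "b = H / (p + 1)"
  have b: "0 < b" "b \<le> 1" using H p0 by (auto simp: b_def)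
  define A where "A = C * 2 powr (p + 1) + 2 * V * (2 ^ CARD('d) * (T * 2 powr s))"
  show thesis
  proof (rule that[of A])
    show "0 \<le> A" using C T V by (simp add: A_def)
    fix N :: "((int ^ 'd \<Rightarrow> 'l) \<times> (int ^ 'd \<Rightarrow> 'l)) measure" and Z Z' i k
    assume N: "prob_space N" "Z \<in> N \<rightarrow>\<^sub>M MP" "Z' \<in> N \<rightarrow>\<^sub>M MP" "distr N MP Z = MP" "distr N MP Z' = MP"
      "\<And>w j. w \<in> space N \<Longrightarrow> sup_norm (j - i) \<le> k \<Longrightarrow> Z w j = Z' w j"
    define x where "x = (1 + real k) powr b"
    have x1: "1 \<le> x" unfolding x_def using b by (intro ge_one_powr_ge_zero) auto
    have xk: "x \<le> 1 + real k" unfolding x_def using b powr_mono[of b 1 "1 + real k"] by simp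
    \<comment> \<open>Halving keeps \<open>k'\<close> below \<open>(1 + k) / 2\<close>, so that
      \<open>1 + (k - k')\<close> is still comparable to \<open>1 + k\<close>.\<close>
    define k' where "k' = nat \<lfloor>x / 2\<rfloor>"
    have k': "real k' \<le> x / 2" "x / 2 < real k' + 1" using x1 unfolding k'_def by linarith+
    have k'k: "k' \<le> k"
    proof (cases "k = 0")
      case False
      have "real k' \<le> (1 + real k) / 2"
        using k'(1) divide_right_mono[OF xk, of 2] by simp
      also have "\<dots> \<le> real k" using False by simp
      finally show ?thesis by simp
    qed (use k' xk in linarith)
    have "osc X v k' \<le> C * (1 + real k') powr - (p + 1)" by (rule C)
    also have "\<dots> \<le> C * (x / 2) powr - (p + 1)"
      using k' x1 p0 C by (intro mult_left_mono powr_mono2') auto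
    also have "(x / 2) powr - e = 2 powr e * x powr - e" for e
      using x1 by (simp add: powr_divide powr_minus divide_simps)
    also have "x powr - (p + 1) = (1 + real k) powr - H"
    proof -
      have "b * - (p + 1) = - H" using p0 unfolding b_def by (simp add: divide_simps algebra_simps)
      thus ?thesis unfolding x_def powr_powr by (rule arg_cong)
    qed
    finally have 1: "osc X v k' \<le> C * 2 powr (p + 1) * (1 + real k) powr - H" by (simp only: mult.assoc)
    have 2: "(2 * real k' + 1) ^ CARD('d) * measure MP (bad (k - k')) \<le> 2 ^ CARD('d) * (T * 2 powr s) * (1 + real k) powr - H"
    proof -
      have "(2 * real k' + 1) ^ CARD('d) \<le> (2 * x) ^ CARD('d)" using k' x1 by (intro power_mono) auto
      also have "\<dots> = 2 ^ CARD('d) * (1 + real k) powr (b * ?d)"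
        using x1 by (simp add: power_mult_distrib powr_realpow[symmetric] x_def powr_powr)
      finally have e1: "(2 * real k' + 1) ^ CARD('d) \<le> 2 ^ CARD('d) * (1 + real k) powr (b * ?d)" .
      have "(1 + real k) / 2 \<le> 1 + real (k - k')" using k' xk k'k by (simp add: of_nat_diff)
      hence "T * (1 + real (k - k')) powr - s \<le> T * ((1 + real k) / 2) powr - s"
        using T s0 by (intro mult_left_mono powr_mono2') auto
      also have "\<dots> = T * 2 powr s * (1 + real k) powr - s"
        by (simp add: powr_divide powr_minus divide_simps)
      finally have e2: "measure MP (bad (k - k')) \<le> T * 2 powr s * (1 + real k) powr - s"
        using T(2)[of "k - k'"] by linarith
      have "(2 * real k' + 1) ^ CARD('d) * measure MP (bad (k - k'))
        \<le> (2 ^ CARD('d) * (1 + real k) powr (b * ?d)) * (T * 2 powr s * (1 + real k) powr - s)"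
        by (intro mult_mono e1 e2) auto
      also have "\<dots> = 2 ^ CARD('d) * (T * 2 powr s) * (1 + real k) powr (b * ?d - s)"
        by (simp add: powr_diff powr_minus divide_simps)
      also have "\<dots> \<le> 2 ^ CARD('d) * (T * 2 powr s) * (1 + real k) powr - H"
      proof (intro mult_left_mono powr_mono)
        have "H * (q + ?d / (p + 1)) = H * q + b * ?d" by (simp add: b_def distrib_left)
        moreover have "H \<le> H * q" using H q by simp
        ultimately show "b * ?d - s \<le> - H" using s by linarith
      qed (use T in auto)
      finally show ?thesis .
    qed
    have "(\<integral>w. \<bar>field i (Z w) - field i (Z' w)\<bar> \<partial>N)
      \<le> osc X v k' + 2 * V * (2 * real k' + 1) ^ CARD('d) * measure MP (bad (k - k'))"
      by (rule coupling_error[OF V N k'k])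
    also have "\<dots> = osc X v k' + 2 * V * ((2 * real k' + 1) ^ CARD('d) * measure MP (bad (k - k')))" by (simp add: mult.assoc)
    also have "\<dots> \<le> C * 2 powr (p + 1) * (1 + real k) powr - H + 2 * V * (2 ^ CARD('d) * (T * 2 powr s) * (1 + real k) powr - H)"
      using V(2) by (intro add_mono 1 mult_left_mono 2) auto
    also have "\<dots> = A * (1 + real k) powr - H" by (simp add: A_def algebra_simps)
    finally show "(\<integral>w. \<bar>field i (Z w) - field i (Z' w)\<bar> \<partial>N) \<le> A * (1 + real k) powr - H" .
  qed
qed

lemma weak_field_obs:
  fixes p q s H :: real
  assumes reg: "regular_fun X p v" and int: "integrable (restrict_space MP Y) (\<lambda>y. real (R y) powr s)"
    and q: "1 \<le> q" and H: "real CARD('d) < H" "H \<le> p + 1" and s: "H * (q + real CARD('d) / (p + 1)) < s"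
  obtains V A where "weak_field MP field splice_sites V A H cov"
proof -
  obtain V where V: "0 < V" "\<And>x. x \<in> X \<Longrightarrow> \<bar>v x\<bar> \<le> V" using v_bounded by blast
  have H0: "0 < H" using H(1) by (rule le_less_trans[rotated]) simp
  obtain A where A: "0 \<le> A" "\<And>(N :: ((int ^ 'd \<Rightarrow> 'l) \<times> (int ^ 'd \<Rightarrow> 'l)) measure) Z Z' i k.
    prob_space N \<Longrightarrow> Z \<in> N \<rightarrow>\<^sub>M MP \<Longrightarrow> Z' \<in> N \<rightarrow>\<^sub>M MP \<Longrightarrow> distr N MP Z = MP \<Longrightarrow> distr N MP Z' = MP \<Longrightarrow>
    (\<And>w j. w \<in> space N \<Longrightarrow> sup_norm (j - i) \<le> k \<Longrightarrow> Z w j = Z' w j) \<Longrightarrow>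
    (\<integral>w. \<bar>field i (Z w) - field i (Z' w)\<bar> \<partial>N) \<le> A * (1 + real k) powr - H"
    using coupling_rate[OF V(2,1) reg int q H0 H(2) s] by blast
  interpret MM: pair_prob_space MP MP ..
  have fst: "distr (MP \<Otimes>\<^sub>M MP) MP fst = MP"
    by (rule MP.distr_pair_fst)
  have snd: "distr (MP \<Otimes>\<^sub>M MP) MP snd = MP"
  proof (rule measure_eqI)
    fix B assume "B \<in> sets (distr (MP \<Otimes>\<^sub>M MP) MP snd)"
    hence B: "B \<in> sets MP" by simp
    have "snd -` B \<inter> space (MP \<Otimes>\<^sub>M MP) = space MP \<times> B"
      using sets.sets_into_space[OF B] by (auto simp: space_pair_measure)
    thus "emeasure (distr (MP \<Otimes>\<^sub>M MP) MP snd) B = emeasure MP B"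
      using B by (simp add: emeasure_distr MP.emeasure_pair_measure_Times MP.emeasure_space_1)
  qed simp
  note sp = distr_splice_sites[OF factorD(6)]
  have "weak_field MP field splice_sites V A H cov"
  proof
    show "\<bar>field i \<omega>\<bar> \<le> V" for i \<omega>
      using V(1) V(2)[OF \<pi>_in] by (auto simp: field_def obs_def)
    show "splice_sites U \<in> MP \<Otimes>\<^sub>M MP \<rightarrow>\<^sub>M MP" "distr (MP \<Otimes>\<^sub>M MP) MP (splice_sites U) = MP" for U
      by (rule sp)+
    show "(\<integral>z. \<bar>field i (splice_sites U z) - field i (fst z)\<bar> \<partial>(MP \<Otimes>\<^sub>M MP)) \<le> A * (1 + real k) powr - H"
      if "\<And>j. sup_norm (j - i) \<le> k \<Longrightarrow> j \<in> U" for i k U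
      by (rule A(2)[OF MM.prob_space_axioms sp(1) measurable_fst sp(2) fst])
         (use that in \<open>auto simp: splice_sites_def\<close>)
    show "(\<integral>z. \<bar>field i (splice_sites U z) - field i (snd z)\<bar> \<partial>(MP \<Otimes>\<^sub>M MP)) \<le> A * (1 + real k) powr - H"
      if "\<And>j. sup_norm (j - i) \<le> k \<Longrightarrow> j \<notin> U" for i k U
      by (rule A(2)[OF MM.prob_space_axioms sp(1) measurable_snd sp(2) snd])
         (use that in \<open>auto simp: splice_sites_def\<close>)
  qed (use V A H in \<open>auto simp: field_mean field_cov\<close>)
  thus thesis by (rule that)
qed

end

theorem theorem2p6:
  fixes X :: "(int ^ 'd \<Rightarrow> 'a::finite) set"
    and \<mu> :: "(int ^ 'd \<Rightarrow> 'a) measure"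
    and L :: "'l topology"
    and P :: "'l measure"
    and Y :: "(int ^ 'd \<Rightarrow> 'l) set"
    and \<pi> :: "(int ^ 'd \<Rightarrow> 'l) \<Rightarrow> (int ^ 'd \<Rightarrow> 'a)"
    and R :: "(int ^ 'd \<Rightarrow> 'l) \<Rightarrow> nat"
    and v :: "(int ^ 'd \<Rightarrow> 'a) \<Rightarrow> real"
    and d \<epsilon> q p s :: real
  defines "d \<equiv> real CARD('d)"
  assumes "finitary_factor L P Y \<pi> R X \<mu>"
    and "continuous_fun_on X v"
    and "(\<integral>x. v x \<partial>\<mu>) = 0"
    and "0 < \<epsilon>" and "\<epsilon> < d / 2"
    and "3 \<le> q"
    and "regular_fun X p v"
    and "integrable (restrict_space (iid_measure P) Y) (\<lambda>y. real (R y) powr s)"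
    and "h_exp d \<epsilon> q \<le> p"
    and "(h_exp d \<epsilon> q + 1) * (q + d / (p + 1)) < s"
    and "0 < asymp_var \<mu> v"
  shows "\<exists>C>0. \<forall>n\<ge>1.
    (SUP t. \<bar>measure \<mu> {x \<in> space \<mu>. (\<Sum>i\<in>corner_box n. v (shift_by i x)) / real n powr (d / 2) \<le> t}
             - cdf std_normal_distribution (t / sqrt (asymp_var \<mu> v))\<bar>)
    \<le> C * max (real n powr (- d / 2 + \<epsilon>)) (real n powr (-1))"
proof -
  interpret factor_observable L P Y \<pi> R X \<mu> v by standard (rule assms)+
  define H where "H = h_exp d \<epsilon> q + 1"
  define D where "D = d\<^sup>2 / \<epsilon> - 2 * d"
  define \<sigma> where "\<sigma> = sqrt (asymp_var \<mu> v)"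
  have \<sigma>: "0 < \<sigma>" using assms(12) by (simp add: \<sigma>_def)
  have d1: "1 \<le> d" unfolding d_def by (simp add: Suc_leI)
  have D0: "0 \<le> D"
  proof -
    have "2 * d * \<epsilon> \<le> d * d" using assms(5,6) d1 by (simp add: mult.commute mult_left_mono)
    thus ?thesis using assms(5) by (simp add: D_def power2_eq_square field_simps)
  qed
  \<comment> \<open>Here \<open>3 \<le> q\<close> enters: \<open>d / q \<le> d / 3\<close> turns the
    coefficient of \<open>d\<close> into at least \<open>7/6\<close>. The factor
    \<open>(q + 1) / q\<close> is at least 1 and helps because \<open>D\<close> is
    nonnegative.\<close>
  have H: "D + d + 1 / 2 + d / 6 \<le> H"
  proof -
    have "d / q \<le> d / 3" using assms(7) d1 by (intro divide_left_mono) auto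
    moreover have "D \<le> D * ((q + 1) / q)" using assms(7) D0 by (simp add: mult_left_mono field_simps)
    moreover have "(3 / 2 - 1 / q) * d = 3 / 2 * d - d / q" by (simp add: algebra_simps)
    ultimately show ?thesis unfolding H_def h_exp_def D_def[symmetric] by linarith
  qed
  obtain V A where "weak_field MP field splice_sites V A H cov"
  proof (rule weak_field_obs)
    show "regular_fun X p v" "integrable (restrict_space MP Y) (\<lambda>y. real (R y) powr s)" by (rule assms)+
    show "1 \<le> q" using assms(7) by simp
    show "real CARD('d) < H" "H \<le> p + 1" using H D0 d1 assms(10) by (auto simp: H_def d_def)
    show "H * (q + real CARD('d) / (p + 1)) < s" using assms(11) by (simp add: H_def d_def)
  qed
  then interpret W: weak_field MP field splice_sites V A H cov .
  have "asymp_var \<mu> v = (\<Sum>\<^sub>\<infinity>k. cov k)" by (simp add: asymp_var_def cov_def)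
  from W.berry_esseen_rate[folded d_def, OF assms(5,6) H[unfolded D_def] this assms(12)]
  obtain C where C: "0 < C" "\<And>n z. 1 \<le> n \<Longrightarrow>
    \<bar>measure MP {\<omega>\<in>space MP. (\<Sum>i\<in>corner_box n. field i \<omega>) / (\<sigma> * real n powr (d / 2)) \<le> z} - cdf gauss z\<bar>
      \<le> C * max (real n powr (- d / 2 + \<epsilon>)) (real n powr (-1))"
    unfolding \<sigma>_def by blast
  show ?thesis
  proof (intro exI[of _ C] conjI C(1) allI impI cSUP_least)
    fix n :: nat and t :: real assume n: "1 \<le> n"
    \<comment> \<open>Normalising by \<open>\<sigma>\<close> as well moves the threshold from
      \<open>t\<close> to \<open>t / \<sigma>\<close>, which is the argument of the Gaussian
      distribution function.\<close>
    have "(w / real n powr (d / 2) \<le> t) = (w / (\<sigma> * real n powr (d / 2)) \<le> t / \<sigma>)" for w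
      using \<sigma> n by (simp add: field_simps)
    thus "\<bar>measure \<mu> {x \<in> space \<mu>. (\<Sum>i\<in>corner_box n. v (shift_by i x)) / real n powr (d / 2) \<le> t}
             - cdf std_normal_distribution (t / sqrt (asymp_var \<mu> v))\<bar>
      \<le> C * max (real n powr (- d / 2 + \<epsilon>)) (real n powr (-1))"
      using C(2)[OF n, of "t / \<sigma>"] unfolding measure_factor \<sigma>_def by simp
  qed simp
qed

end
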